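(* Let $f:M\to Z$ be a continuous map from an oriented $d$-dimensional topological manifold $M$ to a locally compact metric space $Z$. Suppose that $f$ extends to a continuous map $\overline f:\overline M\to Z$ from a thin compactification $\overline M=M\cup S$ of $M$ and that $\dim\overline f(S)\le d-2$. Then $f$ is a pseudo-cycle and $$[f]=\overline f_*[\overline M]\quad\text{in }{}^sH_d(X),$$ where $X=\overline f(\overline M)$ is the image of $\overline f$.
   Context: All spaces are Hausdorff; $\dim$ is Lebesgue covering dimension; coefficients are $\mathbb Z$. Steenrod homology ${}^sH_*$: the homology theory on locally compact Hausdorff spaces and proper maps based on infinite chains (Massey), with restrictions $\rho_U:{}^sH_*(X)\to{}^sH_*(U)$ for open $U\subseteq X$, long exact sequences $\cdots\to{}^sH_k(A)\to{}^sH_k(X)\xrightarrow{\rho}{}^sH_k(X\setminus A)\to\cdots$ for closed $A\subseteq X$, and fundamental classes $[M]\in{}^sH_d(M)$ of oriented $d$-manifolds. Thin compactification of an oriented $d$-manifold $M$: a compact Hausdorff space $\overline M\supseteq M$ with $S=\overline M\setminus M$ closed and ${}^sH_k(S)=0$ for all $k>d-2$. Then $\rho_M:{}^sH_d(\overline M)\to{}^sH_d(M)$ is an isomorphism and $[\overline M]$ is defined by $\rho_M[\overline M]=[M]$. Omega limit set: $\Omega_f=\bigcap_{K\subseteq M\text{ compact}}\overline{f(M\setminus K)}$. A $d$-dimensional pseudo-cycle is a continuous map $f:M\to Z$ from an oriented $d$-dimensional topological manifold to a locally compact metric space such that $f(M)$ has compact closure and $\dim\Omega_f\le d-2$. Its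 class $[f]\in{}^sH_d(X_f)$, $X_f=\overline{f(M)}$, is $[f]=\rho^{-1}f^o_*[M^o]$, where $M^o=f^{-1}(Z\setminus\Omega_f)$, $f^o:M^o\to X_f\setminus\Omega_f$ is the (proper) restriction of $f$, and $\rho:{}^sH_d(X_f)\to{}^sH_d(X_f\setminus\Omega_f)$ is the restriction isomorphism. In the claim $[f]$ is regarded in ${}^sH_d(X)$ via the inclusion $X_f\subseteq X$. *)

theory Defs
  imports "HOL-Analysis.Analysis" "HOL-Algebra.Elementary_Groups"
begin

section \<open>Alexander-Spanier cochains with compact support\<close>

text \<open>
  A \<open>q\<close>-cochain on \<open>X\<close> is a function \<open>X ^ (q+1) \<rightarrow> \<int>\<close> taking finitely many values. A tuple
  is a list of length \<open>q+1\<close>, and a cochain is normalised to be \<open>0\<close> on all other lists.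
\<close>

type_synonym 'a cochain = "'a list \<Rightarrow> int"

definition cochains :: "'a topology \<Rightarrow> nat \<Rightarrow> 'a cochain set" where
  "cochains X q =
     {\<phi>. finite (range \<phi>) \<and>
         (\<forall>xs. \<phi> xs \<noteq> 0 \<longrightarrow> length xs = Suc q \<and> set xs \<subseteq> topspace X)}"

text \<open>The cochain \<open>\<phi>\<close> is locally zero if and only if \<open>cochain_support X \<phi> = {}\<close>.\<close>

definition cochain_support :: "'a topology \<Rightarrow> 'a cochain \<Rightarrow> 'a set" where
  "cochain_support X \<phi> =
     {x \<in> topspace X. \<not> (\<exists>U. openin X U \<and> x \<in> U \<and> (\<forall>xs. set xs \<subseteq> U \<longrightarrow> \<phi> xs = 0))}"

definition compact_cochains :: "'a topology \<Rightarrow> nat \<Rightarrow> 'a cochain set" where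
  "compact_cochains X q = {\<phi> \<in> cochains X q. compactin X (cochain_support X \<phi>)}"

definition coboundary :: "'a topology \<Rightarrow> 'a cochain \<Rightarrow> 'a cochain" where
  "coboundary X \<phi> =
     (\<lambda>xs. if set xs \<subseteq> topspace X
           then \<Sum>i<length xs. (-1) ^ i * \<phi> (take i xs @ drop (Suc i) xs)
           else 0)"

definition cochain_pullback :: "'a topology \<Rightarrow> ('a \<Rightarrow> 'b) \<Rightarrow> 'b cochain \<Rightarrow> 'a cochain" where
  "cochain_pullback X f \<psi> = (\<lambda>xs. if set xs \<subseteq> topspace X then \<psi> (map f xs) else 0)"

text \<open>
  For open \<open>U\<close>, a cochain \<open>\<phi>\<close> on \<open>U\<close> with compact support is extended by zero to \<open>X\<close>. The
  function on \<open>X ^ (q+1)\<close> that is \<open>\<phi>\<close> on \<open>U ^ (q+1)\<close> and zero elsewhere need not be locally zero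
  at frontier points of \<open>U\<close>, so \<open>\<phi>\<close> has first to be changed by a locally zero cochain on \<open>U\<close>. The
  extension is therefore a compactly supported cochain on \<open>X\<close> with support inside \<open>U\<close> whose
  restriction to \<open>U\<close> agrees with \<open>\<phi>\<close> up to a locally zero cochain; this determines it up to a
  locally zero cochain on \<open>X\<close>.
\<close>

definition cochain_extension :: "'a topology \<Rightarrow> 'a set \<Rightarrow> nat \<Rightarrow> 'a cochain \<Rightarrow> 'a cochain" where
  "cochain_extension X U q \<phi> =
     (SOME \<psi>. \<psi> \<in> compact_cochains X q \<and> cochain_support X \<psi> \<subseteq> U \<and>
        cochain_support (subtopology X U)
          (\<lambda>xs. cochain_pullback (subtopology X U) id \<psi> xs - \<phi> xs) = {})"

section \<open>Steenrod homology\<close>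

text \<open>
  Following Massey, the group of infinite \<open>q\<close>-chains is \<open>Hom (C, \<int>)\<close>, where \<open>C\<close> is the group of
  compactly supported \<open>q\<close>-cochains modulo the locally zero ones. A homomorphism out of the
  quotient is represented by an additive function on \<open>compact_cochains X q\<close> that vanishes on
  locally zero cochains (and has the value \<open>0\<close> outside \<open>compact_cochains X q\<close>).
\<close>

type_synonym 'a infinite_chain = "'a cochain \<Rightarrow> int"

definition infinite_chains :: "'a topology \<Rightarrow> nat \<Rightarrow> 'a infinite_chain set" where
  "infinite_chains X q =
     {c. (\<forall>\<phi>. \<phi> \<notin> compact_cochains X q \<longrightarrow> c \<phi> = 0) \<and>
         (\<forall>\<phi>\<in>compact_cochains X q. \<forall>\<psi>\<in>compact_cochains X q.
             c (\<lambda>xs. \<phi> xs + \<psi> xs) = c \<phi> + c \<psi>) \<and>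
         (\<forall>\<phi>\<in>compact_cochains X q. cochain_support X \<phi> = {} \<longrightarrow> c \<phi> = 0)}"

text \<open>\<open>boundary X q\<close> maps infinite \<open>(q+1)\<close>-chains to infinite \<open>q\<close>-chains.\<close>

definition boundary :: "'a topology \<Rightarrow> nat \<Rightarrow> 'a infinite_chain \<Rightarrow> 'a infinite_chain" where
  "boundary X q b = (\<lambda>\<phi>. if \<phi> \<in> compact_cochains X q then b (coboundary X \<phi>) else 0)"

definition infinite_cycles :: "'a topology \<Rightarrow> nat \<Rightarrow> 'a infinite_chain set" where
  "infinite_cycles X q =
     {c \<in> infinite_chains X q. \<forall>p. q = Suc p \<longrightarrow> boundary X p c = (\<lambda>\<phi>. 0)}"

definition infinite_boundaries :: "'a topology \<Rightarrow> nat \<Rightarrow> 'a infinite_chain set" where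
  "infinite_boundaries X q = boundary X q ` infinite_chains X (Suc q)"

definition cycle_group :: "'a topology \<Rightarrow> nat \<Rightarrow> 'a infinite_chain monoid" where
  "cycle_group X q =
     \<lparr>carrier = infinite_cycles X q, monoid.mult = (\<lambda>c c' \<phi>. c \<phi> + c' \<phi>), one = (\<lambda>\<phi>. 0)\<rparr>"

definition steenrod_homology :: "'a topology \<Rightarrow> nat \<Rightarrow> 'a infinite_chain set monoid" where
  "steenrod_homology X q = cycle_group X q Mod infinite_boundaries X q"

text \<open>
  The maps induced on homology by a chain map send a class \<open>\<alpha>\<close> (a coset of boundaries) to the
  coset of the image of any of its members; the union below ranges over equal cosets.
\<close>

definition chain_pushforward ::
    "'a topology \<Rightarrow> 'b topology \<Rightarrow> nat \<Rightarrow> ('a \<Rightarrow> 'b) \<Rightarrow> 'a infinite_chain \<Rightarrow> 'b infinite_chain" where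
  "chain_pushforward X Y q f c =
     (\<lambda>\<psi>. if \<psi> \<in> compact_cochains Y q then c (cochain_pullback X f \<psi>) else 0)"

text \<open>The homomorphism induced by a proper continuous map \<open>f : X \<rightarrow> Y\<close>.\<close>

definition steenrod_induced ::
    "'a topology \<Rightarrow> 'b topology \<Rightarrow> nat \<Rightarrow> ('a \<Rightarrow> 'b) \<Rightarrow>
       'a infinite_chain set \<Rightarrow> 'b infinite_chain set" where
  "steenrod_induced X Y q f \<alpha> =
     (\<Union>c\<in>\<alpha>. infinite_boundaries Y q #>\<^bsub>cycle_group Y q\<^esub> chain_pushforward X Y q f c)"

definition chain_restriction ::
    "'a topology \<Rightarrow> 'a set \<Rightarrow> nat \<Rightarrow> 'a infinite_chain \<Rightarrow> 'a infinite_chain" where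
  "chain_restriction X U q c =
     (\<lambda>\<phi>. if \<phi> \<in> compact_cochains (subtopology X U) q
          then c (cochain_extension X U q \<phi>) else 0)"

text \<open>The restriction homomorphism \<open>\<rho>\<close> to an open subset \<open>U\<close> of \<open>X\<close>.\<close>

definition steenrod_restriction ::
    "'a topology \<Rightarrow> 'a set \<Rightarrow> nat \<Rightarrow> 'a infinite_chain set \<Rightarrow> 'a infinite_chain set" where
  "steenrod_restriction X U q \<alpha> =
     (\<Union>c\<in>\<alpha>. infinite_boundaries (subtopology X U) q
        #>\<^bsub>cycle_group (subtopology X U) q\<^esub> chain_restriction X U q c)"

section \<open>Covering dimension\<close>

text \<open>
  \<open>covering_dim_le X n\<close> means \<open>dim X \<le> n\<close>. The bound is an integer so that \<open>d - 2\<close> makes sense for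
  \<open>d < 2\<close>; for \<open>n < 0\<close> the condition holds exactly for the empty space.
\<close>

definition covering_dim_le :: "'a topology \<Rightarrow> int \<Rightarrow> bool" where
  "covering_dim_le X n \<longleftrightarrow>
     (\<forall>\<U>. (\<forall>U\<in>\<U>. openin X U) \<and> topspace X \<subseteq> \<Union>\<U> \<longrightarrow>
        (\<exists>\<V>. (\<forall>V\<in>\<V>. openin X V) \<and> topspace X \<subseteq> \<Union>\<V> \<and> (\<forall>V\<in>\<V>. \<exists>U\<in>\<U>. V \<subseteq> U) \<and>
             (\<forall>x\<in>topspace X. finite {V\<in>\<V>. x \<in> V} \<and> int (card {V\<in>\<V>. x \<in> V}) \<le> n + 1)))"

section \<open>Oriented manifolds and fundamental classes\<close>

definition euclidean_open :: "nat \<Rightarrow> 'a topology \<Rightarrow> 'a set \<Rightarrow> bool" where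
  "euclidean_open d M U \<longleftrightarrow>
     openin M U \<and> subtopology M U homeomorphic_space Euclidean_space d"

definition topological_manifold :: "nat \<Rightarrow> 'a topology \<Rightarrow> bool" where
  "topological_manifold d M \<longleftrightarrow>
     Hausdorff_space M \<and> (\<forall>x\<in>topspace M. \<exists>U. euclidean_open d M U \<and> x \<in> U)"

text \<open>
  An orientation is a coherent choice of local orientations: for each open \<open>U\<close> homeomorphic to
  \<open>\<real>^d\<close> a generator of the infinite cyclic group \<open>H_d(U)\<close>, compatible with restrictions. An
  orientation of \<open>M\<close> thus is also an orientation of each open subset of \<open>M\<close>.
\<close>

definition orientation ::
    "nat \<Rightarrow> 'a topology \<Rightarrow> ('a set \<Rightarrow> 'a infinite_chain set) \<Rightarrow> bool" where
  "orientation d M ori \<longleftrightarrow>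
     (\<forall>U. euclidean_open d M U \<longrightarrow>
        ori U \<in> carrier (steenrod_homology (subtopology M U) d) \<and>
        generate (steenrod_homology (subtopology M U) d) {ori U}
          = carrier (steenrod_homology (subtopology M U) d)) \<and>
     (\<forall>U V. euclidean_open d M U \<and> euclidean_open d M V \<and> V \<subseteq> U \<longrightarrow>
        steenrod_restriction (subtopology M U) V d (ori U) = ori V)"

definition fundamental_class ::
    "nat \<Rightarrow> 'a topology \<Rightarrow> ('a set \<Rightarrow> 'a infinite_chain set) \<Rightarrow> 'a infinite_chain set" where
  "fundamental_class d M ori =
     (THE \<mu>. \<mu> \<in> carrier (steenrod_homology M d) \<and>
        (\<forall>U. euclidean_open d M U \<longrightarrow> steenrod_restriction M U d \<mu> = ori U))"

section \<open>Thin compactifications\<close>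

definition thin_compactification :: "nat \<Rightarrow> 'a topology \<Rightarrow> 'a topology \<Rightarrow> bool" where
  "thin_compactification d M Mbar \<longleftrightarrow>
     compact_space Mbar \<and> Hausdorff_space Mbar \<and>
     topspace M \<subseteq> topspace Mbar \<and> subtopology Mbar (topspace M) = M \<and>
     closedin Mbar (topspace Mbar - topspace M) \<and>
     (\<forall>k. int k > int d - 2 \<longrightarrow>
        trivial_group (steenrod_homology (subtopology Mbar (topspace Mbar - topspace M)) k))"

definition thin_fundamental_class ::
    "nat \<Rightarrow> 'a topology \<Rightarrow> ('a set \<Rightarrow> 'a infinite_chain set) \<Rightarrow> 'a topology \<Rightarrow>
       'a infinite_chain set" where
  "thin_fundamental_class d M ori Mbar =
     (THE \<mu>. \<mu> \<in> carrier (steenrod_homology Mbar d) \<and>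
        steenrod_restriction Mbar (topspace M) d \<mu> = fundamental_class d M ori)"

section \<open>Pseudo-cycles\<close>

definition omega_limit_set :: "'a topology \<Rightarrow> 'b topology \<Rightarrow> ('a \<Rightarrow> 'b) \<Rightarrow> 'b set" where
  "omega_limit_set M Z f = (\<Inter>K\<in>{K. compactin M K}. Z closure_of (f ` (topspace M - K)))"

definition pseudo_cycle ::
    "nat \<Rightarrow> 'a topology \<Rightarrow> ('a set \<Rightarrow> 'a infinite_chain set) \<Rightarrow> 'b topology \<Rightarrow> ('a \<Rightarrow> 'b) \<Rightarrow> bool" where
  "pseudo_cycle d M ori Z f \<longleftrightarrow>
     topological_manifold d M \<and> orientation d M ori \<and>
     metrizable_space Z \<and> locally_compact_space Z \<and>
     continuous_map M Z f \<and>
     compactin Z (Z closure_of (f ` topspace M)) \<and>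
     covering_dim_le (subtopology Z (omega_limit_set M Z f)) (int d - 2)"

definition image_closure :: "'a topology \<Rightarrow> 'b topology \<Rightarrow> ('a \<Rightarrow> 'b) \<Rightarrow> 'b topology" where
  "image_closure M Z f = subtopology Z (Z closure_of (f ` topspace M))"

definition pseudo_cycle_class ::
    "nat \<Rightarrow> 'a topology \<Rightarrow> ('a set \<Rightarrow> 'a infinite_chain set) \<Rightarrow> 'b topology \<Rightarrow> ('a \<Rightarrow> 'b) \<Rightarrow>
       'b infinite_chain set" where
  "pseudo_cycle_class d M ori Z f =
     (let Xf = image_closure M Z f;
          W = topspace Xf - omega_limit_set M Z f;
          Mo = subtopology M {x \<in> topspace M. f x \<notin> omega_limit_set M Z f}
      in THE \<alpha>. \<alpha> \<in> carrier (steenrod_homology Xf d) \<and>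
           steenrod_restriction Xf W d \<alpha>
             = steenrod_induced Mo (subtopology Xf W) d f (fundamental_class d Mo ori))"

end

theory Submission
  imports Defs "HOL-Library.Function_Algebras"
begin

text \<open>
  Both classes are compared in \<open>X = fbar (Mbar)\<close>. Put \<open>A = fbar (S)\<close>, which contains the omega limit
  set. On cochains supported off \<open>A\<close> both cycles are the image under \<open>f\<close> of one fundamental
  cycle of \<open>f\<^sup>-\<^sup>1 (Z - A)\<close>, and restriction to \<open>X - A\<close> is injective because \<open>dim A \<le> d - 2\<close>.

  The exact sequence of a closed pair is replaced by two facts. The groups of cochains modulo
  locally zero ones are groups of finitely valued functions modulo an ideal, so that
  homomorphisms from them to \<open>\<real> / \<int>\<close> lift to \<open>\<real>\<close> (Noebeling), and closed subspaces are taut.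
  Cohomology above the dimension vanishes because a cocycle can be moved to the nerve of a
  partition of which at most \<open>n + 1\<close> pieces come together at any point. On a \<open>d\<close>-manifold,
  top-dimensional homology is thereby dual to \<open>H\<^sub>c\<^sup>d\<close>, which is generated by the Euclidean
  open sets, and this gives existence and uniqueness of fundamental classes.
\<close>

subsection \<open>Extension of homomorphisms\<close>

text \<open>Chains are dual objects: an exactness statement about cochains yields one about chains
  only if an Ext group vanishes. This is under control when the subgroup to extend from is the
  preimage of a \<open>support_closed\<close> group \<open>J\<close> under an additive
  \<open>T\<close> into finitely valued functions. Every application consists in naming the two:
  \<open>T\<close> is a coboundary, a restriction or the identity, and \<open>J\<close> is some
  \<open>null_near\<close>.

  Cochains are arbitrary functions, compared only near the diagonal. A map along which they are
  pulled back has to be small, not continuous. So neighbourhoods retract to closed sets, points can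
  be moved to representatives of the pieces of a partition, and splitting by the first entry
  replaces a partition of unity; \<open>prism\<close> compares such maps with the identity.

  The bound \<open>d - 2\<close> makes restriction to the complement of a closed set bijective in
  degree \<open>d\<close>: injectivity uses vanishing on the closed set in degree \<open>d\<close>,
  surjectivity in degree \<open>d - 1\<close>.\<close>

definition subgrp :: "'g::ab_group_add set \<Rightarrow> bool" where
  "subgrp A \<longleftrightarrow> 0 \<in> A \<and> (\<forall>x\<in>A. \<forall>y\<in>A. x - y \<in> A)"

text \<open>A homomorphism from \<open>A\<close> to the quotient of \<real> by \<open>N\<close>,
  given by real representatives: \<open>N = {0}\<close> gives honest homomorphisms,
  \<open>N = \<int>\<close> those into the circle group.\<close>

definition additive_mod :: "real set \<Rightarrow> 'g::ab_group_add set \<Rightarrow> ('g \<Rightarrow> real) \<Rightarrow> bool" where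
  "additive_mod N A h \<longleftrightarrow> (\<forall>x\<in>A. \<forall>y\<in>A. h (x + y) - h x - h y \<in> N)"

lemma subgrp_0: "subgrp A \<Longrightarrow> 0 \<in> A"
  and subgrp_diff: "subgrp A \<Longrightarrow> x \<in> A \<Longrightarrow> y \<in> A \<Longrightarrow> x - y \<in> A"
  by (auto simp: subgrp_def)

lemma subgrp_minus: "subgrp A \<Longrightarrow> x \<in> A \<Longrightarrow> - x \<in> A"
  by (metis diff_0 subgrp_0 subgrp_diff)

lemma subgrp_add: "subgrp A \<Longrightarrow> x \<in> A \<Longrightarrow> y \<in> A \<Longrightarrow> x + y \<in> A"
  by (metis diff_minus_eq_add subgrp_diff subgrp_minus)

lemma subgrp_sum: "subgrp A \<Longrightarrow> (\<And>i. i \<in> I \<Longrightarrow> f i \<in> A) \<Longrightarrow> sum f I \<in> A"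
  by (induction I rule: infinite_finite_induct) (auto simp: subgrp_0 subgrp_add)

text \<open>The class \<open>ring_1\<close> supplies integer multiples as
  \<open>of_nat n * x\<close> and \<open>of_int k * x\<close>; on cochains these are pointwise
  multiples by constants.\<close>

lemma subgrp_of_nat_mult: "subgrp A \<Longrightarrow> x \<in> A \<Longrightarrow> of_nat n * x \<in> A" for x :: "'g::ring_1"
  by (induction n) (auto simp: algebra_simps subgrp_0 subgrp_add)

lemma subgrp_of_int_mult: "subgrp A \<Longrightarrow> x \<in> A \<Longrightarrow> of_int k * x \<in> A" for x :: "'g::ring_1"
  by (cases k) (auto simp: subgrp_of_nat_mult algebra_simps simp del: of_nat_Suc
        dest: subgrp_of_nat_mult subgrp_minus intro: subgrp_minus[of _ "of_nat _ * x"])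

lemma subgrp_Union_chain:
  assumes "subset.chain S C" "C \<noteq> {}" "\<And>G. G \<in> C \<Longrightarrow> subgrp G"
  shows "subgrp (\<Union>C)"
proof -
  have "x - y \<in> \<Union>C" if "x \<in> X" "X \<in> C" "y \<in> Y" "Y \<in> C" for x y X Y
  proof -
    have "X \<subseteq> Y \<or> Y \<subseteq> X"
      using assms(1) that by (auto simp: subset_chain_def)
    then show ?thesis
      using that assms(3) by (meson UnionI subgrp_diff subsetD)
  qed
  then show ?thesis
    using assms(2,3) by (auto simp: subgrp_def)
qed

text \<open>Division with remainder by the least positive element. The zero group gives
  \<open>d = 0\<close>, for which \<open>d dvd k\<close> still has the right meaning.\<close>

lemma subgrp_int_ideal:
  assumes "subgrp (D :: int set)"
  obtains d where "d \<ge> 0" "\<And>k. k \<in> D \<longleftrightarrow> d dvd k"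
proof (cases "D = {0}")
  case True
  then show ?thesis using that[of 0] by auto
next
  case False
  then obtain k where k: "k \<in> D" "k \<noteq> 0"
    using assms by (auto simp: subgrp_def)
  then have "\<exists>n. 0 < n \<and> int n \<in> D"
    using subgrp_minus[OF assms] by (intro exI[of _ "nat \<bar>k\<bar>"]) (auto simp: abs_if)
  define n where "n = (LEAST n. 0 < n \<and> int n \<in> D)"
  have n: "0 < n" "int n \<in> D"
    using LeastI_ex[OF \<open>\<exists>n. 0 < n \<and> int n \<in> D\<close>] by (auto simp: n_def)
  have mult: "int n * j \<in> D" for j
    using subgrp_of_int_mult[OF assms n(2), of j] by (simp add: mult.commute)
  have "int n dvd k" if "k \<in> D" for k
  proof (rule ccontr)
    assume "\<not> int n dvd k"
    then have "0 < k mod int n" "k mod int n < int n"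
      using n by (auto simp: mod_eq_0_iff_dvd le_less[of 0])
        (metis mod_eq_0_iff_dvd mod_int_pos_iff n(1) of_nat_0_less_iff order_less_le)+
    moreover have "k mod int n \<in> D"
      using subgrp_diff[OF assms that mult[of "k div int n"]] by (simp add: minus_mult_div_eq_mod)
    ultimately have "0 < nat (k mod int n) \<and> int (nat (k mod int n)) \<in> D" "nat (k mod int n) < n"
      by auto
    then show False
      using not_less_Least n_def by blast
  qed
  then show ?thesis
    using that[of "int n"] mult by (auto simp: dvd_def)
qed

text \<open>The quotient of \<open>\<real>\<close> by \<open>N\<close> is divisible, hence injective.\<close>

lemma extend_additive_mod:
  fixes A :: "'g::ring_1 set"
  assumes A: "subgrp A" and N: "subgrp N" and h: "additive_mod N A h"
  obtains h' where "additive_mod N UNIV h'" "\<And>x. x \<in> A \<Longrightarrow> h' x - h x \<in> N"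
proof -
  \<comment> \<open>Partial extensions are handled as graphs. The fibre of \<open>G0\<close> over a
    point of \<open>A\<close> is a whole coset of \<open>N\<close>, so that additivity modulo
    \<open>N\<close> becomes the statement that the graph is a subgroup.\<close>
  define G0 where "G0 = {(x, t). x \<in> A \<and> t - h x \<in> N}"
  define S where "S = {G. subgrp G \<and> G0 \<subseteq> G \<and> (\<forall>t. (0, t) \<in> G \<longrightarrow> t \<in> N)}"
  have h0: "h 0 \<in> N"
    using h subgrp_0[OF A] subgrp_minus[OF N, of "- h 0"] by (force simp: additive_mod_def)
  have hd: "(s - t) - h (x - y) \<in> N" if "x \<in> A" "y \<in> A" "s - h x \<in> N" "t - h y \<in> N" for s t x y
  proof -
    have "h x - h (x - y) - h y \<in> N"
      using h that subgrp_diff[OF A] unfolding additive_mod_def by (metis diff_add_cancel)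
    from subgrp_add[OF N this subgrp_diff[OF N that(3,4)]] show ?thesis
      by (simp add: algebra_simps)
  qed
  have "G0 \<in> S"
    using A h0 subgrp_add[OF N _ h0] subgrp_minus[OF N h0] hd
    by (fastforce simp: S_def G0_def subgrp_def zero_prod_def)
  have "\<exists>G\<in>S. \<forall>X\<in>S. G \<subseteq> X \<longrightarrow> X = G"
  proof (rule subset_Zorn_nonempty)
    show "S \<noteq> {}" using \<open>G0 \<in> S\<close> by auto
    fix C assume "C \<noteq> {}" "subset.chain S C"
    then show "\<Union>C \<in> S"
      using subgrp_Union_chain[of S C] by (fastforce simp: S_def subset_chain_def)
  qed
  then obtain G where G: "subgrp G" "G0 \<subseteq> G" "\<And>t. (0, t) \<in> G \<Longrightarrow> t \<in> N"
    and max: "\<And>X. X \<in> S \<Longrightarrow> G \<subseteq> X \<Longrightarrow> X = G"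
    by (auto simp: S_def)
  have "\<exists>t. (x, t) \<in> G" for x
  proof -
    \<comment> \<open>The integers \<open>k\<close> for which \<open>k\<close> times
      \<open>x\<close> already lies in the domain form an ideal; the value \<open>s\<close> at its
      generator is the only constraint on the value at \<open>x\<close>.\<close>
    define D where "D = {k::int. \<exists>s. (of_int k * x, s) \<in> G}"
    have "subgrp D"
      using subgrp_0[OF G(1)] subgrp_diff[OF G(1)]
      by (force simp: subgrp_def D_def zero_prod_def left_diff_distrib)
    then obtain d where d: "d \<ge> 0" "\<And>k. k \<in> D \<longleftrightarrow> d dvd k"
      using subgrp_int_ideal by blast
    then have "d \<in> D" by auto
    then obtain s where s: "(of_int d * x, s) \<in> G" by (auto simp: D_def)
    \<comment> \<open>Divisibility of \<real> enters here. For \<open>d = 0\<close> the new value is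
      unconstrained, and division by zero simply makes it \<open>0\<close>.\<close>
    define t where "t = s / of_int d"
    define G' where "G' = {(y + of_int j * x, u + of_int j * t) | y u j. (y, u) \<in> G}"
    have "subgrp G'"
      unfolding subgrp_def
    proof safe
      show "0 \<in> G'"
        using subgrp_0[OF G(1)] by (force simp: G'_def zero_prod_def intro!: exI[of _ 0])
    next
      fix a b c e assume "(a, b) \<in> G'" "(c, e) \<in> G'"
      then obtain y u j y' u' j' where
        *: "(a, b) = (y + of_int j * x, u + of_int j * t)" "(y, u) \<in> G"
          "(c, e) = (y' + of_int j' * x, u' + of_int j' * t)" "(y', u') \<in> G"
        by (auto simp: G'_def)
      then have "(a, b) - (c, e)
          = ((y - y') + of_int (j - j') * x, (u - u') + of_int (j - j') * t)"
        by (simp add: algebra_simps)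
      moreover have "(y - y', u - u') \<in> G"
        using subgrp_diff[OF G(1) *(2,4)] by simp
      ultimately show "(a, b) - (c, e) \<in> G'"
        unfolding G'_def by blast
    qed
    moreover have "G \<subseteq> G'"
      by (force simp: G'_def intro!: exI[of _ "0::int"])
    moreover have "u + of_int j * t \<in> N" if "(y, u) \<in> G" "y + of_int j * x = 0" for y u j
    proof -
      have y: "of_int j * x = - y"
        using that(2) by (metis add.commute add.inverse_inverse minus_unique)
      then have "j \<in> D"
        using subgrp_minus[OF G(1) that(1)] by (auto simp: D_def)
      then obtain l where l: "j = l * d" using d by (auto simp: dvd_def mult.commute)
      have "(of_nat n * (of_int d * x), of_nat n * s) \<in> G" for n
      proof (induction n)
        case (Suc n)
        then show ?case
          using subgrp_add[OF G(1) s Suc] by (simp add: algebra_simps)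
      qed (use subgrp_0[OF G(1)] in \<open>simp add: zero_prod_def\<close>)
      from this[of "nat l"] subgrp_minus[OF G(1) this[of "nat (- l)"]]
      have "(of_int l * (of_int d * x), of_int l * s) \<in> G"
        by (cases "l \<ge> 0") (simp_all add: of_nat_nat)
      then have "(of_int j * x, of_int l * s) \<in> G"
        by (simp add: l mult.assoc)
      then have "(0, u + of_int l * s) \<in> G"
        using subgrp_add[OF G(1) that(1)] y by fastforce
      moreover have "of_int l * s = of_int j * t" if "d \<noteq> 0"
        using that by (simp add: t_def l)
      moreover have "u \<in> N" if "d = 0"
        using that G(3)[of u] \<open>(y, u) \<in> G\<close> y l by auto
      ultimately show ?thesis
        using G(3) l by (cases "d = 0") auto
    qed
    then have "\<forall>u. (0, u) \<in> G' \<longrightarrow> u \<in> N"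
      by (auto simp: G'_def)
    ultimately have "G' \<in> S"
      using G(2) by (auto simp: S_def)
    then have "G' = G" using max \<open>G \<subseteq> G'\<close> by blast
    moreover have "(0 + of_int 1 * x, 0 + of_int 1 * t) \<in> G'"
      using subgrp_0[OF G(1)] unfolding G'_def zero_prod_def by blast
    ultimately show ?thesis by auto
  qed
  then obtain h' where h': "\<And>x. (x, h' x) \<in> G" by metis
  show thesis
  proof
    show "additive_mod N UNIV h'"
      unfolding additive_mod_def
    proof safe
      fix x y
      have "(x + y, h' (x + y)) - (x, h' x) - (y, h' y) \<in> G"
        using h' by (intro subgrp_diff[OF G(1)])
      then show "h' (x + y) - h' x - h' y \<in> N" using G(3) by simp
    qed
    show "h' x - h x \<in> N" if "x \<in> A" for x
    proof -
      have "(x, h x) \<in> G" using that G(2) subgrp_0[OF N] by (auto simp: G0_def)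
      then have "(x, h' x) - (x, h x) \<in> G" using h' subgrp_diff[OF G(1)] by blast
      then show ?thesis using G(3) by simp
    qed
  qed
qed

lemma subgrp_Ints: "subgrp (\<int> :: real set)" and subgrp_zero: "subgrp ({0} :: 'g::ab_group_add set)"
  by (auto simp: subgrp_def)

text \<open>Functions determined by finitely many membership tests from \<open>I\<close>, that is,
  the ring generated by the constants and the \<open>ind e\<close> with \<open>e \<in> I\<close>.
  For \<open>I = UNIV\<close> these are all finitely valued functions; smaller \<open>I\<close>
  filter them, and the filtration is climbed one test at a time.\<close>

definition cylinder :: "'y set set \<Rightarrow> ('y \<Rightarrow> int) set" where
  "cylinder I = {f. \<exists>B. finite B \<and> B \<subseteq> I \<and> (\<forall>y y'. (\<forall>g\<in>B. y \<in> g \<longleftrightarrow> y' \<in> g) \<longrightarrow> f y = f y')}"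

abbreviation ind :: "'y set \<Rightarrow> 'y \<Rightarrow> int" where
  "ind e \<equiv> (\<lambda>y. if y \<in> e then 1 else 0)"

lemma cylinder_combine:
  assumes "f \<in> cylinder I" "g \<in> cylinder I"
  shows "(\<lambda>y. k (f y) (g y)) \<in> cylinder I"
proof -
  obtain B where B: "finite B" "B \<subseteq> I" "\<And>y y'. (\<forall>g\<in>B. y \<in> g \<longleftrightarrow> y' \<in> g) \<Longrightarrow> f y = f y'"
    using assms(1) by (auto simp: cylinder_def)
  obtain B' where B': "finite B'" "B' \<subseteq> I" "\<And>y y'. (\<forall>g\<in>B'. y \<in> g \<longleftrightarrow> y' \<in> g) \<Longrightarrow> g y = g y'"
    using assms(2) by (auto simp: cylinder_def)
  have "k (f y) (g y) = k (f y') (g y')" if "\<forall>g\<in>B \<union> B'. y \<in> g \<longleftrightarrow> y' \<in> g" for y y'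
    using B(3)[of y y'] B'(3)[of y y'] that by simp
  then show ?thesis
    using B(1,2) B'(1,2) unfolding cylinder_def by (intro CollectI exI[of _ "B \<union> B'"]) auto
qed

lemma cylinder_const: "(\<lambda>y. k) \<in> cylinder I"
  by (force simp: cylinder_def)

lemma cylinder_ind: "e \<in> I \<Longrightarrow> ind e \<in> cylinder I"
  by (auto simp: cylinder_def intro!: exI[of _ "{e}"])

lemma cylinder_mono: "I \<subseteq> I' \<Longrightarrow> cylinder I \<subseteq> cylinder I'"
  unfolding cylinder_def by (intro Collect_mono impI, elim ex_forward) auto

lemma cylinder_empty: "f \<in> cylinder {} \<longleftrightarrow> (\<exists>k. f = (\<lambda>y. k))"
  by (auto simp: cylinder_def fun_eq_iff)

lemma subgrp_cylinder: "subgrp (cylinder I)"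
  unfolding subgrp_def zero_fun_def fun_diff_def using cylinder_const cylinder_combine by blast

lemma cylinder_times: "f \<in> cylinder I \<Longrightarrow> g \<in> cylinder I \<Longrightarrow> f * g \<in> cylinder I"
  unfolding times_fun_def by (rule cylinder_combine)

lemma finite_range_cylinder:
  assumes "finite (range f)"
  shows "f \<in> cylinder UNIV"
  using assms unfolding cylinder_def
  by (intro CollectI exI[of _ "(\<lambda>k. f -` {k}) ` range f"]) (auto simp: vimage_def)

lemma cylinder_finite_range:
  assumes "f \<in> cylinder I"
  shows "finite (range f)"
proof -
  obtain B where B: "finite B" "\<forall>y y'. (\<forall>g\<in>B. y \<in> g \<longleftrightarrow> y' \<in> g) \<longrightarrow> f y = f y'"
    using assms by (auto simp: cylinder_def)
  define h where "h = (\<lambda>s. f (SOME y. B \<inter> {g. y \<in> g} = s))"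
  have "f y = h (B \<inter> {g. y \<in> g})" for y
    using someI[of "\<lambda>y'. B \<inter> {g. y' \<in> g} = B \<inter> {g. y \<in> g}" y] B(2) unfolding h_def by blast
  then have "range f \<subseteq> h ` Pow B" by blast
  then show ?thesis using B(1) by (meson finite_Pow_iff finite_surj)
qed

text \<open>On \<open>e\<close> and off \<open>e\<close> separately, \<open>f\<close> depends only
  on the remaining tests. The coefficient of \<open>ind e\<close> is the difference of the two
  resulting functions \<open>c\<close> and \<open>a\<close>.\<close>

lemma cylinder_insert:
  assumes "f \<in> cylinder (insert e I)"
  obtains a b where "a \<in> cylinder I" "b \<in> cylinder I" "f = a + b * ind e"
proof -
  obtain B where B: "finite B" "B \<subseteq> insert e I" "\<And>y y'. (\<forall>g\<in>B. y \<in> g \<longleftrightarrow> y' \<in> g) \<Longrightarrow> f y = f y'"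
    using assms by (auto simp: cylinder_def)
  define same where "same = (\<lambda>y y'. \<forall>g\<in>B - {e}. y \<in> g \<longleftrightarrow> y' \<in> g)"
  \<comment> \<open>The value of \<open>f\<close> at a chosen point off \<open>e\<close> that passes
    the same other tests. If there is no such point the choice is arbitrary, but it is the same for
    all points passing these tests, and that is all that \<open>cylinder I\<close> asks for.\<close>
  define a where "a = (\<lambda>y. f (SOME y'. y' \<notin> e \<and> same y y'))"
  define c where "c = (\<lambda>y. f (SOME y'. y' \<in> e \<and> same y y'))"
  have "same y = same y'" if "same y y'" for y y'
    using that by (intro ext) (auto simp: same_def)
  then have ac: "a y = a y'" "c y = c y'" if "same y y'" for y y'
    using that by (simp_all add: a_def c_def)
  have "f' \<in> cylinder I" if "\<And>y y'. same y y' \<Longrightarrow> f' y = f' y'" for f'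
    using B(1,2) that unfolding cylinder_def same_def mem_Collect_eq
    by (intro exI[of _ "B - {e}"] conjI) auto
  from this[of a] this[of c] ac have "a \<in> cylinder I" "c \<in> cylinder I"
    by auto
  moreover have "a y = f y" if "y \<notin> e" for y
  proof -
    define z where "z = (SOME y'. y' \<notin> e \<and> same y y')"
    have "z \<notin> e \<and> same y z"
      unfolding z_def by (rule someI[of _ y]) (use that in \<open>auto simp: same_def\<close>)
    then have "\<forall>g\<in>B. z \<in> g \<longleftrightarrow> y \<in> g"
      using that unfolding same_def by blast
    from B(3)[OF this] show ?thesis by (simp add: a_def z_def)
  qed
  moreover have "c y = f y" if "y \<in> e" for y
  proof -
    define z where "z = (SOME y'. y' \<in> e \<and> same y y')"
    have "z \<in> e \<and> same y z"
      unfolding z_def by (rule someI[of _ y]) (use that in \<open>auto simp: same_def\<close>)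
    then have "\<forall>g\<in>B. z \<in> g \<longleftrightarrow> y \<in> g"
      using that unfolding same_def by blast
    from B(3)[OF this] show ?thesis by (simp add: c_def z_def)
  qed
  ultimately have "f = a + (c - a) * ind e" and "c - a \<in> cylinder I"
    by (auto simp: fun_eq_iff intro: subgrp_diff[OF subgrp_cylinder])
  then show thesis
    using that[OF \<open>a \<in> cylinder I\<close>] by blast
qed

text \<open>More than an ideal: \<open>J\<close> must contain every \<open>f\<close> in
  \<open>R\<close> whose support lies in that of a member. The even constants among all constants
  are excluded, rightly so: the character sending \<open>1\<close> to one half vanishes on them but
  has no real lift that vanishes on them.\<close>

definition support_closed :: "('y \<Rightarrow> int) set \<Rightarrow> ('y \<Rightarrow> int) set \<Rightarrow> bool" where
  "support_closed R J \<longleftrightarrow> (\<forall>j\<in>J. \<forall>f\<in>R. (\<forall>y. f y \<noteq> 0 \<longrightarrow> j y \<noteq> 0) \<longrightarrow> f \<in> J)"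

text \<open>A character \<open>h\<close> of \<open>cylinder I\<close> lifts to \<real>, with the
  lift prescribed on \<open>J\<close>. The relative form is what survives the induction: adjoining a
  generator \<open>e\<close> poses the same problem for the coefficients of \<open>ind e\<close>,
  with the already determined coefficients in the role of \<open>J\<close>.\<close>

definition liftable :: "'y set set \<Rightarrow> bool" where
  "liftable I \<longleftrightarrow> (\<forall>J h n.
     subgrp J \<and> J \<subseteq> cylinder I \<and> support_closed (cylinder I) J \<and>
     additive_mod \<int> (cylinder I) h \<and> additive_mod {0} J n \<and> (\<forall>j\<in>J. n j - h j \<in> \<int>) \<longrightarrow>
     (\<exists>m. additive_mod {0} (cylinder I) m \<and> (\<forall>j\<in>J. m j = n j) \<and> (\<forall>f\<in>cylinder I. m f - h f \<in> \<int>)))"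

text \<open>\<open>G\<close> is the graph of a lift of \<open>h\<close> that is defined on \<open>cylinder I + J\<close>.\<close>

definition partial_lift ::
    "('y \<Rightarrow> int) set \<Rightarrow> (('y \<Rightarrow> int) \<Rightarrow> real) \<Rightarrow> 'y set set \<Rightarrow> (('y \<Rightarrow> int) \<times> real) set \<Rightarrow> bool" where
  "partial_lift J h I G \<longleftrightarrow> subgrp G \<and> (\<forall>t. (0, t) \<in> G \<longrightarrow> t = 0) \<and>
     (\<forall>f t. (f, t) \<in> G \<longrightarrow> t - h f \<in> \<int>) \<and>
     (\<forall>f. (\<exists>t. (f, t) \<in> G) \<longleftrightarrow> (\<exists>a\<in>cylinder I. f - a \<in> J))"

lemma partial_liftD:
  assumes "partial_lift J h I G"
  shows "subgrp G" and "\<And>f t. (f, t) \<in> G \<Longrightarrow> t - h f \<in> \<int>"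
    and "\<And>f. (\<exists>t. (f, t) \<in> G) \<longleftrightarrow> (\<exists>a\<in>cylinder I. f - a \<in> J)"
    and "\<And>f s t. (f, s) \<in> G \<Longrightarrow> (f, t) \<in> G \<Longrightarrow> s = t"
proof -
  show G: "subgrp G" and "\<And>f t. (f, t) \<in> G \<Longrightarrow> t - h f \<in> \<int>"
    and "\<And>f. (\<exists>t. (f, t) \<in> G) \<longleftrightarrow> (\<exists>a\<in>cylinder I. f - a \<in> J)"
    using assms by (auto simp: partial_lift_def)
  fix f s t assume "(f, s) \<in> G" "(f, t) \<in> G"
  then have "(f, s) - (f, t) \<in> G" using G subgrp_diff by blast
  then show "s = t" using assms by (auto simp: partial_lift_def)
qed

text \<open>By \<open>cylinder_insert\<close> only the values at \<open>b * ind e\<close> are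
  missing. They are forced by \<open>G\<close> for \<open>b\<close> in a subgroup \<open>J'\<close>
  of \<open>cylinder I'\<close>, which is again \<open>support_closed\<close>; so
  \<open>liftable I'\<close> provides values \<open>m'\<close> for all \<open>b\<close> that agree
  with the forced ones, and \<open>G'\<close> is single-valued.\<close>

lemma partial_lift_step:
  assumes I': "liftable I'" and sub: "insert e I' \<subseteq> I"
    and J: "subgrp J" "J \<subseteq> cylinder I" "support_closed (cylinder I) J"
    and h: "additive_mod \<int> (cylinder I) h"
    and G: "partial_lift J h I' G"
  obtains G' where "partial_lift J h (insert e I') G'" "G \<subseteq> G'"
proof -
  have cyl: "cylinder I' \<subseteq> cylinder I" "ind e \<in> cylinder I"
    using sub cylinder_mono[of I' I] cylinder_ind[of e I] by auto
  define J' where "J' = {b \<in> cylinder I'. \<exists>t. (b * ind e, t) \<in> G}"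
  define n' where "n' = (\<lambda>b. SOME t. (b * ind e, t) \<in> G)"
  have n': "(b * ind e, n' b) \<in> G" if "b \<in> J'" for b
    using that someI_ex[of "\<lambda>t. (b * ind e, t) \<in> G"] by (auto simp: J'_def n'_def)
  have J'sub: "subgrp J'"
    unfolding subgrp_def
  proof safe
    show "0 \<in> J'"
      using subgrp_0[OF partial_liftD(1)[OF G]] subgrp_0[OF subgrp_cylinder, of I']
      by (auto simp: J'_def zero_prod_def)
    fix b b' assume b: "b \<in> J'" "b' \<in> J'"
    have "(b * ind e, n' b) - (b' * ind e, n' b') \<in> G"
      using b n' subgrp_diff[OF partial_liftD(1)[OF G]] by blast
    then show "b - b' \<in> J'"
      using b subgrp_diff[OF subgrp_cylinder, of b I' b'] by (auto simp: J'_def left_diff_distrib)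
  qed
  moreover have "support_closed (cylinder I') J'"
    unfolding support_closed_def
  proof (intro ballI impI)
    fix b f assume b: "b \<in> J'" and f: "f \<in> cylinder I'" and supp: "\<forall>y. f y \<noteq> 0 \<longrightarrow> b y \<noteq> 0"
    obtain a where a: "a \<in> cylinder I'" "b * ind e - a \<in> J"
      using b partial_liftD(3)[OF G] by (auto simp: J'_def)
    \<comment> \<open>The correction for \<open>f\<close> in place of \<open>b\<close>: keep the
      support of \<open>a\<close> but take the values of \<open>f\<close>. Where \<open>a\<close>
      vanishes, \<open>f * ind e\<close> is nonzero only if \<open>b * ind e\<close> is; where
      \<open>a\<close> does not, \<open>f * ind e - a'\<close> vanishes on \<open>e\<close> and
      \<open>b * ind e - a\<close> is nonzero off \<open>e\<close>.\<close>
    define a' where "a' = (\<lambda>y. if a y \<noteq> 0 then f y else 0)"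
    have a': "a' \<in> cylinder I'"
      using cylinder_combine[OF a(1) f, of "\<lambda>s t. if s \<noteq> 0 then t else 0"] by (simp add: a'_def)
    moreover have "f * ind e - a' \<in> J"
    proof -
      have "f * ind e - a' \<in> cylinder I"
        using f a' cyl by (intro subgrp_diff[OF subgrp_cylinder] cylinder_times) auto
      moreover have "\<forall>y. (f * ind e - a') y \<noteq> 0 \<longrightarrow> (b * ind e - a) y \<noteq> 0"
        using supp by (auto simp: a'_def)
      ultimately show ?thesis
        using J(3) a(2) unfolding support_closed_def by blast
    qed
    ultimately show "f \<in> J'"
      using f partial_liftD(3)[OF G] by (auto simp: J'_def)
  qed
  moreover have "additive_mod \<int> (cylinder I') (\<lambda>b. h (b * ind e))"
    using h cyl cylinder_times[of _ I "ind e"] unfolding additive_mod_def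
    by (simp add: distrib_right subset_iff)
  moreover have "additive_mod {0} J' n'"
    unfolding additive_mod_def
  proof safe
    fix b b' assume b: "b \<in> J'" "b' \<in> J'"
    have "(b * ind e, n' b) + (b' * ind e, n' b') \<in> G"
      using b n' subgrp_add[OF partial_liftD(1)[OF G]] by blast
    then have "((b + b') * ind e, n' b + n' b') \<in> G" by (simp add: distrib_right)
    then show "n' (b + b') - n' b - n' b' = 0"
      using partial_liftD(4)[OF G n'[OF subgrp_add[OF J'sub b]]] by simp
  qed
  moreover have "\<forall>j\<in>J'. n' j - h (j * ind e) \<in> \<int>"
    using n' partial_liftD(2)[OF G] by blast
  ultimately obtain m' where m': "additive_mod {0} (cylinder I') m'" "\<forall>j\<in>J'. m' j = n' j"
    "\<forall>f\<in>cylinder I'. m' f - h (f * ind e) \<in> \<int>"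
    using I'[unfolded liftable_def, rule_format, of J' "\<lambda>b. h (b * ind e)" n'] by (auto simp: J'_def)
  have m'_diff: "m' (b - b') = m' b - m' b'" if "b \<in> cylinder I'" "b' \<in> cylinder I'" for b b'
  proof -
    have "m' ((b - b') + b') - m' (b - b') - m' b' = 0"
      using m'(1) that subgrp_diff[OF subgrp_cylinder that] unfolding additive_mod_def by blast
    then show ?thesis by simp
  qed
  then have m'_0: "m' 0 = 0" using subgrp_0[OF subgrp_cylinder, of I'] by fastforce
  define G' where "G' = {(f + b * ind e, t + m' b) | f t b. (f, t) \<in> G \<and> b \<in> cylinder I'}"
  have "partial_lift J h (insert e I') G'"
    unfolding partial_lift_def
  proof (intro conjI allI impI)
    show "subgrp G'"
      unfolding subgrp_def
    proof safe
      have "(0 + 0 * ind e, 0 + m' 0) \<in> G'"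
        using subgrp_0[OF partial_liftD(1)[OF G]] subgrp_0[OF subgrp_cylinder, of I']
        unfolding G'_def zero_prod_def by blast
      then show "0 \<in> G'" by (simp add: m'_0 zero_prod_def)
    next
      fix f1 t1 f2 t2 assume "(f1, t1) \<in> G'" "(f2, t2) \<in> G'"
      then obtain f s b f' s' b' where *: "(f1, t1) = (f + b * ind e, s + m' b)" "(f, s) \<in> G" "b \<in> cylinder I'"
        "(f2, t2) = (f' + b' * ind e, s' + m' b')" "(f', s') \<in> G" "b' \<in> cylinder I'"
        unfolding G'_def by blast
      have "(f1, t1) - (f2, t2) = ((f - f') + (b - b') * ind e, (s - s') + m' (b - b'))"
        using * m'_diff by (simp add: left_diff_distrib)
      moreover have "(f - f', s - s') \<in> G"
        using subgrp_diff[OF partial_liftD(1)[OF G] *(2,5)] by simp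
      moreover have "b - b' \<in> cylinder I'"
        using * subgrp_diff[OF subgrp_cylinder] by blast
      ultimately show "(f1, t1) - (f2, t2) \<in> G'"
        unfolding G'_def by blast
    qed
  next
    fix t assume "(0, t) \<in> G'"
    then obtain f s b where *: "f + b * ind e = 0" "t = s + m' b" "(f, s) \<in> G" "b \<in> cylinder I'"
      unfolding G'_def by (smt (verit) mem_Collect_eq prod.inject)
    have "b * ind e = - f" using *(1) by (metis add.inverse_inverse minus_unique)
    then have G2: "(b * ind e, - s) \<in> G"
      using subgrp_minus[OF partial_liftD(1)[OF G] *(3)] by simp
    then have "b \<in> J'" using *(4) by (auto simp: J'_def)
    then have "m' b = - s"
      using m'(2) partial_liftD(4)[OF G G2 n'] by simp
    then show "t = 0" using *(2) by simp
  next
    fix f0 t0 assume "(f0, t0) \<in> G'"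
    then obtain f s b where *: "f0 = f + b * ind e" "t0 = s + m' b" "(f, s) \<in> G" "b \<in> cylinder I'"
      unfolding G'_def by blast
    obtain a where a: "a \<in> cylinder I'" "f - a \<in> J"
      using partial_liftD(3)[OF G] *(3) by blast
    then have "f \<in> cylinder I"
      using J(2) cyl(1) subgrp_add[OF subgrp_cylinder, of "f - a" I a] by auto
    moreover have "b * ind e \<in> cylinder I" using *(4) cyl cylinder_times by blast
    ultimately have "h (f + b * ind e) - h f - h (b * ind e) \<in> \<int>"
      using h unfolding additive_mod_def by blast
    moreover have "s - h f \<in> \<int>" using partial_liftD(2)[OF G *(3)] .
    moreover have "m' b - h (b * ind e) \<in> \<int>" using m'(3) *(4) by blast
    ultimately have "(s - h f) + (m' b - h (b * ind e)) - (h (f + b * ind e) - h f - h (b * ind e)) \<in> \<int>"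
      using subgrp_add[OF subgrp_Ints] subgrp_diff[OF subgrp_Ints] by blast
    then show "t0 - h f0 \<in> \<int>" using *(1,2) by (simp add: algebra_simps)
  next
    fix f
    show "(\<exists>t. (f, t) \<in> G') \<longleftrightarrow> (\<exists>a\<in>cylinder (insert e I'). f - a \<in> J)"
    proof
      assume "\<exists>t. (f, t) \<in> G'"
      then obtain f' s b where *: "f = f' + b * ind e" "(f', s) \<in> G" "b \<in> cylinder I'"
        unfolding G'_def by blast
      obtain a where a: "a \<in> cylinder I'" "f' - a \<in> J"
        using partial_liftD(3)[OF G] *(2) by blast
      have "a + b * ind e \<in> cylinder (insert e I')"
        using a *(3) cylinder_mono[of I' "insert e I'"] cylinder_ind[of e "insert e I'"]
        by (intro subgrp_add[OF subgrp_cylinder] cylinder_times) auto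
      moreover have "f - (a + b * ind e) = f' - a" using * by simp
      ultimately show "\<exists>a\<in>cylinder (insert e I'). f - a \<in> J" using a by metis
    next
      assume "\<exists>a\<in>cylinder (insert e I'). f - a \<in> J"
      then obtain a b where "a \<in> cylinder I'" "b \<in> cylinder I'" "f - (a + b * ind e) \<in> J"
        using cylinder_insert by metis
      moreover from this have "(f - b * ind e) - a \<in> J" by (simp add: algebra_simps)
      ultimately obtain t where "(f - b * ind e, t) \<in> G" "b \<in> cylinder I'"
        using partial_liftD(3)[OF G] by blast
      then have "((f - b * ind e) + b * ind e, t + m' b) \<in> G'" unfolding G'_def by blast
      then show "\<exists>t. (f, t) \<in> G'" by (auto simp del: fun_diff_def)
    qed
  qed
  moreover have "G \<subseteq> G'"
  proof
    fix x assume "x \<in> G"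
    then have "(fst x, snd x) \<in> G" by simp
    then have "(fst x + 0 * ind e, snd x + m' 0) \<in> G'"
      using subgrp_0[OF subgrp_cylinder, of I'] unfolding G'_def by blast
    then show "x \<in> G'" by (simp add: m'_0)
  qed
  ultimately show thesis using that by blast
qed

lemma additive_mod_of_int:
  fixes x :: "'g::ring_1"
  assumes h: "additive_mod N A h" and A: "subgrp A" and N: "subgrp N" and x: "x \<in> A"
  shows "h (of_int k * x) - of_int k * h x \<in> N"
proof -
  have h0: "h 0 \<in> N"
    using h subgrp_0[OF A] subgrp_minus[OF N, of "- h 0"] by (force simp: additive_mod_def)
  have nat: "h (of_nat n * y) - of_nat n * h y \<in> N" if "y \<in> A" for n y
  proof (induction n)
    case (Suc n)
    have "h (y + of_nat n * y) - h y - h (of_nat n * y) \<in> N"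
      using h that subgrp_of_nat_mult[OF A that] unfolding additive_mod_def by blast
    from subgrp_add[OF N this Suc] show ?case by (simp add: algebra_simps)
  qed (simp add: h0)
  have neg: "h (- y) + h y \<in> N" if "y \<in> A" for y
  proof -
    have "h (y + - y) - h y - h (- y) \<in> N"
      using h that subgrp_minus[OF A that] unfolding additive_mod_def by blast
    from subgrp_diff[OF N h0 this] show ?thesis by (simp add: algebra_simps)
  qed
  show ?thesis
  proof (cases "k \<ge> 0")
    case True
    then show ?thesis using nat[OF x, of "nat k"] by simp
  next
    case False
    then have "h (of_int (- k) * x) - of_int (- k) * h x \<in> N"
      using nat[OF x, of "nat (- k)"] by simp
    moreover have "h (- (of_int (- k) * x)) + h (of_int (- k) * x) \<in> N"
      using neg subgrp_of_int_mult[OF A x] by blast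
    ultimately show ?thesis
      using subgrp_diff[OF N] by fastforce
  qed
qed

lemma of_int_mult_one_fun: "of_int k * (1 :: 'y \<Rightarrow> int) = (\<lambda>y. k)"
proof -
  have "of_nat n = (\<lambda>y::'y. int n)" for n
    by (induction n) (auto simp: fun_eq_iff zero_fun_def one_fun_def)
  then show ?thesis
    by (cases k rule: int_diff_cases) (auto simp: fun_eq_iff)
qed

text \<open>The domain is \<open>J\<close> plus the constants. A conflict could only come from a
  nonzero constant in \<open>J\<close>; it has the same support as \<open>1\<close>, so then
  \<open>1 \<in> J\<close> and the value at \<open>1\<close> is prescribed.\<close>

lemma partial_lift_initial:
  assumes J: "subgrp J" "J \<subseteq> cylinder I" "support_closed (cylinder I) J"
    and h: "additive_mod \<int> (cylinder I) h"
    and n: "additive_mod {0} J n" "\<forall>j\<in>J. n j - h j \<in> \<int>"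
  obtains G where "partial_lift J h {} G" "\<And>j. j \<in> J \<Longrightarrow> (j, n j) \<in> G"
proof -
  have one: "of_int k * (1 :: 'a \<Rightarrow> int) \<in> cylinder I" for k
    unfolding of_int_mult_one_fun by (rule cylinder_const)
  have n_diff: "n (b - b') = n b - n b'" if "b \<in> J" "b' \<in> J" for b b'
  proof -
    have "n ((b - b') + b') - n (b - b') - n b' = 0"
      using n(1) that subgrp_diff[OF J(1) that] unfolding additive_mod_def by blast
    then show ?thesis by simp
  qed
  then have n_0: "n 0 = 0" using subgrp_0[OF J(1)] by fastforce
  define t1 where "t1 = (if 1 \<in> J then n 1 else h 1)"
  have t1: "t1 - h 1 \<in> \<int>" using n(2) by (auto simp: t1_def)
  define G where "G = {(j + of_int k * 1, n j + of_int k * t1) | j k. j \<in> J}"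
  have "partial_lift J h {} G"
    unfolding partial_lift_def
  proof (intro conjI allI impI)
    show "subgrp G"
      unfolding subgrp_def
    proof safe
      have "(0 + of_int 0 * 1, n 0 + of_int 0 * t1) \<in> G"
        using subgrp_0[OF J(1)] unfolding G_def by blast
      then show "0 \<in> G" by (simp add: n_0 zero_prod_def)
    next
      fix f1 t1' f2 t2 assume "(f1, t1') \<in> G" "(f2, t2) \<in> G"
      then obtain j k j' k' where *: "(f1, t1') = (j + of_int k * 1, n j + of_int k * t1)" "j \<in> J"
        "(f2, t2) = (j' + of_int k' * 1, n j' + of_int k' * t1)" "j' \<in> J"
        unfolding G_def by blast
      have "(f1, t1') - (f2, t2) = ((j - j') + of_int (k - k') * 1, n (j - j') + of_int (k - k') * t1)"
        using * n_diff by (simp add: algebra_simps)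
      moreover have "j - j' \<in> J"
        using * subgrp_diff[OF J(1)] by blast
      ultimately show "(f1, t1') - (f2, t2) \<in> G"
        unfolding G_def by blast
    qed
  next
    fix t assume "(0, t) \<in> G"
    then obtain j k where *: "j + of_int k * 1 = 0" "t = n j + of_int k * t1" "j \<in> J"
      unfolding G_def by (smt (verit) mem_Collect_eq prod.inject)
    have j: "- j = of_int k * 1" using *(1) by (metis minus_unique)
    show "t = 0"
    proof (cases "k = 0")
      case True
      then show ?thesis using * n_0 by simp
    next
      case False
      have "- j \<in> J" using *(3) J(1) subgrp_minus by blast
      then have "1 \<in> J"
        using J(3) one[of 1] False j of_int_mult_one_fun[of k] unfolding support_closed_def
        by (metis mult.right_neutral of_int_1 one_fun_apply)
      then have "n (of_int k * 1) = of_int k * n 1"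
        using additive_mod_of_int[OF n(1) J(1) subgrp_zero] by fastforce
      moreover have "n (- j) = - n j" using n_diff[of 0 j] subgrp_0[OF J(1)] *(3) n_0 by simp
      ultimately show ?thesis using * j \<open>1 \<in> J\<close> by (simp add: t1_def)
    qed
  next
    fix f0 t0 assume "(f0, t0) \<in> G"
    then obtain j k where *: "f0 = j + of_int k * 1" "t0 = n j + of_int k * t1" "j \<in> J"
      unfolding G_def by blast
    have i1: "h (j + of_int k * 1) - h j - h (of_int k * 1) \<in> \<int>"
      using h * J(2) one unfolding additive_mod_def by blast
    have i2: "h (of_int k * 1) - of_int k * h 1 \<in> \<int>"
      using additive_mod_of_int[OF h subgrp_cylinder subgrp_Ints, where x = 1 and k = k] one[of 1] by simp
    have i3: "of_int k * (t1 - h 1) \<in> \<int>" using t1 by (intro Ints_mult) auto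
    have i4: "n j - h j \<in> \<int>" using *(3) n(2) by blast
    from Ints_diff[OF Ints_diff[OF Ints_add[OF i4 i3] i2] i1]
    show "t0 - h f0 \<in> \<int>" using *(1,2) by (simp add: algebra_simps)
  next
    fix f
    have "(\<exists>t. (f, t) \<in> G) \<longleftrightarrow> (\<exists>j\<in>J. \<exists>k. f = j + of_int k * 1)"
      unfolding G_def by blast
    also have "\<dots> \<longleftrightarrow> (\<exists>k. f - of_int k * 1 \<in> J)"
      by (metis add_diff_cancel_right' diff_add_cancel)
    also have "\<dots> \<longleftrightarrow> (\<exists>a\<in>cylinder {}. f - a \<in> J)"
      unfolding of_int_mult_one_fun
    proof
      assume "\<exists>k. f - (\<lambda>y. k) \<in> J"
      then show "\<exists>a\<in>cylinder {}. f - a \<in> J" using cylinder_const by metis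
    next
      assume "\<exists>a\<in>cylinder {}. f - a \<in> J"
      then obtain a k where "f - a \<in> J" "a = (\<lambda>y. k)" by (auto simp: cylinder_empty)
      then show "\<exists>k. f - (\<lambda>y. k) \<in> J" by blast
    qed
    finally show "(\<exists>t. (f, t) \<in> G) \<longleftrightarrow> (\<exists>a\<in>cylinder {}. f - a \<in> J)" .
  qed
  moreover have "(j, n j) \<in> G" if "j \<in> J" for j
  proof -
    have "(j + of_int 0 * 1, n j + of_int 0 * t1) \<in> G"
      using that unfolding G_def by blast
    then show ?thesis by simp
  qed
  ultimately show thesis using that by blast
qed

text \<open>Not only the graphs but also their index sets must form a chain: a member of the union's
  \<open>cylinder\<close> uses finitely many tests, and these must lie in a single index
  set.\<close>

lemma partial_lift_Union:
  assumes P: "P \<noteq> {}" "\<And>K G. (K, G) \<in> P \<Longrightarrow> partial_lift J h K G"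
    and K: "subset.chain UNIV (fst ` P)" and G: "subset.chain UNIV (snd ` P)"
  shows "partial_lift J h (\<Union>(fst ` P)) (\<Union>(snd ` P))"
  unfolding partial_lift_def
proof (intro conjI allI impI)
  show "subgrp (\<Union>(snd ` P))"
    using P by (intro subgrp_Union_chain[OF G]) (fastforce dest: partial_liftD(1))+
  show "t = 0" if "(0, t) \<in> \<Union>(snd ` P)" for t
    using that P(2) unfolding partial_lift_def by fastforce
  show "t - h f \<in> \<int>" if "(f, t) \<in> \<Union>(snd ` P)" for f t
    using that P(2) unfolding partial_lift_def by fastforce
  fix f
  show "(\<exists>t. (f, t) \<in> \<Union>(snd ` P)) \<longleftrightarrow> (\<exists>a\<in>cylinder (\<Union>(fst ` P)). f - a \<in> J)"
  proof
    assume "\<exists>t. (f, t) \<in> \<Union>(snd ` P)"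
    then obtain K G t where KG: "(K, G) \<in> P" "(f, t) \<in> G" by auto
    then obtain a where "a \<in> cylinder K" "f - a \<in> J"
      using partial_liftD(3)[OF P(2)] by blast
    moreover have "cylinder K \<subseteq> cylinder (\<Union>(fst ` P))"
      using KG(1) by (intro cylinder_mono) force
    ultimately show "\<exists>a\<in>cylinder (\<Union>(fst ` P)). f - a \<in> J" by blast
  next
    assume "\<exists>a\<in>cylinder (\<Union>(fst ` P)). f - a \<in> J"
    then obtain a B where a: "f - a \<in> J" and B: "finite B" "B \<subseteq> \<Union>(fst ` P)"
      "\<forall>y y'. (\<forall>g\<in>B. y \<in> g \<longleftrightarrow> y' \<in> g) \<longrightarrow> a y = a y'"
      unfolding cylinder_def by blast
    obtain K where "K \<in> fst ` P" "B \<subseteq> K"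
      using finite_subset_Union_chain[OF B(1,2) _ K] P(1) by blast
    then obtain G where KG: "(K, G) \<in> P" "B \<subseteq> K" by auto
    then have "a \<in> cylinder K" using B unfolding cylinder_def by blast
    then obtain t where "(f, t) \<in> G"
      using a partial_liftD(3)[OF P(2)[OF KG(1)]] by blast
    then show "\<exists>t. (f, t) \<in> \<Union>(snd ` P)"
      using KG(1) by force
  qed
qed

text \<open>Zorn's lemma for graphs over initial segments of \<open>I\<close>. If a maximal graph
  stops at a segment short of \<open>I\<close>, that segment is \<open>underS r e\<close> for the
  first missing \<open>e\<close>; its liftability is the hypothesis that
  \<open>partial_lift_step\<close> needs in order to adjoin \<open>e\<close>.\<close>

lemma liftable_extend:
  assumes r: "Well_order r" "Field r = UNIV" and sub: "\<And>e. e \<in> I \<Longrightarrow> liftable (underS r e)"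
    and I: "\<And>x y. y \<in> I \<Longrightarrow> (x, y) \<in> r \<Longrightarrow> x \<in> I"
  shows "liftable (I :: 'y set set)"
  unfolding liftable_def
proof (intro allI impI)
  fix J h n
  assume "subgrp J \<and> J \<subseteq> cylinder I \<and> support_closed (cylinder I) J \<and>
     additive_mod \<int> (cylinder I) h \<and> additive_mod {0} J n \<and> (\<forall>j\<in>J. n j - h j \<in> \<int>)"
  then have J: "subgrp J" "J \<subseteq> cylinder I" "support_closed (cylinder I) J"
    and h: "additive_mod \<int> (cylinder I) h"
    and n: "additive_mod {0} J n" "\<forall>j\<in>J. n j - h j \<in> \<int>"
    by auto
  have lin: "(x, y) \<in> r \<or> (y, x) \<in> r" for x y
    using r by (metis UNIV_I wo_rel.TOTALS wo_rel.intro)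
  define closed where "closed = (\<lambda>K. K \<subseteq> I \<and> (\<forall>y\<in>K. \<forall>x. (x, y) \<in> r \<longrightarrow> x \<in> K))"
  have nested: "K \<subseteq> K' \<or> K' \<subseteq> K" if "closed K" "closed K'" for K K'
    using that lin unfolding closed_def by blast
  define S where "S = {G. {(j, n j) | j. j \<in> J} \<subseteq> G \<and> (\<exists>K. closed K \<and> partial_lift J h K G)}"
  obtain G0 where "partial_lift J h {} G0" "\<And>j. j \<in> J \<Longrightarrow> (j, n j) \<in> G0"
    using partial_lift_initial[OF J h n] by blast
  then have "G0 \<in> S"
    unfolding S_def closed_def by blast
  have "\<exists>G\<in>S. \<forall>X\<in>S. G \<subseteq> X \<longrightarrow> X = G"
  proof (rule subset_Zorn_nonempty)
    show "S \<noteq> {}" using \<open>G0 \<in> S\<close> by auto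
    fix C assume C: "C \<noteq> {}" "subset.chain S C"
    then have "\<forall>G\<in>C. \<exists>K. closed K \<and> partial_lift J h K G"
      by (auto simp: S_def subset_chain_def)
    then obtain K where K: "\<And>G. G \<in> C \<Longrightarrow> closed (K G)" "\<And>G. G \<in> C \<Longrightarrow> partial_lift J h (K G) G"
      by metis
    define P where "P = (\<lambda>G. (K G, G)) ` C"
    have "fst ` P = K ` C" "snd ` P = C" by (auto simp: P_def image_image)
    have "closed (\<Union>(K ` C))" using K(1) unfolding closed_def by blast
    moreover have "partial_lift J h (\<Union>(fst ` P)) (\<Union>(snd ` P))"
    proof (rule partial_lift_Union)
      show "P \<noteq> {}" using C(1) by (auto simp: P_def)
      show "partial_lift J h L G" if "(L, G) \<in> P" for L G
        using that K(2) by (auto simp: P_def)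
      show "subset.chain UNIV (fst ` P)"
        unfolding \<open>fst ` P = K ` C\<close> subset_chain_def using K(1) nested by blast
      show "subset.chain UNIV (snd ` P)"
        using C(2) unfolding \<open>snd ` P = C\<close> subset_chain_def by blast
    qed
    then have "partial_lift J h (\<Union>(K ` C)) (\<Union>C)"
      using \<open>fst ` P = K ` C\<close> \<open>snd ` P = C\<close> by simp
    moreover have "{(j, n j) | j. j \<in> J} \<subseteq> \<Union>C"
    proof -
      obtain G where "G \<in> C" using C(1) by blast
      then have "G \<in> S" using C(2) by (auto simp: subset_chain_def)
      then show ?thesis using \<open>G \<in> C\<close> unfolding S_def by blast
    qed
    ultimately show "\<Union>C \<in> S" unfolding S_def by blast
  qed
  then obtain G where G: "G \<in> S" and max: "\<And>X. X \<in> S \<Longrightarrow> G \<subseteq> X \<Longrightarrow> X = G"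
    by auto
  then have Jn: "(j, n j) \<in> G" if "j \<in> J" for j using that unfolding S_def by blast
  \<comment> \<open>The same graph may serve several initial segments. Their union \<open>K\<close>
    is used, since adjoining a generator may enlarge the segment without enlarging the
    graph.\<close>
  define P where "P = {(K, G) | K. closed K \<and> partial_lift J h K G}"
  define K where "K = \<Union>(fst ` P)"
  have "closed L" if "L \<in> fst ` P" for L
    using that by (auto simp: P_def)
  then have L: "L \<subseteq> I" "y \<in> L \<Longrightarrow> (x, y) \<in> r \<Longrightarrow> x \<in> L" if "L \<in> fst ` P" for L x y
    using that unfolding closed_def by blast+
  have "closed K"
    unfolding closed_def
  proof (intro conjI ballI allI impI)
    show "K \<subseteq> I" unfolding K_def using L(1) by blast
    show "x \<in> K" if "y \<in> K" "(x, y) \<in> r" for x y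
      using that L(2) unfolding K_def by blast
  qed
  have "snd ` P = {G}" using G by (force simp: S_def P_def)
  have "partial_lift J h (\<Union>(fst ` P)) (\<Union>(snd ` P))"
  proof (rule partial_lift_Union)
    show "P \<noteq> {}" using \<open>snd ` P = {G}\<close> by blast
    show "subset.chain UNIV (fst ` P)"
      using nested unfolding P_def subset_chain_def by auto
    show "subset.chain UNIV (snd ` P)"
      unfolding \<open>snd ` P = {G}\<close> subset_chain_def by blast
  qed (auto simp: P_def)
  then have K: "closed K" "partial_lift J h K G"
    using \<open>closed K\<close> \<open>snd ` P = {G}\<close> by (simp_all add: K_def)
  have "K = I"
  proof (rule ccontr)
    assume "K \<noteq> I"
    then have "I - K \<noteq> {}" using K(1) by (auto simp: closed_def)
    then obtain e where e: "e \<in> I - K" "\<And>x. x \<in> I - K \<Longrightarrow> (e, x) \<in> r"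
      using wo_rel.minim_in[OF wo_rel.intro[OF r(1)], of "I - K"]
        wo_rel.minim_least[OF wo_rel.intro[OF r(1)], of "I - K"] r(2) by auto
    have antisym: "x = y" if "(x, y) \<in> r" "(y, x) \<in> r" for x y
      using wo_rel.ANTISYM[OF wo_rel.intro[OF r(1)]] that by (auto dest: antisymD)
    have "underS r e = K"
      unfolding underS_def using e K(1) I lin antisym unfolding closed_def by blast
    then have "liftable K" using sub e(1) by blast
    then obtain G' where G': "partial_lift J h (insert e K) G'" "G \<subseteq> G'"
      using partial_lift_step[OF _ _ J h K(2), of e] e(1) K(1) by (auto simp: closed_def)
    have "closed (insert e K)"
      using K(1) e I \<open>underS r e = K\<close> unfolding closed_def underS_def by blast
    then have "G' \<in> S" using G' Jn unfolding S_def by blast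
    then have "G' = G" using max G'(2) by blast
    then have "(insert e K, G) \<in> P" using G'(1) \<open>closed (insert e K)\<close> by (simp add: P_def)
    then show False using e(1) unfolding K_def by force
  qed
  then have PG: "partial_lift J h I G" using K(2) by simp
  define m where "m = (\<lambda>f. SOME t. (f, t) \<in> G)"
  have m: "(f, m f) \<in> G" if "f \<in> cylinder I" for f
  proof -
    have "\<exists>a\<in>cylinder I. f - a \<in> J"
      using that subgrp_0[OF J(1)] by (intro bexI[of _ f]) auto
    then have "\<exists>t. (f, t) \<in> G" using partial_liftD(3)[OF PG] by blast
    then show ?thesis unfolding m_def by (rule someI_ex)
  qed
  show "\<exists>m. additive_mod {0} (cylinder I) m \<and> (\<forall>j\<in>J. m j = n j) \<and> (\<forall>f\<in>cylinder I. m f - h f \<in> \<int>)"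
  proof (intro exI conjI ballI)
    show "additive_mod {0} (cylinder I) m"
      unfolding additive_mod_def
    proof safe
      fix f g assume fg: "f \<in> cylinder I" "g \<in> cylinder I"
      then have "(f, m f) + (g, m g) \<in> G"
        using m subgrp_add[OF partial_liftD(1)[OF PG]] by blast
      then show "m (f + g) - m f - m g = 0"
        using partial_liftD(4)[OF PG m[OF subgrp_add[OF subgrp_cylinder fg]]] by simp
    qed
    show "m j = n j" if "j \<in> J" for j
      using partial_liftD(4)[OF PG m Jn[OF that]] that J(2) by blast
    show "m f - h f \<in> \<int>" if "f \<in> cylinder I" for f
      using partial_liftD(2)[OF PG m[OF that]] .
  qed
qed

text \<open>Noebeling's theorem on groups of bounded functions, in lifting form: the generators are
  adjoined one at a time along a well-order.\<close>

lemma liftable_UNIV: "liftable (UNIV :: 'y set set)"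
proof -
  obtain r :: "'y set rel" where "well_order_on UNIV r"
    using well_order_on by blast
  then have r: "Well_order r" "Field r = UNIV"
    using well_order_on_Well_order by blast+
  then have "wf (r - Id)" by (simp add: well_order_on_def)
  \<comment> \<open>Well-founded induction gives all proper initial segments; one more application
    of \<open>liftable_extend\<close> then gives the whole type.\<close>
  then have "liftable (underS r e)" for e
  proof (induction e)
    case (less e)
    show ?case
    proof (rule liftable_extend[OF r])
      show "liftable (underS r x)" if "x \<in> underS r e" for x
        using that less by (auto simp: underS_def)
      show "x \<in> underS r e" if "y \<in> underS r e" "(x, y) \<in> r" for x y
      proof -
        have "(x, e) \<in> r" using that wo_rel.TRANS[OF wo_rel.intro[OF r(1)]] by (auto simp: underS_def dest: transD)
        moreover have "x \<noteq> e"
          using that wo_rel.ANTISYM[OF wo_rel.intro[OF r(1)]] by (auto simp: underS_def dest: antisymD)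
        ultimately show ?thesis by (simp add: underS_def)
      qed
    qed
  qed
  then show ?thesis by (rule liftable_extend[OF r _ UNIV_I])
qed

section \<open>Integral extension of homomorphisms and exactness of duals\<close>

definition additive_on :: "'g::ab_group_add set \<Rightarrow> ('g \<Rightarrow> int) \<Rightarrow> bool" where
  "additive_on A c \<longleftrightarrow> (\<forall>x\<in>A. \<forall>y\<in>A. c (x + y) = c x + c y)"

lemma additive_on_diff:
  assumes "additive_on A c" "subgrp A" "x \<in> A" "y \<in> A"
  shows "c (x - y) = c x - c y"
proof -
  have "c ((x - y) + y) = c (x - y) + c y"
    using assms subgrp_diff unfolding additive_on_def by blast
  then show ?thesis by simp
qed

lemma additive_on_0: "additive_on A c \<Longrightarrow> subgrp A \<Longrightarrow> c 0 = 0"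
  using additive_on_diff[of A c 0 0] subgrp_0[of A] by simp

text \<open>In other words, \<open>Ext (G / A, \<int>) = 0\<close> for \<open>A = {x \<in> G. T x \<in> J}\<close>.\<close>

theorem extend_additive:
  fixes T :: "'g::ring_1 \<Rightarrow> 'z \<Rightarrow> int"
  assumes G: "subgrp G" and T: "\<And>x y. x \<in> G \<Longrightarrow> y \<in> G \<Longrightarrow> T (x + y) = T x + T y"
    and J: "subgrp J" "support_closed (Collect (\<lambda>f. finite (range f))) J"
    and fin: "\<And>x. x \<in> G \<Longrightarrow> finite (range (T x))" "\<And>j. j \<in> J \<Longrightarrow> finite (range j)"
    and c: "additive_on {x \<in> G. T x \<in> J} c"
  obtains c' where "additive_on G c'" "\<And>x. x \<in> G \<Longrightarrow> T x \<in> J \<Longrightarrow> c' x = c x"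
proof -
  define A where "A = {x \<in> G. T x \<in> J}"
  have cyl: "cylinder UNIV = Collect (\<lambda>f :: 'z \<Rightarrow> int. finite (range f))"
    using finite_range_cylinder cylinder_finite_range by blast
  have T_diff: "T (x - y) = T x - T y" if "x \<in> G" "y \<in> G" for x y
    using T[of "x - y" y] subgrp_diff[OF G] that by simp
  have A: "subgrp A"
    using T_diff[of 0 0] T_diff G subgrp_0[OF J(1)] subgrp_diff[OF J(1)]
    by (auto simp: subgrp_def A_def)
  have cA: "additive_mod {0} A (\<lambda>x. of_int (c x))"
    using c unfolding additive_mod_def additive_on_def A_def by (simp flip: of_int_add)
  \<comment> \<open>Over the divisible group \<real> the extension is free of charge; the rest of
    the proof makes it integral.\<close>
  obtain d where d: "additive_mod {0} UNIV d" "\<And>x. x \<in> A \<Longrightarrow> d x = of_int (c x)"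
    using extend_additive_mod[OF A subgrp_zero cA] by auto
  have d_add: "d (x + y) = d x + d y" for x y
    using d(1) by (simp add: additive_mod_def algebra_simps)
  \<comment> \<open>Since \<open>d\<close> is integral on \<open>A\<close>, the class of
    \<open>d x\<close> modulo \<int> depends only on \<open>T x\<close> modulo \<open>J\<close>. So
    \<open>d\<close> descends to a character of \<open>B\<close>, represented by means of the
    section \<open>s\<close>.\<close>
  define B where "B = {b. \<exists>x\<in>G. b - T x \<in> J}"
  define s where "s = (\<lambda>b. SOME x. x \<in> G \<and> b - T x \<in> J)"
  have s: "s b \<in> G" "b - T (s b) \<in> J" if "b \<in> B" for b
    using that someI_ex[of "\<lambda>x. x \<in> G \<and> b - T x \<in> J"] by (auto simp: B_def s_def)
  have key: "d x - d (s b) \<in> \<int>" if "x \<in> G" "b \<in> B" "b - T x \<in> J" for b x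
  proof -
    have "(b - T (s b)) - (b - T x) \<in> J" using that s subgrp_diff[OF J(1)] by blast
    then have "x - s b \<in> A" using that s[of b] T_diff subgrp_diff[OF G] by (simp add: A_def)
    then have "d (x - s b) \<in> \<int>" using d(2) by simp
    moreover have "d (x - s b) = d x - d (s b)" using d_add[of "x - s b" "s b"] by simp
    ultimately show ?thesis by simp
  qed
  have B: "subgrp B"
    unfolding subgrp_def
  proof safe
    show "0 \<in> B" using subgrp_0[OF G] T_diff[of 0 0] subgrp_0[OF J(1)] by (force simp: B_def)
    fix b b' assume b: "b \<in> B" "b' \<in> B"
    have "(b - T (s b)) - (b' - T (s b')) \<in> J" using b s subgrp_diff[OF J(1)] by blast
    moreover have "(b - T (s b)) - (b' - T (s b')) = (b - b') - T (s b - s b')"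
      using T_diff[of "s b" "s b'"] b s(1) by (simp add: algebra_simps)
    ultimately show "b - b' \<in> B"
      using b s(1) subgrp_diff[OF G, of "s b" "s b'"] unfolding B_def by auto
  qed
  have "additive_mod \<int> B (\<lambda>b. d (s b))"
    unfolding additive_mod_def
  proof (intro ballI)
    fix b b' assume b: "b \<in> B" "b' \<in> B"
    have "(b - T (s b)) + (b' - T (s b')) \<in> J" using b s subgrp_add[OF J(1)] by blast
    then have "(b + b') - T (s b + s b') \<in> J" using b s T by (simp add: algebra_simps)
    then have "d (s b + s b') - d (s (b + b')) \<in> \<int>"
      by (rule key[OF subgrp_add[OF G s(1)[OF b(1)] s(1)[OF b(2)]] subgrp_add[OF B b]])
    from Ints_minus[OF this] show "d (s (b + b')) - d (s b) - d (s b') \<in> \<int>"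
      using d_add by (simp add: algebra_simps)
  qed
  then obtain h where h: "additive_mod \<int> UNIV h" "\<And>b. b \<in> B \<Longrightarrow> h b - d (s b) \<in> \<int>"
    using extend_additive_mod[OF B subgrp_Ints] by blast
  have hJ: "h j \<in> \<int>" if "j \<in> J" for j
  proof -
    have "j \<in> B" "j - T 0 \<in> J"
      using that subgrp_0[OF G] T_diff[of 0 0] by (force simp: B_def)+
    then have "d 0 - d (s j) \<in> \<int>" using key subgrp_0[OF G] by blast
    moreover have "d 0 = 0" using d_add[of 0 0] by simp
    ultimately have "h j - d (s j) - (d 0 - d (s j)) \<in> \<int>" "d 0 = 0"
      using h(2)[OF \<open>j \<in> B\<close>] Ints_diff by blast+
    then show ?thesis by simp
  qed
  \<comment> \<open>The character, extended to all functions, is integral on \<open>J\<close>; hence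
    it can be lifted with the prescribed lift \<open>0\<close> there.\<close>
  have "\<exists>m. additive_mod {0} (cylinder UNIV) m \<and> (\<forall>j\<in>J. m j = 0) \<and> (\<forall>f\<in>cylinder UNIV. m f - h f \<in> \<int>)"
  proof (rule liftable_UNIV[unfolded liftable_def, rule_format, of J h "\<lambda>_. 0"], intro conjI)
    show "additive_mod \<int> (cylinder UNIV) h" using h(1) by (simp add: additive_mod_def)
    show "\<forall>j\<in>J. 0 - h j \<in> \<int>" using hJ by auto
  qed (use J fin(2) in \<open>auto simp: cyl additive_mod_def\<close>)
  then obtain m where m: "additive_mod {0} (cylinder UNIV) m" "\<And>j. j \<in> J \<Longrightarrow> m j = 0"
    "\<And>f. f \<in> cylinder UNIV \<Longrightarrow> m f - h f \<in> \<int>" by blast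
  have int: "d x - m (T x) \<in> \<int>" if "x \<in> G" for x
  proof -
    have TB: "T x \<in> B" using that subgrp_0[OF J(1)] unfolding B_def by force
    have "d x - d (s (T x)) \<in> \<int>" using key[OF that TB] subgrp_0[OF J(1)] by simp
    moreover have "m (T x) - h (T x) \<in> \<int>" using m(3) fin(1)[OF that] by (simp add: cyl)
    moreover have "h (T x) - d (s (T x)) \<in> \<int>" using h(2) TB by blast
    ultimately have "d x - d (s (T x)) - (h (T x) - d (s (T x)) + (m (T x) - h (T x))) \<in> \<int>"
      by (meson Ints_add Ints_diff)
    then show ?thesis by simp
  qed
  \<comment> \<open>The difference is integral, so the floor only changes its type. On
    \<open>A\<close> the correction \<open>m (T x)\<close> vanishes and \<open>c\<close> is
    recovered.\<close>
  define c' where "c' = (\<lambda>x. \<lfloor>d x - m (T x)\<rfloor>)"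
  have c': "of_int (c' x) = d x - m (T x)" if "x \<in> G" for x
    using int[OF that] by (simp add: c'_def)
  show thesis
  proof
    show "additive_on G c'"
      unfolding additive_on_def
    proof safe
      fix x y assume xy: "x \<in> G" "y \<in> G"
      have "m (T x + T y) - m (T x) - m (T y) = 0"
        using m(1) fin(1) xy unfolding additive_mod_def cyl by blast
      then have "real_of_int (c' (x + y)) = real_of_int (c' x + c' y)"
        using xy c' subgrp_add[OF G] T d_add by simp
      then show "c' (x + y) = c' x + c' y" by linarith
    qed
    fix x assume "x \<in> G" "T x \<in> J"
    then have "real_of_int (c' x) = real_of_int (c x)"
      using c'[of x] m(2) d(2)[of x] by (simp add: A_def)
    then show "c' x = c x" by linarith
  qed
qed

text \<open>By \<open>exact\<close> the preimage of \<open>J\<close> is spanned by \<open>N1\<close>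
  and the image of \<open>\<delta>\<close>. There the required equations leave no choice for
  \<open>b\<close>, and the condition on \<open>c\<close> makes the forced values well defined;
  \<open>extend_additive\<close> carries them to \<open>G1\<close>.\<close>

lemma dual_exact:
  fixes T :: "'g::ring_1 \<Rightarrow> 'z \<Rightarrow> int" and \<delta> :: "'f::ab_group_add \<Rightarrow> 'g"
  assumes G0: "subgrp G0" and G1: "subgrp G1" and N1: "subgrp N1" "N1 \<subseteq> G1"
    and \<delta>: "\<And>x y. x \<in> G0 \<Longrightarrow> y \<in> G0 \<Longrightarrow> \<delta> (x + y) = \<delta> x + \<delta> y" "\<And>x. x \<in> G0 \<Longrightarrow> \<delta> x \<in> G1"
    and T: "\<And>x y. x \<in> G1 \<Longrightarrow> y \<in> G1 \<Longrightarrow> T (x + y) = T x + T y"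
    and J: "subgrp J" "support_closed (Collect (\<lambda>f. finite (range f))) J"
    and fin: "\<And>x. x \<in> G1 \<Longrightarrow> finite (range (T x))" "\<And>j. j \<in> J \<Longrightarrow> finite (range j)"
    and exact: "\<And>x. x \<in> G1 \<Longrightarrow> T x \<in> J \<longleftrightarrow> (\<exists>y\<in>G0. x - \<delta> y \<in> N1)"
    and c: "additive_on G0 c" "\<And>y. y \<in> G0 \<Longrightarrow> \<delta> y \<in> N1 \<Longrightarrow> c y = 0"
  obtains b where "additive_on G1 b" "\<And>x. x \<in> N1 \<Longrightarrow> b x = 0" "\<And>y. y \<in> G0 \<Longrightarrow> b (\<delta> y) = c y"
proof -
  define s where "s = (\<lambda>x. SOME y. y \<in> G0 \<and> x - \<delta> y \<in> N1)"
  have s: "s x \<in> G0" "x - \<delta> (s x) \<in> N1" if "x \<in> G1" "T x \<in> J" for x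
    using exact[OF that(1)] that(2) someI_ex[of "\<lambda>y. y \<in> G0 \<and> x - \<delta> y \<in> N1"] unfolding s_def by blast+
  have \<delta>_diff: "\<delta> (x - y) = \<delta> x - \<delta> y" if "x \<in> G0" "y \<in> G0" for x y
    using \<delta>(1)[of "x - y" y] that subgrp_diff[OF G0] by simp
  have \<delta>0: "\<delta> 0 = 0" using \<delta>_diff[of 0 0] subgrp_0[OF G0] by simp
  have key: "c (s x) = c y" if "x \<in> G1" "y \<in> G0" "x - \<delta> y \<in> N1" for x y
  proof -
    have x: "T x \<in> J" using exact that by blast
    have "(x - \<delta> y) - (x - \<delta> (s x)) \<in> N1"
      using that s[OF that(1) x] N1(1) subgrp_diff by blast
    then have "\<delta> (s x - y) \<in> N1" using \<delta>_diff s[OF that(1) x] that by simp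
    then have "c (s x - y) = 0" using c(2) s[OF that(1) x] that subgrp_diff[OF G0] by blast
    then show ?thesis using additive_on_diff[OF c(1) G0] s[OF that(1) x] that by simp
  qed
  have add: "additive_on {x \<in> G1. T x \<in> J} (\<lambda>x. c (s x))"
    unfolding additive_on_def
  proof clarify
    fix x y assume *: "x \<in> G1" "T x \<in> J" "y \<in> G1" "T y \<in> J"
    have "(x - \<delta> (s x)) + (y - \<delta> (s y)) \<in> N1"
      using * s N1(1) subgrp_add by blast
    then have "x + y - \<delta> (s x + s y) \<in> N1"
      using \<delta>(1) s * by (simp add: algebra_simps)
    then have "c (s (x + y)) = c (s x + s y)"
      using * s by (intro key subgrp_add[OF G0] subgrp_add[OF G1])
    also have "\<dots> = c (s x) + c (s y)" using c(1) s * unfolding additive_on_def by blast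
    finally show "c (s (x + y)) = c (s x) + c (s y)" .
  qed
  from extend_additive[OF G1 T J fin add]
  obtain b where b: "additive_on G1 b" "\<And>x. x \<in> G1 \<Longrightarrow> T x \<in> J \<Longrightarrow> b x = c (s x)"
    by blast
  show thesis
  proof
    show "additive_on G1 b" by fact
    show "b x = 0" if "x \<in> N1" for x
    proof -
      have x: "x \<in> G1" "x - \<delta> 0 \<in> N1" using that N1 \<delta>0 by auto
      then have "T x \<in> J" using exact subgrp_0[OF G0] by blast
      then have "b x = c 0" using b(2) key x subgrp_0[OF G0] by simp
      then show ?thesis using additive_on_0[OF c(1) G0] by simp
    qed
    show "b (\<delta> y) = c y" if "y \<in> G0" for y
    proof -
      have y: "\<delta> y \<in> G1" "\<delta> y - \<delta> y \<in> N1" using that \<delta>(2) subgrp_0[OF N1(1)] by auto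
      then have "T (\<delta> y) \<in> J" using exact that by blast
      then show ?thesis using b(2) key y that by simp
    qed
  qed
qed

subsection \<open>Supports\<close>

lemma cochain_support_subset: "cochain_support X \<phi> \<subseteq> topspace X"
  by (auto simp: cochain_support_def)

lemma not_in_supportI:
  "openin X U \<Longrightarrow> x \<in> U \<Longrightarrow> (\<And>xs. set xs \<subseteq> U \<Longrightarrow> \<phi> xs = 0) \<Longrightarrow> x \<notin> cochain_support X \<phi>"
  by (auto simp: cochain_support_def)

lemma not_in_supportE:
  assumes "x \<notin> cochain_support X \<phi>" "x \<in> topspace X"
  obtains U where "openin X U" "x \<in> U" "\<And>xs. set xs \<subseteq> U \<Longrightarrow> \<phi> xs = 0"
  using assms unfolding cochain_support_def by blast

lemma closedin_cochain_support: "closedin X (cochain_support X \<phi>)"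
proof -
  have "topspace X - cochain_support X \<phi> = \<Union>{U. openin X U \<and> (\<forall>xs. set xs \<subseteq> U \<longrightarrow> \<phi> xs = 0)}"
    using openin_subset[of X] unfolding cochain_support_def by blast
  moreover have "openin X \<dots>" by auto
  ultimately show ?thesis using cochain_support_subset by (metis closedin_def)
qed

lemma cochain_support_local:
  assumes "x \<notin> cochain_support X \<phi>" "openin X V" "x \<in> V" and
    "\<And>xs. set xs \<subseteq> V \<Longrightarrow> \<phi> xs = 0 \<Longrightarrow> \<psi> xs = 0"
  shows "x \<notin> cochain_support X \<psi>"
proof -
  have "x \<in> topspace X" using assms openin_subset by blast
  then obtain U where "openin X U" "x \<in> U" "\<And>xs. set xs \<subseteq> U \<Longrightarrow> \<phi> xs = 0"
    using assms(1) unfolding cochain_support_def by blast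
  then show ?thesis using assms by (intro not_in_supportI[of X "U \<inter> V"]) auto
qed

lemma cochain_support_mono:
  assumes "\<And>xs. set xs \<subseteq> topspace X \<Longrightarrow> \<phi> xs = 0 \<Longrightarrow> \<psi> xs = 0"
  shows "cochain_support X \<psi> \<subseteq> cochain_support X \<phi>"
  using cochain_support_local[of _ X \<phi> "topspace X" \<psi>] assms cochain_support_subset[of X \<psi>] by blast

lemma cochain_support_add: "cochain_support X (\<phi> + \<psi>) \<subseteq> cochain_support X \<phi> \<union> cochain_support X \<psi>"
proof
  fix x assume x: "x \<in> cochain_support X (\<phi> + \<psi>)"
  show "x \<in> cochain_support X \<phi> \<union> cochain_support X \<psi>"
  proof (rule ccontr)
    assume "x \<notin> cochain_support X \<phi> \<union> cochain_support X \<psi>"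
    then obtain U where "openin X U" "x \<in> U" "\<And>xs. set xs \<subseteq> U \<Longrightarrow> \<phi> xs = 0" "x \<notin> cochain_support X \<psi>"
      using x cochain_support_subset by (metis Un_iff not_in_supportE subsetD)
    then show False using x cochain_support_local[of x X \<psi> U "\<phi> + \<psi>"] by auto
  qed
qed

lemma cochain_support_uminus: "cochain_support X (- \<phi>) = cochain_support X \<phi>"
  by (auto simp: cochain_support_def)

lemma cochain_support_diff: "cochain_support X (\<phi> - \<psi>) \<subseteq> cochain_support X \<phi> \<union> cochain_support X \<psi>"
  using cochain_support_add[of X \<phi> "- \<psi>"] by (simp add: cochain_support_uminus)

lemma cochain_support_0 [simp]: "cochain_support X 0 = {}" "cochain_support X (\<lambda>_. 0) = {}"
  by (auto simp: cochain_support_def)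

lemma cochain_support_sum: "cochain_support X (sum \<phi> I) \<subseteq> (\<Union>i\<in>I. cochain_support X (\<phi> i))"
proof (induction I rule: infinite_finite_induct)
  case (insert i I)
  then show ?case
    unfolding sum.insert[OF insert.hyps] using cochain_support_add[of X "\<phi> i" "sum \<phi> I"] by blast
qed simp_all

text \<open>Being locally zero at the points of \<open>S\<close> is inherited by functions with
  smaller support, so these are groups \<open>J\<close> that \<open>extend_additive\<close> accepts.
  For \<open>S = topspace X\<close> they are the finitely valued functions that are locally
  zero.\<close>

definition null_near :: "'a topology \<Rightarrow> 'a set \<Rightarrow> 'a cochain set" where
  "null_near X S = {\<phi>. finite (range \<phi>) \<and> S \<inter> cochain_support X \<phi> = {}}"

lemma finite_range_diff:
  fixes f g :: "'b \<Rightarrow> int"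
  assumes "finite (range f)" "finite (range g)"
  shows "finite (range (f - g))"
proof -
  have "range (f - g) \<subseteq> (\<lambda>(a, b). a - b) ` (range f \<times> range g)" by auto
  then show ?thesis using assms finite_subset by blast
qed

lemma subgrp_null_near: "subgrp (null_near X S)"
  unfolding subgrp_def
proof (intro conjI ballI)
  show "0 \<in> null_near X S" by (simp add: null_near_def) 
  show "\<phi> - \<psi> \<in> null_near X S" if "\<phi> \<in> null_near X S" "\<psi> \<in> null_near X S" for \<phi> \<psi>
    using that finite_range_diff[of \<phi> \<psi>] cochain_support_diff[of X \<phi> \<psi>] unfolding null_near_def by blast
qed

lemma support_closed_null_near: "support_closed (Collect (\<lambda>f. finite (range f))) (null_near X S)"
proof -
  have "cochain_support X f \<subseteq> cochain_support X j" if "\<forall>xs. f xs \<noteq> 0 \<longrightarrow> j xs \<noteq> 0" for f j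
    using that by (intro cochain_support_mono) auto
  then show ?thesis unfolding support_closed_def null_near_def by blast
qed

lemma null_near_finite_range: "j \<in> null_near X S \<Longrightarrow> finite (range j)"
  by (simp add: null_near_def)

lemma subgrp_cochains: "subgrp (cochains X q)"
  unfolding subgrp_def
proof safe
  show "0 \<in> cochains X q" by (simp add: cochains_def zero_fun_def)
  show "\<phi> - \<psi> \<in> cochains X q" if "\<phi> \<in> cochains X q" "\<psi> \<in> cochains X q" for \<phi> \<psi>
    unfolding cochains_def
  proof (intro CollectI conjI allI impI)
    show "finite (range (\<phi> - \<psi>))" using that finite_range_diff by (auto simp: cochains_def)
    fix xs assume "(\<phi> - \<psi>) xs \<noteq> 0"
    then have "\<phi> xs \<noteq> 0 \<or> \<psi> xs \<noteq> 0" by auto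
    then show "length xs = Suc q" "set xs \<subseteq> topspace X" using that unfolding cochains_def by blast+
  qed
qed

text \<open>A model, on the space \<open>X\<close> itself, for the compactly supported cochains of
  an open subspace \<open>U\<close>. Up to locally zero cochains \<open>restr\<close> identifies the
  two whenever extension by zero exists (\<open>extendable\<close>).\<close>

definition cochains_in :: "'a topology \<Rightarrow> 'a set \<Rightarrow> nat \<Rightarrow> 'a cochain set" where
  "cochains_in X U q = {\<phi> \<in> compact_cochains X q. cochain_support X \<phi> \<subseteq> U}"

lemma compact_cochains_diff:
  assumes "\<phi> \<in> compact_cochains X q" "\<psi> \<in> compact_cochains X q"
  shows "\<phi> - \<psi> \<in> compact_cochains X q"
proof -
  have "compactin X (cochain_support X \<phi> \<union> cochain_support X \<psi>)"
    using assms by (intro compactin_Un) (auto simp: compact_cochains_def)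
  then have "compactin X (cochain_support X (\<phi> - \<psi>))"
    using closed_compactin cochain_support_diff closedin_cochain_support by metis
  then show ?thesis
    using assms subgrp_diff[OF subgrp_cochains] by (auto simp: compact_cochains_def)
qed

lemma subgrp_compact_cochains: "subgrp (compact_cochains X q)"
  using compact_cochains_diff subgrp_0[OF subgrp_cochains]
  by (auto simp: subgrp_def) (simp add: compact_cochains_def)

lemma subgrp_cochains_in: "subgrp (cochains_in X U q)"
  unfolding subgrp_def
proof (intro conjI ballI)
  show "0 \<in> cochains_in X U q"
    using subgrp_0[OF subgrp_compact_cochains] by (simp add: cochains_in_def)
  show "\<phi> - \<psi> \<in> cochains_in X U q" if "\<phi> \<in> cochains_in X U q" "\<psi> \<in> cochains_in X U q" for \<phi> \<psi>
    using that compact_cochains_diff[of \<phi> X q \<psi>] cochain_support_diff[of X \<phi> \<psi>]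
    unfolding cochains_in_def by blast
qed

lemma cochains_in_subset: "cochains_in X U q \<subseteq> compact_cochains X q"
  by (auto simp: cochains_in_def)

lemma cochains_in_mono: "U \<subseteq> V \<Longrightarrow> cochains_in X U q \<subseteq> cochains_in X V q"
  by (auto simp: cochains_in_def)

lemma cochains_in_topspace: "cochains_in X (topspace X) q = compact_cochains X q"
  using cochain_support_subset[of X] unfolding cochains_in_def by blast

lemma cochainsD:
  assumes "\<phi> \<in> cochains X q"
  shows "finite (range \<phi>)" "\<And>xs. \<phi> xs \<noteq> 0 \<Longrightarrow> length xs = Suc q" "\<And>xs. \<phi> xs \<noteq> 0 \<Longrightarrow> set xs \<subseteq> topspace X"
  using assms by (auto simp: cochains_def)

lemma compact_cochainsD: "\<phi> \<in> compact_cochains X q \<Longrightarrow> \<phi> \<in> cochains X q"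
  by (simp add: compact_cochains_def)

lemma compact_cochains_cong:
  assumes "\<phi> \<in> compact_cochains X q" "\<psi> \<in> cochains X q" "cochain_support X (\<psi> - \<phi>) = {}"
  shows "\<psi> \<in> compact_cochains X q" "cochain_support X \<psi> \<subseteq> cochain_support X \<phi>"
proof -
  show *: "cochain_support X \<psi> \<subseteq> cochain_support X \<phi>"
    using cochain_support_add[of X "\<psi> - \<phi>" \<phi>] assms by simp
  show "\<psi> \<in> compact_cochains X q"
    using assms closed_compactin[OF _ * closedin_cochain_support] by (simp add: compact_cochains_def)
qed

subsection \<open>Coboundary and prism operator\<close>

text \<open>The coboundary formula without the guard on \<open>topspace\<close>. Freed of it, the
  sum satisfies the recursion \<open>alt_faces_Cons\<close>, by which all sign computations become
  inductions on lists.\<close>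

definition alt_faces :: "('a list \<Rightarrow> int) \<Rightarrow> 'a list \<Rightarrow> int" where
  "alt_faces \<phi> xs = (\<Sum>i<length xs. (-1) ^ i * \<phi> (take i xs @ drop (Suc i) xs))"

lemma coboundary_alt_faces:
  "coboundary X \<phi> = (\<lambda>xs. if set xs \<subseteq> topspace X then alt_faces \<phi> xs else 0)"
  by (auto simp: coboundary_def alt_faces_def)

lemma alt_faces_Nil [simp]: "alt_faces \<phi> [] = 0"
  by (simp add: alt_faces_def)

lemma alt_faces_Cons [simp]: "alt_faces \<phi> (x # xs) = \<phi> xs - alt_faces (\<lambda>ys. \<phi> (x # ys)) xs"
  by (simp add: alt_faces_def sum.lessThan_Suc_shift sum_negf del: sum.lessThan_Suc)

lemma alt_faces_cong:
  "(\<And>ys. set ys \<subseteq> set xs \<Longrightarrow> length xs = Suc (length ys) \<Longrightarrow> \<phi> ys = \<psi> ys) \<Longrightarrow>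
    alt_faces \<phi> xs = alt_faces \<psi> xs"
proof (induction xs arbitrary: \<phi> \<psi>)
  case (Cons x xs)
  have "alt_faces (\<lambda>ys. \<phi> (x # ys)) xs = alt_faces (\<lambda>ys. \<psi> (x # ys)) xs"
    by (intro Cons.IH Cons.prems) auto
  then show ?case using Cons.prems[of xs] by auto
qed auto

lemma alt_faces_zero:
  assumes "\<And>ys. set ys \<subseteq> set xs \<Longrightarrow> length xs = Suc (length ys) \<Longrightarrow> \<phi> ys = 0"
  shows "alt_faces \<phi> xs = 0"
proof -
  have "alt_faces \<phi> xs = alt_faces (\<lambda>_. 0) xs" using assms by (intro alt_faces_cong)
  then show ?thesis by (simp add: alt_faces_def)
qed

lemma alt_faces_diff: "alt_faces (\<lambda>ys. \<phi> ys - \<psi> ys) xs = alt_faces \<phi> xs - alt_faces \<psi> xs"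
  by (simp add: alt_faces_def right_diff_distrib sum_subtractf)

lemma alt_faces_add: "alt_faces (\<lambda>ys. \<phi> ys + \<psi> ys) xs = alt_faces \<phi> xs + alt_faces \<psi> xs"
  by (simp add: alt_faces_def distrib_left sum.distrib)

lemma alt_faces_alt_faces: "alt_faces (alt_faces \<phi>) xs = 0"
  by (induction xs arbitrary: \<phi>) (simp_all add: alt_faces_diff)

lemma alt_faces_map: "alt_faces \<phi> (map f xs) = alt_faces (\<lambda>ys. \<phi> (map f ys)) xs"
  by (induction xs arbitrary: \<phi>) auto

text \<open>The alternating sum over \<open>i\<close> of \<phi> at the list
  \<open>x_0, ..., x_i, r x_i, ..., r x_n\<close>: the usual subdivision of the prism between a
  simplex and its image under \<open>r\<close>. It is a homotopy from the identity to
  \<open>r\<close>, and \<open>r\<close> may be any function.\<close>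

fun prism :: "('a \<Rightarrow> 'a) \<Rightarrow> ('a list \<Rightarrow> int) \<Rightarrow> 'a list \<Rightarrow> int" where
  "prism r \<phi> [] = 0"
| "prism r \<phi> (x # xs) = \<phi> (x # map r (x # xs)) - prism r (\<lambda>ys. \<phi> (x # ys)) xs"

lemma prism_diff: "prism r (\<lambda>ys. \<phi> ys - \<psi> ys) xs = prism r \<phi> xs - prism r \<psi> xs"
  by (induction xs arbitrary: \<phi> \<psi>) auto

lemma prism_homotopy:
  "alt_faces (prism r \<phi>) xs + prism r (alt_faces \<phi>) xs = \<phi> (map r xs) - \<phi> xs"
proof (induction xs arbitrary: \<phi>)
  case (Cons x xs)
  from Cons[of "\<lambda>ys. \<phi> (x # ys)"] show ?case
    by (simp add: alt_faces_diff prism_diff alt_faces_map)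
qed simp

text \<open>All vertices of the prism over \<open>xs\<close> are entries of \<open>xs\<close> or
  their images under \<open>r\<close>.\<close>

lemma prism_zero:
  "(\<And>ys. set ys \<subseteq> A \<Longrightarrow> length ys = Suc (length xs) \<Longrightarrow> \<phi> ys = 0) \<Longrightarrow> set xs \<subseteq> A \<Longrightarrow> r ` set xs \<subseteq> A
    \<Longrightarrow> prism r \<phi> xs = 0"
proof (induction xs arbitrary: \<phi>)
  case (Cons x xs)
  have "prism r (\<lambda>ys. \<phi> (x # ys)) xs = 0"
    using Cons.prems by (intro Cons.IH Cons.prems(1)) auto
  moreover have "\<phi> (x # map r (x # xs)) = 0" using Cons.prems by (intro Cons.prems(1)) auto
  ultimately show ?case by simp
qed simp

text \<open>The finite set of values must be uniform in \<phi>, because the recursion replaces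
  \<phi> by the functions with a fixed first argument.\<close>

lemma prism_finite:
  assumes "finite R"
  shows "\<exists>V. finite V \<and> (\<forall>\<phi> xs. range \<phi> \<subseteq> R \<longrightarrow> length xs = n \<longrightarrow> prism r \<phi> xs \<in> V)"
proof (induction n)
  case 0
  then show ?case by (intro exI[of _ "{0}"]) auto
next
  case (Suc n)
  then obtain V where V: "finite V" "\<And>\<phi> xs. range \<phi> \<subseteq> R \<Longrightarrow> length xs = n \<Longrightarrow> prism r \<phi> xs \<in> V"
    by blast
  have "prism r \<phi> xs \<in> (\<lambda>(a, b). a - b) ` (R \<times> V)" if "range \<phi> \<subseteq> R" "length xs = Suc n" for \<phi> xs
  proof -
    obtain y ys where xs: "xs = y # ys" "length ys = n" using \<open>length xs = Suc n\<close> by (cases xs) auto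
    have "prism r (\<lambda>zs. \<phi> (y # zs)) ys \<in> V" using V(2)[of "\<lambda>zs. \<phi> (y # zs)"] that xs by blast
    moreover have "\<phi> (y # map r (y # ys)) \<in> R" using that by blast
    ultimately show ?thesis using xs(1) by force
  qed
  then show ?case using assms V(1) by (intro exI[of _ "(\<lambda>(a, b). a - b) ` (R \<times> V)"]) auto
qed

lemma alt_faces_finite:
  assumes "finite (range \<phi>)"
  shows "finite (alt_faces \<phi> ` {xs. length xs = n})"
proof -
  have "alt_faces \<phi> ` {xs. length xs = n} \<subseteq>
      (\<lambda>v. \<Sum>i<n. (-1) ^ i * v i) ` (\<Pi>\<^sub>E i\<in>{..<n}. range \<phi>)"
  proof safe
    fix xs :: "'a list" assume "n = length xs"
    then show "alt_faces \<phi> xs \<in> (\<lambda>v. \<Sum>i<length xs. (-1) ^ i * v i) ` (\<Pi>\<^sub>E i\<in>{..<length xs}. range \<phi>)"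
      by (intro image_eqI[of _ _ "\<lambda>i\<in>{..<length xs}. \<phi> (take i xs @ drop (Suc i) xs)"])
        (auto simp: alt_faces_def)
  qed
  then show ?thesis using assms by (meson finite_PiE finite_imageI finite_lessThan finite_subset)
qed

lemma cochainsI:
  assumes "finite (\<phi> ` {xs. length xs = Suc q})" "\<And>xs. \<phi> xs \<noteq> 0 \<Longrightarrow> length xs = Suc q \<and> set xs \<subseteq> topspace X"
  shows "\<phi> \<in> cochains X q"
proof -
  have "range \<phi> \<subseteq> insert 0 (\<phi> ` {xs. length xs = Suc q})" using assms(2) by blast
  then have "finite (range \<phi>)" using assms(1) finite_subset by blast
  then show ?thesis using assms(2) by (auto simp: cochains_def)
qed

lemma coboundary_cochains:
  assumes "\<phi> \<in> cochains X q"
  shows "coboundary X \<phi> \<in> cochains X (Suc q)"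
proof (rule cochainsI)
  have "coboundary X \<phi> ` {xs. length xs = Suc (Suc q)} \<subseteq> insert 0 (alt_faces \<phi> ` {xs. length xs = Suc (Suc q)})"
    by (auto simp: coboundary_alt_faces)
  then show "finite (coboundary X \<phi> ` {xs. length xs = Suc (Suc q)})"
    using alt_faces_finite[OF cochainsD(1)[OF assms]] by (meson finite.insertI finite_subset)
  fix xs assume "coboundary X \<phi> xs \<noteq> 0"
  then have "alt_faces \<phi> xs \<noteq> 0" "set xs \<subseteq> topspace X" by (auto simp: coboundary_alt_faces split: if_splits)
  moreover from this obtain ys where "length xs = Suc (length ys)" "\<phi> ys \<noteq> 0"
    using alt_faces_zero[of xs \<phi>] by metis
  ultimately show "length xs = Suc (Suc q) \<and> set xs \<subseteq> topspace X"
    using cochainsD(2)[OF assms] by simp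
qed

lemma cochain_support_coboundary: "cochain_support X (coboundary X \<phi>) \<subseteq> cochain_support X \<phi>"
proof
  fix x assume x: "x \<in> cochain_support X (coboundary X \<phi>)"
  show "x \<in> cochain_support X \<phi>"
  proof (rule ccontr)
    assume "x \<notin> cochain_support X \<phi>"
    then obtain U where U: "openin X U" "x \<in> U" "\<And>xs. set xs \<subseteq> U \<Longrightarrow> \<phi> xs = 0"
      using x cochain_support_subset by (metis not_in_supportE subsetD)
    then have "coboundary X \<phi> xs = 0" if "set xs \<subseteq> U" for xs
      using that alt_faces_zero[of xs \<phi>] by (auto simp: coboundary_alt_faces)
    then show False using x U(1,2) not_in_supportI by metis
  qed
qed

lemma coboundary_compact: "\<phi> \<in> compact_cochains X q \<Longrightarrow> coboundary X \<phi> \<in> compact_cochains X (Suc q)"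
  using coboundary_cochains closed_compactin[OF _ cochain_support_coboundary closedin_cochain_support]
  by (auto simp: compact_cochains_def)

lemma coboundary_in: "\<phi> \<in> cochains_in X U q \<Longrightarrow> coboundary X \<phi> \<in> cochains_in X U (Suc q)"
  using coboundary_compact cochain_support_coboundary[of X \<phi>] by (auto simp: cochains_in_def)

lemma coboundary_add: "coboundary X (\<phi> + \<psi>) = coboundary X \<phi> + coboundary X \<psi>"
  by (auto simp: coboundary_alt_faces plus_fun_def alt_faces_add)

lemma coboundary_diff: "coboundary X (\<phi> - \<psi>) = coboundary X \<phi> - coboundary X \<psi>"
  by (auto simp: coboundary_alt_faces fun_diff_def alt_faces_diff)

lemma coboundary_0 [simp]: "coboundary X 0 = 0"
  using coboundary_diff[of X 0 0] by simp

lemma coboundary_sum: "coboundary X (sum \<phi> I) = (\<Sum>i\<in>I. coboundary X (\<phi> i))"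
  by (induction I rule: infinite_finite_induct)
    (simp_all only: sum.infinite sum.empty sum.insert coboundary_0 coboundary_add not_False_eq_True)

lemma coboundary_coboundary: "coboundary X (coboundary X \<phi>) = 0"
proof
  fix xs
  have "alt_faces (coboundary X \<phi>) xs = alt_faces (alt_faces \<phi>) xs" if "set xs \<subseteq> topspace X"
    using that by (intro alt_faces_cong) (auto simp: coboundary_alt_faces)
  then show "coboundary X (coboundary X \<phi>) xs = 0 xs"
    by (auto simp: coboundary_alt_faces[of X "coboundary X \<phi>"] alt_faces_alt_faces)
qed

subsection \<open>Pullbacks\<close>

lemma pullback_add: "cochain_pullback X f (\<phi> + \<psi>) = cochain_pullback X f \<phi> + cochain_pullback X f \<psi>"
  by (auto simp: cochain_pullback_def)

lemma pullback_diff: "cochain_pullback X f (\<phi> - \<psi>) = cochain_pullback X f \<phi> - cochain_pullback X f \<psi>"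
  by (auto simp: cochain_pullback_def)

lemma pullback_cochains:
  assumes "\<phi> \<in> cochains Y q"
  shows "cochain_pullback X f \<phi> \<in> cochains X q"
proof (rule cochainsI)
  have "cochain_pullback X f \<phi> ` {xs. length xs = Suc q} \<subseteq> insert 0 (range \<phi>)"
    by (auto simp: cochain_pullback_def)
  then show "finite (cochain_pullback X f \<phi> ` {xs. length xs = Suc q})"
    using cochainsD(1)[OF assms] by (meson finite.insertI finite_subset)
  show "length xs = Suc q \<and> set xs \<subseteq> topspace X" if "cochain_pullback X f \<phi> xs \<noteq> 0" for xs
    using that cochainsD(2)[OF assms, of "map f xs"] by (simp add: cochain_pullback_def split: if_splits)
qed

lemma pullback_support:
  assumes "continuous_map X Y f"
  shows "cochain_support X (cochain_pullback X f \<phi>) \<subseteq> {x \<in> topspace X. f x \<in> cochain_support Y \<phi>}"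
proof
  fix x assume x: "x \<in> cochain_support X (cochain_pullback X f \<phi>)"
  then have xX: "x \<in> topspace X" using cochain_support_subset[of X] by blast
  moreover have "f x \<in> cochain_support Y \<phi>"
  proof (rule ccontr)
    assume "f x \<notin> cochain_support Y \<phi>"
    moreover have "f x \<in> topspace Y" using xX assms by (auto simp: continuous_map_def)
    ultimately obtain U where U: "openin Y U" "f x \<in> U" "\<And>xs. set xs \<subseteq> U \<Longrightarrow> \<phi> xs = 0"
      unfolding cochain_support_def by blast
    have "x \<notin> cochain_support X (cochain_pullback X f \<phi>)"
    proof (rule not_in_supportI)
      show "openin X {x \<in> topspace X. f x \<in> U}"
        using assms U(1) openin_continuous_map_preimage by blast
      show "x \<in> {x \<in> topspace X. f x \<in> U}" using xX U(2) by simp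
      show "cochain_pullback X f \<phi> xs = 0" if "set xs \<subseteq> {x \<in> topspace X. f x \<in> U}" for xs
        using that U(3)[of "map f xs"] by (auto simp: cochain_pullback_def)
    qed
    then show False using x by simp
  qed
  ultimately show "x \<in> {x \<in> topspace X. f x \<in> cochain_support Y \<phi>}" by simp
qed

lemma pullback_coboundary:
  assumes "f ` topspace X \<subseteq> topspace Y"
  shows "cochain_pullback X f (coboundary Y \<phi>) = coboundary X (cochain_pullback X f \<phi>)"
proof
  fix xs
  show "cochain_pullback X f (coboundary Y \<phi>) xs = coboundary X (cochain_pullback X f \<phi>) xs"
  proof (cases "set xs \<subseteq> topspace X")
    case True
    then have "alt_faces (cochain_pullback X f \<phi>) xs = alt_faces (\<lambda>ys. \<phi> (map f ys)) xs"
      by (intro alt_faces_cong) (auto simp: cochain_pullback_def)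
    then show ?thesis using True assms
      by (auto simp: cochain_pullback_def coboundary_alt_faces alt_faces_map)
  qed (auto simp: cochain_pullback_def coboundary_alt_faces)
qed

lemma pullback_pullback:
  assumes "f ` topspace X \<subseteq> topspace Y"
  shows "cochain_pullback X f (cochain_pullback Y g \<phi>) = cochain_pullback X (g \<circ> f) \<phi>"
  using assms by (auto simp: cochain_pullback_def fun_eq_iff)

lemma pullback_cong:
  assumes "\<And>x. x \<in> topspace X \<Longrightarrow> f x = g x"
  shows "cochain_pullback X f \<phi> = cochain_pullback X g \<phi>"
proof
  fix xs
  have "map f xs = map g xs" if "set xs \<subseteq> topspace X"
    using that assms by (intro map_cong) auto
  then show "cochain_pullback X f \<phi> xs = cochain_pullback X g \<phi> xs"
    unfolding cochain_pullback_def by metis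
qed

subsection \<open>Chains and homology classes\<close>

lemma infinite_chains_iff:
  "c \<in> infinite_chains X q \<longleftrightarrow> (\<forall>\<phi>. \<phi> \<notin> compact_cochains X q \<longrightarrow> c \<phi> = 0) \<and>
     additive_on (compact_cochains X q) c \<and>
     (\<forall>\<phi>\<in>compact_cochains X q. cochain_support X \<phi> = {} \<longrightarrow> c \<phi> = 0)"
  unfolding infinite_chains_def additive_on_def plus_fun_def by blast

lemma chain_additive: "c \<in> infinite_chains X q \<Longrightarrow> additive_on (compact_cochains X q) c"
  by (simp add: infinite_chains_iff)

lemma chain_diff:
  "c \<in> infinite_chains X q \<Longrightarrow> \<phi> \<in> compact_cochains X q \<Longrightarrow> \<psi> \<in> compact_cochains X q \<Longrightarrow> c (\<phi> - \<psi>) = c \<phi> - c \<psi>"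
  using additive_on_diff chain_additive subgrp_compact_cochains by blast

lemma chain_zero:
  "c \<in> infinite_chains X q \<Longrightarrow> \<phi> \<in> compact_cochains X q \<Longrightarrow> cochain_support X \<phi> = {} \<Longrightarrow> c \<phi> = 0"
  by (simp add: infinite_chains_iff)

lemma chain_cong:
  assumes "c \<in> infinite_chains X q" "\<phi> \<in> compact_cochains X q" "\<psi> \<in> compact_cochains X q"
    "cochain_support X (\<phi> - \<psi>) = {}"
  shows "c \<phi> = c \<psi>"
proof -
  have "c (\<phi> - \<psi>) = 0"
    using chain_zero[OF assms(1) _ assms(4)] assms(2,3) compact_cochains_diff by blast
  then show ?thesis using chain_diff[OF assms(1-3)] by simp
qed

lemma subgrp_infinite_chains: "subgrp (infinite_chains X q)"
proof -
  have "c - c' \<in> infinite_chains X q" if "c \<in> infinite_chains X q" "c' \<in> infinite_chains X q" for c c'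
    using that unfolding infinite_chains_iff additive_on_def by simp
  then show ?thesis
    by (simp add: subgrp_def infinite_chains_iff additive_on_def)
qed

lemma boundary_diff: "boundary X q (b - b') = boundary X q b - boundary X q b'"
  by (auto simp: boundary_def)

lemma boundary_chain:
  assumes "b \<in> infinite_chains X (Suc q)"
  shows "boundary X q b \<in> infinite_chains X q"
proof -
  have "boundary X q b (\<phi> + \<psi>) = boundary X q b \<phi> + boundary X q b \<psi>"
    if "\<phi> \<in> compact_cochains X q" "\<psi> \<in> compact_cochains X q" for \<phi> \<psi>
    using that chain_additive[OF assms] subgrp_add[OF subgrp_compact_cochains that]
      coboundary_compact[OF that(1)] coboundary_compact[OF that(2)]
    by (simp add: boundary_def coboundary_add additive_on_def)
  moreover have "b (coboundary X \<phi>) = 0" if "\<phi> \<in> compact_cochains X q" "cochain_support X \<phi> = {}" for \<phi>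
    using that chain_zero[OF assms coboundary_compact] cochain_support_coboundary[of X \<phi>] by simp
  ultimately show ?thesis by (auto simp: infinite_chains_iff additive_on_def boundary_def)
qed

lemma boundary_boundary:
  assumes "b \<in> infinite_chains X (Suc (Suc q))"
  shows "boundary X q (boundary X (Suc q) b) = (\<lambda>_. 0)"
proof -
  have "b 0 = 0" using additive_on_0 chain_additive[OF assms] subgrp_compact_cochains by blast
  then show ?thesis by (auto simp: boundary_def coboundary_compact coboundary_coboundary)
qed

lemma infinite_cyclesD: "c \<in> infinite_cycles X q \<Longrightarrow> c \<in> infinite_chains X q"
  by (simp add: infinite_cycles_def)

lemma cycle_coboundary:
  assumes "c \<in> infinite_cycles X (Suc q)" "\<phi> \<in> compact_cochains X q"
  shows "c (coboundary X \<phi>) = 0"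
proof -
  have "boundary X q c \<phi> = 0" using assms(1) by (simp add: infinite_cycles_def)
  then show ?thesis using assms(2) by (simp add: boundary_def)
qed

lemma cycleI:
  assumes "c \<in> infinite_chains X q"
    "\<And>p \<phi>. q = Suc p \<Longrightarrow> \<phi> \<in> compact_cochains X p \<Longrightarrow> c (coboundary X \<phi>) = 0"
  shows "c \<in> infinite_cycles X q"
  using assms by (auto simp: infinite_cycles_def boundary_def)

lemma subgrp_infinite_cycles: "subgrp (infinite_cycles X q)"
  unfolding subgrp_def
proof (intro conjI ballI)
  show "0 \<in> infinite_cycles X q"
    using subgrp_0[OF subgrp_infinite_chains] by (intro cycleI) auto
  fix c c' assume *: "c \<in> infinite_cycles X q" "c' \<in> infinite_cycles X q"
  show "c - c' \<in> infinite_cycles X q"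
  proof (rule cycleI)
    show "c - c' \<in> infinite_chains X q"
      using * infinite_cyclesD subgrp_diff[OF subgrp_infinite_chains] by blast
    show "(c - c') (coboundary X \<phi>) = 0" if "q = Suc p" "\<phi> \<in> compact_cochains X p" for p \<phi>
      using * that cycle_coboundary[of c X p \<phi>] cycle_coboundary[of c' X p \<phi>] by simp
  qed
qed

lemma subgrp_infinite_boundaries: "subgrp (infinite_boundaries X q)"
  unfolding subgrp_def
proof (intro conjI ballI)
  have "boundary X q 0 = 0" by (auto simp: boundary_def)
  then show "0 \<in> infinite_boundaries X q"
    using subgrp_0[OF subgrp_infinite_chains] unfolding infinite_boundaries_def by (metis imageI)
  fix c c' assume "c \<in> infinite_boundaries X q" "c' \<in> infinite_boundaries X q"
  then obtain b b' where "c = boundary X q b" "c' = boundary X q b'"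
    "b \<in> infinite_chains X (Suc q)" "b' \<in> infinite_chains X (Suc q)"
    unfolding infinite_boundaries_def by blast
  then have "c - c' = boundary X q (b - b')" "b - b' \<in> infinite_chains X (Suc q)"
    using boundary_diff subgrp_diff[OF subgrp_infinite_chains] by (metis, blast)
  then show "c - c' \<in> infinite_boundaries X q"
    unfolding infinite_boundaries_def by blast
qed

lemma infinite_boundaries_cycles: "infinite_boundaries X q \<subseteq> infinite_cycles X q"
  using boundary_chain boundary_boundary unfolding infinite_boundaries_def infinite_cycles_def by blast

lemma boundaryI:
  assumes c: "c \<in> infinite_chains X q" and b: "additive_on (compact_cochains X (Suc q)) b"
    "\<And>\<phi>. \<phi> \<in> compact_cochains X (Suc q) \<Longrightarrow> cochain_support X \<phi> = {} \<Longrightarrow> b \<phi> = 0"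
    and eq: "\<And>\<phi>. \<phi> \<in> compact_cochains X q \<Longrightarrow> c \<phi> = b (coboundary X \<phi>)"
  shows "c \<in> infinite_boundaries X q"
proof -
  define b' where "b' = (\<lambda>\<phi>. if \<phi> \<in> compact_cochains X (Suc q) then b \<phi> else 0)"
  have "b' \<in> infinite_chains X (Suc q)"
    using b by (auto simp: b'_def infinite_chains_iff additive_on_def
        dest: subgrp_add[OF subgrp_compact_cochains])
  moreover have "c = boundary X q b'"
    using c eq coboundary_compact by (auto simp: boundary_def b'_def infinite_chains_iff fun_eq_iff)
  ultimately show ?thesis unfolding infinite_boundaries_def by blast
qed

lemma chainI:
  assumes "additive_on (compact_cochains X q) b"
    "\<And>\<phi>. \<phi> \<in> compact_cochains X q \<Longrightarrow> cochain_support X \<phi> = {} \<Longrightarrow> b \<phi> = 0"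
  shows "(\<lambda>\<phi>. if \<phi> \<in> compact_cochains X q then b \<phi> else 0) \<in> infinite_chains X q"
  using assms by (auto simp: infinite_chains_iff additive_on_def
      dest: subgrp_add[OF subgrp_compact_cochains])

definition hclass :: "'a topology \<Rightarrow> nat \<Rightarrow> 'a infinite_chain \<Rightarrow> 'a infinite_chain set" where
  "hclass X q c = infinite_boundaries X q #>\<^bsub>cycle_group X q\<^esub> c"

lemma hclass_eq: "hclass X q c = (\<lambda>b. b + c) ` infinite_boundaries X q"
  by (auto simp: hclass_def r_coset_def cycle_group_def plus_fun_def)

lemma mem_hclass: "c' \<in> hclass X q c \<longleftrightarrow> c' - c \<in> infinite_boundaries X q"
  by (auto simp: hclass_eq image_iff) (metis diff_add_cancel)

lemma hclass_eq_iff: "hclass X q c = hclass X q c' \<longleftrightarrow> c - c' \<in> infinite_boundaries X q"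
proof
  assume "hclass X q c = hclass X q c'"
  moreover have "c \<in> hclass X q c"
    using subgrp_0[OF subgrp_infinite_boundaries] by (simp add: mem_hclass)
  ultimately show "c - c' \<in> infinite_boundaries X q" using mem_hclass by blast
next
  assume c: "c - c' \<in> infinite_boundaries X q"
  have "x - c \<in> infinite_boundaries X q \<longleftrightarrow> x - c' \<in> infinite_boundaries X q" for x
    using subgrp_add[OF subgrp_infinite_boundaries c, of "x - c"]
      subgrp_diff[OF subgrp_infinite_boundaries _ c, of "x - c'"] by (auto simp: algebra_simps)
  then show "hclass X q c = hclass X q c'" using mem_hclass by blast
qed

lemma carrier_steenrod_homology: "carrier (steenrod_homology X q) = hclass X q ` infinite_cycles X q"
  by (simp add: steenrod_homology_def carrier_FactGroup hclass_def) (simp add: cycle_group_def)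

lemma steenrod_homologyE:
  assumes "\<alpha> \<in> carrier (steenrod_homology X q)"
  obtains c where "c \<in> infinite_cycles X q" "\<alpha> = hclass X q c"
  using assms by (auto simp: carrier_steenrod_homology)

lemma hclass_in_carrier: "c \<in> infinite_cycles X q \<Longrightarrow> hclass X q c \<in> carrier (steenrod_homology X q)"
  by (simp add: carrier_steenrod_homology)

lemma trivial_homologyD:
  assumes "trivial_group (steenrod_homology X q)"
  shows "infinite_cycles X q \<subseteq> infinite_boundaries X q"
proof
  fix c assume "c \<in> infinite_cycles X q"
  moreover have "0 \<in> infinite_cycles X q" using subgrp_0[OF subgrp_infinite_cycles] .
  ultimately have "hclass X q c = hclass X q 0"
    using assms hclass_in_carrier by (metis singletonD trivial_group_def)
  then show "c \<in> infinite_boundaries X q" by (simp add: hclass_eq_iff)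
qed

text \<open>Evaluates the unions in \<open>steenrod_induced\<close> and
  \<open>steenrod_restriction\<close>: once boundaries go to boundaries all cosets in the union
  coincide, and there is at least one.\<close>

lemma UN_hclass:
  assumes "c \<in> infinite_cycles X q"
    and "\<And>b. b \<in> infinite_boundaries X q \<Longrightarrow> F (b + c) - F c \<in> infinite_boundaries Y r"
  shows "(\<Union>c'\<in>hclass X q c. hclass Y r (F c')) = hclass Y r (F c)"
proof -
  have "hclass Y r (F c') = hclass Y r (F c)" if "c' \<in> hclass X q c" for c'
    using that assms(2) by (auto simp: hclass_eq_iff hclass_eq[of X])
  moreover have "hclass X q c \<noteq> {}"
    using subgrp_0[OF subgrp_infinite_boundaries, of X q] by (auto simp: hclass_eq)
  ultimately show ?thesis by auto
qed

subsection \<open>Proper maps\<close>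

text \<open>The preimage condition is what lets pullback preserve compact supports.\<close>

definition proper_continuous :: "'a topology \<Rightarrow> 'b topology \<Rightarrow> ('a \<Rightarrow> 'b) \<Rightarrow> bool" where
  "proper_continuous X Y f \<longleftrightarrow> continuous_map X Y f \<and>
     (\<forall>K. compactin Y K \<longrightarrow> compactin X {x \<in> topspace X. f x \<in> K})"

lemma pullback_compact:
  assumes f: "proper_continuous X Y f" and \<phi>: "\<phi> \<in> compact_cochains Y q"
  shows "cochain_pullback X f \<phi> \<in> compact_cochains X q"
proof -
  have "compactin X {x \<in> topspace X. f x \<in> cochain_support Y \<phi>}"
    using f \<phi> by (auto simp: proper_continuous_def compact_cochains_def)
  then have "compactin X (cochain_support X (cochain_pullback X f \<phi>))"
    using f closed_compactin[OF _ pullback_support closedin_cochain_support] by (auto simp: proper_continuous_def)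
  then show ?thesis using \<phi> pullback_cochains by (auto simp: compact_cochains_def)
qed

lemma pullback_null:
  "continuous_map X Y f \<Longrightarrow> cochain_support Y \<phi> = {} \<Longrightarrow> cochain_support X (cochain_pullback X f \<phi>) = {}"
  using pullback_support[of X Y f \<phi>] by simp

lemma pushforward_chain:
  assumes f: "proper_continuous X Y f" and c: "c \<in> infinite_chains X q"
  shows "chain_pushforward X Y q f c \<in> infinite_chains Y q"
  unfolding chain_pushforward_def
proof (rule chainI)
  show "additive_on (compact_cochains Y q) (\<lambda>\<phi>. c (cochain_pullback X f \<phi>))"
    using chain_additive[OF c] pullback_compact[OF f] by (auto simp: additive_on_def pullback_add)
  show "c (cochain_pullback X f \<phi>) = 0" if "\<phi> \<in> compact_cochains Y q" "cochain_support Y \<phi> = {}" for \<phi>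
    using that f chain_zero[OF c pullback_compact[OF f]] pullback_null[of X Y f]
    by (auto simp: proper_continuous_def)
qed

lemma pushforward_boundary:
  assumes f: "proper_continuous X Y f"
  shows "chain_pushforward X Y q f (boundary X q b) = boundary Y q (chain_pushforward X Y (Suc q) f b)"
proof -
  have "f ` topspace X \<subseteq> topspace Y" using f by (auto simp: proper_continuous_def continuous_map_def)
  then show ?thesis
    using pullback_compact[OF f]
    by (auto simp: chain_pushforward_def boundary_def coboundary_compact pullback_coboundary)
qed

lemma pushforward_add: "chain_pushforward X Y q f (c + c') = chain_pushforward X Y q f c + chain_pushforward X Y q f c'"
  by (auto simp: chain_pushforward_def)

lemma pushforward_boundaries:
  assumes f: "proper_continuous X Y f" and c: "c \<in> infinite_boundaries X q"
  shows "chain_pushforward X Y q f c \<in> infinite_boundaries Y q"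
  using c pushforward_boundary[OF f] pushforward_chain[OF f] unfolding infinite_boundaries_def by blast

lemma pushforward_cycle:
  assumes f: "proper_continuous X Y f" and c: "c \<in> infinite_cycles X q"
  shows "chain_pushforward X Y q f c \<in> infinite_cycles Y q"
proof (rule cycleI)
  show "chain_pushforward X Y q f c \<in> infinite_chains Y q"
    using pushforward_chain[OF f] c infinite_cyclesD by blast
  fix p \<phi> assume *: "q = Suc p" "\<phi> \<in> compact_cochains Y p"
  have "f ` topspace X \<subseteq> topspace Y" using f by (auto simp: proper_continuous_def continuous_map_def)
  then show "chain_pushforward X Y q f c (coboundary Y \<phi>) = 0"
    using * c pullback_compact[OF f *(2)] cycle_coboundary
    by (auto simp: chain_pushforward_def pullback_coboundary)
qed

lemma steenrod_induced_hclass: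
  assumes f: "proper_continuous X Y f" and c: "c \<in> infinite_cycles X q"
  shows "steenrod_induced X Y q f (hclass X q c) = hclass Y q (chain_pushforward X Y q f c)"
  unfolding steenrod_induced_def hclass_def[of Y, symmetric]
  by (rule UN_hclass[OF c]) (simp add: pushforward_add pushforward_boundaries[OF f])

subsection \<open>Restriction to open sets\<close>

abbreviation restr :: "'a topology \<Rightarrow> 'a set \<Rightarrow> 'a cochain \<Rightarrow> 'a cochain" where
  "restr X U \<equiv> cochain_pullback (subtopology X U) id"

lemma restr_apply: "restr X U \<phi> xs = (if set xs \<subseteq> topspace X \<inter> U then \<phi> xs else 0)"
  by (auto simp: cochain_pullback_def)

text \<open>A neighbourhood in an open subspace is one in \<open>X\<close>, so no support gets lost.
  For general subspaces only the inclusion \<open>restr_support_subset\<close> remains; for closed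
  ones tautness makes up for the difference.\<close>

lemma restr_support:
  assumes "openin X U"
  shows "cochain_support (subtopology X U) (restr X U \<phi>) = cochain_support X \<phi> \<inter> U"
proof
  show "cochain_support (subtopology X U) (restr X U \<phi>) \<subseteq> cochain_support X \<phi> \<inter> U"
    using pullback_support[of "subtopology X U" X id \<phi>] by (auto simp: continuous_map_from_subtopology)
  have UX: "U \<subseteq> topspace X" using assms openin_subset by blast
  show "cochain_support X \<phi> \<inter> U \<subseteq> cochain_support (subtopology X U) (restr X U \<phi>)"
  proof
    fix x assume x: "x \<in> cochain_support X \<phi> \<inter> U"
    show "x \<in> cochain_support (subtopology X U) (restr X U \<phi>)"
    proof (rule ccontr)
      assume "x \<notin> cochain_support (subtopology X U) (restr X U \<phi>)"
      moreover have "x \<in> topspace (subtopology X U)" using x UX by auto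
      ultimately obtain V where V: "openin (subtopology X U) V" "x \<in> V"
        "\<And>xs. set xs \<subseteq> V \<Longrightarrow> restr X U \<phi> xs = 0"
        unfolding cochain_support_def by blast
      then have "openin X V" "V \<subseteq> U" using assms openin_open_subtopology by blast+
      then have "\<phi> xs = 0" if "set xs \<subseteq> V" for xs
        using V(3)[OF that] that UX by (simp add: restr_apply subset_iff split: if_splits)
      then show False using x \<open>openin X V\<close> V(2) not_in_supportI by (metis IntD1)
    qed
  qed
qed

lemma restr_compact:
  assumes "openin X U" "\<phi> \<in> cochains_in X U q"
  shows "restr X U \<phi> \<in> compact_cochains (subtopology X U) q"
proof -
  have "cochain_support (subtopology X U) (restr X U \<phi>) = cochain_support X \<phi>"
    using restr_support[OF assms(1)] assms(2) by (auto simp: cochains_in_def)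
  then have "compactin (subtopology X U) (cochain_support (subtopology X U) (restr X U \<phi>))"
    using assms(2) by (simp add: compactin_subtopology cochains_in_def compact_cochains_def)
  then show ?thesis
    using assms(2) pullback_cochains by (auto simp: compact_cochains_def cochains_in_def)
qed

lemma restr_coboundary: "restr X U (coboundary X \<phi>) = coboundary (subtopology X U) (restr X U \<phi>)"
  by (rule pullback_coboundary) auto

text \<open>A chain of the open subspace \<open>U\<close>, given by its values on the cochains of
  \<open>X\<close> supported in \<open>U\<close> and hence free of the choice in
  \<open>cochain_extension\<close>.\<close>

definition local_chain :: "'a topology \<Rightarrow> 'a set \<Rightarrow> nat \<Rightarrow> ('a cochain \<Rightarrow> int) \<Rightarrow> bool" where
  "local_chain X U q a \<longleftrightarrow> additive_on (cochains_in X U q) a \<and>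
     (\<forall>\<phi>\<in>cochains_in X U q. cochain_support X \<phi> = {} \<longrightarrow> a \<phi> = 0)"

lemma local_chain_diff:
  "local_chain X U q a \<Longrightarrow> \<phi> \<in> cochains_in X U q \<Longrightarrow> \<psi> \<in> cochains_in X U q \<Longrightarrow> a (\<phi> - \<psi>) = a \<phi> - a \<psi>"
  using additive_on_diff subgrp_cochains_in unfolding local_chain_def by blast

lemma local_chain_cong:
  assumes "local_chain X U q a" "\<phi> \<in> cochains_in X U q" "\<psi> \<in> cochains_in X U q"
    "cochain_support X (\<phi> - \<psi>) = {}"
  shows "a \<phi> = a \<psi>"
proof -
  have "\<phi> - \<psi> \<in> cochains_in X U q" using assms subgrp_diff[OF subgrp_cochains_in] by blast
  then have "a (\<phi> - \<psi>) = 0" using assms by (simp add: local_chain_def)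
  then show ?thesis using local_chain_diff[OF assms(1-3)] by simp
qed

lemma chain_local_chain: "c \<in> infinite_chains X q \<Longrightarrow> local_chain X U q c"
  by (auto simp: local_chain_def infinite_chains_iff additive_on_def cochains_in_def)

lemma local_chain_restr:
  assumes "openin X U" "c \<in> infinite_chains (subtopology X U) q"
  shows "local_chain X U q (\<lambda>\<phi>. c (restr X U \<phi>))"
  unfolding local_chain_def
proof (intro conjI ballI impI)
  show "additive_on (cochains_in X U q) (\<lambda>\<phi>. c (restr X U \<phi>))"
    using chain_additive[OF assms(2)] restr_compact[OF assms(1)] by (auto simp: additive_on_def pullback_add)
  show "c (restr X U \<phi>) = 0" if "\<phi> \<in> cochains_in X U q" "cochain_support X \<phi> = {}" for \<phi>
    using chain_zero[OF assms(2) restr_compact[OF assms(1) that(1)]] restr_support[OF assms(1), of \<phi>] that by simp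
qed

text \<open>Existence of the extension by zero, without which the choice operator in
  \<open>cochain_extension\<close> has no content.\<close>

definition extendable :: "'a topology \<Rightarrow> 'a set \<Rightarrow> bool" where
  "extendable X U \<longleftrightarrow> openin X U \<and> (\<forall>q. \<forall>\<phi>\<in>compact_cochains (subtopology X U) q.
     \<exists>\<psi>\<in>cochains_in X U q. cochain_support (subtopology X U) (restr X U \<psi> - \<phi>) = {})"

lemma extendableD:
  assumes "extendable X U"
  shows "openin X U"
    and "\<phi> \<in> compact_cochains (subtopology X U) q \<Longrightarrow> cochain_extension X U q \<phi> \<in> cochains_in X U q \<and>
      cochain_support (subtopology X U) (restr X U (cochain_extension X U q \<phi>) - \<phi>) = {}"
proof -
  show "openin X U" using assms by (simp add: extendable_def)
  assume "\<phi> \<in> compact_cochains (subtopology X U) q"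
  then have "\<exists>\<psi>. \<psi> \<in> compact_cochains X q \<and> cochain_support X \<psi> \<subseteq> U \<and>
        cochain_support (subtopology X U) (\<lambda>xs. restr X U \<psi> xs - \<phi> xs) = {}"
    using assms by (auto simp: extendable_def cochains_in_def fun_diff_def)
  from someI_ex[OF this] show "cochain_extension X U q \<phi> \<in> cochains_in X U q \<and>
      cochain_support (subtopology X U) (restr X U (cochain_extension X U q \<phi>) - \<phi>) = {}"
    unfolding cochain_extension_def cochains_in_def fun_diff_def by blast
qed

text \<open>Local compactness puts the support inside an open \<open>V\<close> that lies in a
  compact \<open>L \<subseteq> U\<close>. Keeping only the tuples with entries in \<open>V\<close>
  changes nothing near the support; outside \<open>U\<close> the complement of \<open>L\<close> is a
  neighbourhood without such tuples.\<close>

lemma extendable: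
  assumes "Hausdorff_space X" "openin X U" "locally_compact_space (subtopology X U)"
  shows "extendable X U"
  unfolding extendable_def
proof (intro conjI allI ballI)
  show "openin X U" by fact
  then have UX: "U \<subseteq> topspace X" by (rule openin_subset)
  fix q \<phi> assume \<phi>: "\<phi> \<in> compact_cochains (subtopology X U) q"
  let ?K = "cochain_support (subtopology X U) \<phi>"
  have K: "compactin (subtopology X U) ?K" using \<phi> by (simp add: compact_cochains_def)
  have "Hausdorff_space (subtopology X U)" using assms(1) Hausdorff_space_subtopology by blast
  then obtain V L where V: "openin (subtopology X U) V" "compactin (subtopology X U) L" "?K \<subseteq> V" "V \<subseteq> L"
    using locally_compact_space_compact_closed_compact[of "subtopology X U"] K assms(3) by metis
  have VX: "openin X V" "V \<subseteq> U" using V(1) assms(2) openin_open_subtopology by blast+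
  have LX: "compactin X L" "L \<subseteq> U" using V(2) by (auto simp: compactin_subtopology)
  define \<psi> where "\<psi> = (\<lambda>xs. if set xs \<subseteq> V then \<phi> xs else 0)"
  have \<psi>c: "\<psi> \<in> cochains X q"
  proof (rule cochainsI)
    have "\<psi> ` {xs. length xs = Suc q} \<subseteq> insert 0 (range \<phi>)" by (auto simp: \<psi>_def)
    then show "finite (\<psi> ` {xs. length xs = Suc q})"
      using cochainsD(1)[OF compact_cochainsD[OF \<phi>]] finite_subset by blast
    show "length xs = Suc q \<and> set xs \<subseteq> topspace X" if "\<psi> xs \<noteq> 0" for xs
      using that cochainsD(2,3)[OF compact_cochainsD[OF \<phi>], of xs] by (auto simp: \<psi>_def split: if_splits)
  qed
  have out: "x \<notin> cochain_support X \<psi>" if x: "x \<in> topspace X" "x \<notin> ?K" for x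
  proof (cases "x \<in> U")
    case True
    then have "x \<in> topspace (subtopology X U)" using UX by auto
    then obtain W where W: "openin (subtopology X U) W" "x \<in> W" "\<And>xs. set xs \<subseteq> W \<Longrightarrow> \<phi> xs = 0"
      using x(2) unfolding cochain_support_def by blast
    then have "openin X W" using assms(2) openin_open_subtopology by blast
    then show ?thesis by (rule not_in_supportI) (use W in \<open>auto simp: \<psi>_def\<close>)
  next
    case False
    show ?thesis
    proof (rule not_in_supportI)
      show "openin X (topspace X - L)"
        using compactin_imp_closedin[OF assms(1) LX(1)] by blast
      show "x \<in> topspace X - L" using x(1) False LX(2) by blast
      fix xs assume "set xs \<subseteq> topspace X - L"
      then have "xs = [] \<or> \<not> set xs \<subseteq> V" using V(4) by (cases xs) auto
      then show "\<psi> xs = 0"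
        using cochainsD(2)[OF compact_cochainsD[OF \<phi>], of "[]"] by (auto simp: \<psi>_def)
    qed
  qed
  have supp: "cochain_support X \<psi> \<subseteq> ?K" using out cochain_support_subset[of X \<psi>] by blast
  have "compactin X ?K" "?K \<subseteq> U" using K by (auto simp: compactin_subtopology)
  then have "\<psi> \<in> cochains_in X U q"
    using closed_compactin[OF _ supp closedin_cochain_support] supp \<psi>c
    by (auto simp: cochains_in_def compact_cochains_def)
  moreover have "x \<notin> cochain_support (subtopology X U) (restr X U \<psi> - \<phi>)" if x: "x \<in> U" for x
  proof (cases "x \<in> V")
    case True
    show ?thesis
    proof (rule not_in_supportI[OF V(1) True])
      show "(restr X U \<psi> - \<phi>) xs = 0" if "set xs \<subseteq> V" for xs
        using that VX openin_subset[OF VX(1)] by (auto simp: restr_apply \<psi>_def)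
    qed
  next
    case False
    then have xK: "x \<notin> ?K" using V(3) by blast
    have "x \<notin> cochain_support (subtopology X U) (restr X U \<psi>)"
      using restr_support[OF assms(2)] supp xK by blast
    then show ?thesis using xK cochain_support_diff[of "subtopology X U" "restr X U \<psi>" \<phi>] by blast
  qed
  then have "cochain_support (subtopology X U) (restr X U \<psi> - \<phi>) = {}"
    using cochain_support_subset[of "subtopology X U"] by auto
  ultimately show "\<exists>\<psi>\<in>cochains_in X U q. cochain_support (subtopology X U) (restr X U \<psi> - \<phi>) = {}" by blast
qed

lemma extension_unique:
  assumes "openin X U" "\<psi> \<in> cochains_in X U q" "\<psi>' \<in> cochains_in X U q"
    "cochain_support (subtopology X U) (restr X U \<psi> - restr X U \<psi>') = {}"
  shows "cochain_support X (\<psi> - \<psi>') = {}"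
proof -
  have "cochain_support X (\<psi> - \<psi>') \<inter> U = {}"
    using restr_support[OF assms(1), of "\<psi> - \<psi>'"] assms(4) by (simp add: pullback_diff)
  moreover have "cochain_support X (\<psi> - \<psi>') \<subseteq> U"
    using assms(2,3) cochain_support_diff[of X \<psi> \<psi>'] by (auto simp: cochains_in_def)
  ultimately show ?thesis by blast
qed

text \<open>\<open>chain_restriction\<close> uses its argument only at extensions, so it makes sense
  for local chains. Extensions are unique up to locally zero cochains, hence any one of them
  computes the value.\<close>

lemma chain_restriction_eq:
  assumes U: "extendable X U" and a: "local_chain X U q a" and \<psi>: "\<psi> \<in> cochains_in X U q"
    and \<phi>: "\<phi> \<in> compact_cochains (subtopology X U) q"
    and eq: "cochain_support (subtopology X U) (restr X U \<psi> - \<phi>) = {}"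
  shows "chain_restriction X U q a \<phi> = a \<psi>"
proof -
  let ?\<epsilon> = "cochain_extension X U q \<phi>"
  have \<epsilon>: "?\<epsilon> \<in> cochains_in X U q" "cochain_support (subtopology X U) (restr X U ?\<epsilon> - \<phi>) = {}"
    using extendableD(2)[OF U \<phi>] by auto
  have "cochain_support (subtopology X U) (restr X U ?\<epsilon> - restr X U \<psi>) = {}"
    using cochain_support_diff[of "subtopology X U" "restr X U ?\<epsilon> - \<phi>" "restr X U \<psi> - \<phi>"] eq \<epsilon>(2) by simp
  then have "cochain_support X (?\<epsilon> - \<psi>) = {}"
    using extension_unique extendableD(1)[OF U] \<epsilon>(1) \<psi> by blast
  then have "a ?\<epsilon> = a \<psi>" using local_chain_cong a \<epsilon>(1) \<psi> by blast
  then show ?thesis using \<phi> by (simp add: chain_restriction_def)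
qed

lemma chain_restriction_restr:
  assumes "extendable X U" "local_chain X U q a" "\<psi> \<in> cochains_in X U q"
  shows "chain_restriction X U q a (restr X U \<psi>) = a \<psi>"
  using restr_compact[OF extendableD(1)[OF assms(1)] assms(3)]
  by (intro chain_restriction_eq[OF assms]) auto

lemma chain_restriction_chain:
  assumes U: "extendable X U" and a: "local_chain X U q a"
  shows "chain_restriction X U q a \<in> infinite_chains (subtopology X U) q"
  unfolding infinite_chains_iff
proof (intro conjI allI ballI impI)
  fix \<phi> assume "\<phi> \<notin> compact_cochains (subtopology X U) q"
  then show "chain_restriction X U q a \<phi> = 0" by (simp add: chain_restriction_def)
next
  let ?\<epsilon> = "cochain_extension X U q"
  note \<epsilon> = extendableD(2)[OF U, THEN conjunct1] extendableD(2)[OF U, THEN conjunct2]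
  show "additive_on (compact_cochains (subtopology X U) q) (chain_restriction X U q a)"
    unfolding additive_on_def
  proof (intro ballI)
    fix \<phi> \<psi> assume *: "\<phi> \<in> compact_cochains (subtopology X U) q" "\<psi> \<in> compact_cochains (subtopology X U) q"
    have "cochain_support (subtopology X U) (restr X U (?\<epsilon> \<phi> + ?\<epsilon> \<psi>) - (\<phi> + \<psi>)) = {}"
      using cochain_support_add[of "subtopology X U" "restr X U (?\<epsilon> \<phi>) - \<phi>" "restr X U (?\<epsilon> \<psi>) - \<psi>"]
        \<epsilon>(2)[OF *(1)] \<epsilon>(2)[OF *(2)] by (simp add: pullback_add algebra_simps)
    then have "chain_restriction X U q a (\<phi> + \<psi>) = a (?\<epsilon> \<phi> + ?\<epsilon> \<psi>)"
      by (intro chain_restriction_eq[OF U a] subgrp_add[OF subgrp_cochains_in]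
          subgrp_add[OF subgrp_compact_cochains] \<epsilon>(1) *)
    then show "chain_restriction X U q a (\<phi> + \<psi>) = chain_restriction X U q a \<phi> + chain_restriction X U q a \<psi>"
      using a \<epsilon>(1) * by (auto simp: chain_restriction_def local_chain_def additive_on_def)
  qed
  fix \<phi> assume *: "\<phi> \<in> compact_cochains (subtopology X U) q" "cochain_support (subtopology X U) \<phi> = {}"
  have "cochain_support (subtopology X U) (restr X U 0 - \<phi>) = {}"
    using cochain_support_diff[of "subtopology X U" 0 \<phi>] *(2) pullback_diff[of "subtopology X U" id 0 0] by simp
  then have "chain_restriction X U q a \<phi> = a 0"
    using chain_restriction_eq[OF U a subgrp_0[OF subgrp_cochains_in] *(1)] by blast
  then show "chain_restriction X U q a \<phi> = 0"
    using a additive_on_0 subgrp_cochains_in unfolding local_chain_def by metis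
qed

lemma chain_restriction_of_restr:
  assumes U: "extendable X U" and c: "c \<in> infinite_chains (subtopology X U) q"
  shows "chain_restriction X U q (\<lambda>\<phi>. c (restr X U \<phi>)) = c"
proof
  fix \<phi>
  show "chain_restriction X U q (\<lambda>\<phi>. c (restr X U \<phi>)) \<phi> = c \<phi>"
  proof (cases "\<phi> \<in> compact_cochains (subtopology X U) q")
    case True
    then show ?thesis
      using chain_cong[OF c restr_compact[OF extendableD(1)[OF U]] True] extendableD(2)[OF U True]
      by (auto simp: chain_restriction_def)
  qed (use c in \<open>auto simp: infinite_chains_iff chain_restriction_def\<close>)
qed

lemma chain_restriction_boundary:
  assumes U: "extendable X U" and b: "local_chain X U (Suc q) b"
  shows "chain_restriction X U q (\<lambda>\<phi>. b (coboundary X \<phi>)) = boundary (subtopology X U) q (chain_restriction X U (Suc q) b)"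
proof
  fix \<phi>
  show "chain_restriction X U q (\<lambda>\<phi>. b (coboundary X \<phi>)) \<phi>
      = boundary (subtopology X U) q (chain_restriction X U (Suc q) b) \<phi>"
  proof (cases "\<phi> \<in> compact_cochains (subtopology X U) q")
    case True
    let ?\<epsilon> = "cochain_extension X U q \<phi>"
    have \<epsilon>: "?\<epsilon> \<in> cochains_in X U q" "cochain_support (subtopology X U) (restr X U ?\<epsilon> - \<phi>) = {}"
      using extendableD(2)[OF U True] by auto
    have "cochain_support (subtopology X U) (restr X U (coboundary X ?\<epsilon>) - coboundary (subtopology X U) \<phi>) = {}"
      using \<epsilon>(2) cochain_support_coboundary[of "subtopology X U" "restr X U ?\<epsilon> - \<phi>"]
      by (simp add: restr_coboundary coboundary_diff)
    then have "chain_restriction X U (Suc q) b (coboundary (subtopology X U) \<phi>) = b (coboundary X ?\<epsilon>)"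
      using \<epsilon>(1) True coboundary_in coboundary_compact by (intro chain_restriction_eq[OF U b]) blast+
    then show ?thesis using True by (simp add: boundary_def chain_restriction_def)
  qed (simp add: boundary_def chain_restriction_def)
qed

lemma chain_restriction_cong:
  assumes U: "extendable X U" and "\<And>\<phi>. \<phi> \<in> cochains_in X U q \<Longrightarrow> a \<phi> = a' \<phi>"
  shows "chain_restriction X U q a = chain_restriction X U q a'"
  using assms(2) extendableD(2)[OF U] by (auto simp: chain_restriction_def)

lemma chain_restriction_add: "chain_restriction X U q (c + c') = chain_restriction X U q c + chain_restriction X U q c'"
  and chain_restriction_diff: "chain_restriction X U q (c - c') = chain_restriction X U q c - chain_restriction X U q c'"
  by (auto simp: chain_restriction_def)

text \<open>Moves the question whether a restricted chain bounds to cochains of \<open>X\<close>,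
  where no extension has to be chosen.\<close>

lemma restriction_boundaries_iff:
  assumes U: "extendable X U" and a: "local_chain X U q a"
  shows "chain_restriction X U q a \<in> infinite_boundaries (subtopology X U) q \<longleftrightarrow>
    (\<exists>b. local_chain X U (Suc q) b \<and> (\<forall>\<phi>\<in>cochains_in X U q. a \<phi> = b (coboundary X \<phi>)))"
proof
  assume "chain_restriction X U q a \<in> infinite_boundaries (subtopology X U) q"
  then obtain b where b: "b \<in> infinite_chains (subtopology X U) (Suc q)"
    "chain_restriction X U q a = boundary (subtopology X U) q b"
    unfolding infinite_boundaries_def by blast
  have "a \<phi> = b (restr X U (coboundary X \<phi>))" if "\<phi> \<in> cochains_in X U q" for \<phi>
    using chain_restriction_restr[OF U a that] b(2) restr_compact[OF extendableD(1)[OF U] that]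
    by (simp add: boundary_def restr_coboundary)
  then show "\<exists>b. local_chain X U (Suc q) b \<and> (\<forall>\<phi>\<in>cochains_in X U q. a \<phi> = b (coboundary X \<phi>))"
    using local_chain_restr[OF extendableD(1)[OF U] b(1)] by blast
next
  assume "\<exists>b. local_chain X U (Suc q) b \<and> (\<forall>\<phi>\<in>cochains_in X U q. a \<phi> = b (coboundary X \<phi>))"
  then obtain b where b: "local_chain X U (Suc q) b" "\<And>\<phi>. \<phi> \<in> cochains_in X U q \<Longrightarrow> a \<phi> = b (coboundary X \<phi>)"
    by blast
  have "chain_restriction X U q a = boundary (subtopology X U) q (chain_restriction X U (Suc q) b)"
    using chain_restriction_cong[OF U, of q a "\<lambda>\<phi>. b (coboundary X \<phi>)"] b chain_restriction_boundary[OF U b(1)] by simp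
  then show "chain_restriction X U q a \<in> infinite_boundaries (subtopology X U) q"
    using chain_restriction_chain[OF U b(1)] unfolding infinite_boundaries_def by blast
qed

lemma chain_restriction_cycle:
  assumes U: "extendable X U" and a: "local_chain X U q a"
    and z: "\<And>p \<phi>. q = Suc p \<Longrightarrow> \<phi> \<in> cochains_in X U p \<Longrightarrow> a (coboundary X \<phi>) = 0"
  shows "chain_restriction X U q a \<in> infinite_cycles (subtopology X U) q"
proof (rule cycleI)
  show "chain_restriction X U q a \<in> infinite_chains (subtopology X U) q"
    by (rule chain_restriction_chain[OF U a])
  fix p \<phi> assume *: "q = Suc p" "\<phi> \<in> compact_cochains (subtopology X U) p"
  have "chain_restriction X U p (\<lambda>\<phi>. a (coboundary X \<phi>)) \<phi> = 0"
    using * z extendableD(2)[OF U *(2)] by (simp add: chain_restriction_def)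
  then show "chain_restriction X U q a (coboundary (subtopology X U) \<phi>) = 0"
    using chain_restriction_boundary[OF U, of p a] a * by (simp add: boundary_def)
qed

lemma chain_restriction_cycles:
  assumes U: "extendable X U" and c: "c \<in> infinite_cycles X q"
  shows "chain_restriction X U q c \<in> infinite_cycles (subtopology X U) q"
proof (rule chain_restriction_cycle[OF U chain_local_chain[OF infinite_cyclesD[OF c]]])
  show "c (coboundary X \<phi>) = 0" if "q = Suc p" "\<phi> \<in> cochains_in X U p" for p \<phi>
    using that c cycle_coboundary cochains_in_subset[of X U p] by blast
qed

lemma steenrod_restriction_hclass:
  assumes U: "extendable X U" and c: "c \<in> infinite_cycles X q"
  shows "steenrod_restriction X U q (hclass X q c) = hclass (subtopology X U) q (chain_restriction X U q c)"
  unfolding steenrod_restriction_def hclass_def[of "subtopology X U", symmetric]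
proof (rule UN_hclass[OF c])
  fix b assume "b \<in> infinite_boundaries X q"
  then obtain b' where b': "b' \<in> infinite_chains X (Suc q)" "b = boundary X q b'"
    unfolding infinite_boundaries_def by blast
  have "chain_restriction X U q b = chain_restriction X U q (\<lambda>\<phi>. b' (coboundary X \<phi>))"
    using b'(2) cochains_in_subset[of X U q] by (intro chain_restriction_cong[OF U]) (auto simp: boundary_def)
  then have "chain_restriction X U q b = boundary (subtopology X U) q (chain_restriction X U (Suc q) b')"
    using chain_restriction_boundary[OF U chain_local_chain[OF b'(1)]] by simp
  then have "chain_restriction X U q b \<in> infinite_boundaries (subtopology X U) q"
    using chain_restriction_chain[OF U chain_local_chain[OF b'(1)]] unfolding infinite_boundaries_def by blast
  then show "chain_restriction X U q (b + c) - chain_restriction X U q c \<in> infinite_boundaries (subtopology X U) q"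
    by (simp add: chain_restriction_add)
qed

text \<open>The working form of the equations that define the classes: equality of homology classes
  on \<open>U\<close> becomes equality of functionals on \<open>cochains_in X U q\<close> up to a
  term that depends only on the coboundary.\<close>

lemma restriction_eq_iff:
  assumes U: "extendable X U" and c: "c \<in> infinite_cycles X q" and m: "m \<in> infinite_chains (subtopology X U) q"
  shows "steenrod_restriction X U q (hclass X q c) = hclass (subtopology X U) q m \<longleftrightarrow>
    (\<exists>b. local_chain X U (Suc q) b \<and> (\<forall>\<phi>\<in>cochains_in X U q. c \<phi> = m (restr X U \<phi>) + b (coboundary X \<phi>)))"
proof -
  define a where "a = (\<lambda>\<phi>. c \<phi> - m (restr X U \<phi>))"
  have a: "local_chain X U q a"
    using chain_local_chain[OF infinite_cyclesD[OF c]] local_chain_restr[OF extendableD(1)[OF U] m]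
    by (auto simp: local_chain_def additive_on_def a_def)
  have "chain_restriction X U q c - m = chain_restriction X U q a"
    using chain_restriction_diff[of X U q c "\<lambda>\<phi>. m (restr X U \<phi>)"] chain_restriction_of_restr[OF U m]
    by (simp add: a_def fun_diff_def)
  then show ?thesis
    unfolding steenrod_restriction_hclass[OF U c] hclass_eq_iff
    using restriction_boundaries_iff[OF U a] by (simp add: a_def algebra_simps)
qed

subsection \<open>Closed subspaces of compact spaces\<close>

lemma compact_cochains_eq: "compact_space X \<Longrightarrow> compact_cochains X q = cochains X q"
  by (auto simp: compact_cochains_def closedin_compact_space closedin_cochain_support)

lemma nbhd_closed:
  assumes "compact_space X" "Hausdorff_space X" "openin X W" "x \<in> W"
  obtains P F where "openin X P" "closedin X F" "x \<in> P" "P \<subseteq> F" "F \<subseteq> W"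
proof -
  have "regular_space X" using assms compact_Hausdorff_imp_regular_space by blast
  then show ?thesis
    using assms(3,4) that unfolding neighbourhood_base_of_closedin[symmetric] neighbourhood_base_of by blast
qed

text \<open>A (discontinuous) retraction of a neighbourhood of \<open>S\<close> that is as close to the identity near
  \<open>S\<close> as a given cover of \<open>S\<close> prescribes.\<close>

lemma approximate_retraction:
  assumes X: "compact_space X" "Hausdorff_space X" and S: "closedin X S"
    and cover: "\<And>s. s \<in> S \<Longrightarrow> \<exists>W. openin X W \<and> s \<in> W \<and> P W"
  obtains r where "r ` topspace X \<subseteq> topspace X" "\<And>x. x \<in> S \<Longrightarrow> r x = x"
    "\<And>s. s \<in> S \<Longrightarrow> \<exists>V W. openin X V \<and> s \<in> V \<and> openin X W \<and> P W \<and> V \<subseteq> W \<and> r ` V \<subseteq> W \<inter> S"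
proof -
  have "\<exists>W Q F. openin X W \<and> P W \<and> openin X Q \<and> closedin X F \<and> s \<in> Q \<and> Q \<subseteq> F \<and> F \<subseteq> W" if "s \<in> S" for s
  proof -
    obtain W where W: "openin X W" "s \<in> W" "P W" using cover \<open>s \<in> S\<close> by blast
    from nbhd_closed[OF X W(1,2)] W show ?thesis by metis
  qed
  then obtain W Q F where W: "\<And>s. s \<in> S \<Longrightarrow> openin X (W s) \<and> P (W s) \<and> openin X (Q s) \<and> closedin X (F s)
      \<and> s \<in> Q s \<and> Q s \<subseteq> F s \<and> F s \<subseteq> W s"
    by metis
  have "compactin X S" using X(1) S closedin_compact_space by blast
  moreover have "\<forall>B\<in>Q ` S. openin X B" "S \<subseteq> \<Union>(Q ` S)" using W by blast+
  ultimately obtain \<F> where "finite \<F>" "\<F> \<subseteq> Q ` S" "S \<subseteq> \<Union>\<F>"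
    unfolding compactin_def by meson
  then obtain T where T: "finite T" "T \<subseteq> S" "S \<subseteq> \<Union>(Q ` T)"
    by (metis finite_subset_image)
  have SX: "S \<subseteq> topspace X" using S closedin_subset by blast
  \<comment> \<open>The candidates for the image of \<open>x\<close>: points of \<open>S\<close>
    that lie in \<open>W t\<close> for all of the finitely many \<open>t\<close> with
    \<open>x\<close> in the closed set \<open>F t\<close>.\<close>
  define R where "R = (\<lambda>x. {y \<in> S. \<forall>t\<in>T. x \<in> F t \<longrightarrow> y \<in> W t})"
  define r where "r = (\<lambda>x. if x \<in> S \<or> R x = {} then x else SOME y. y \<in> R x)"
  have r: "r x \<in> R x" if "x \<notin> S" "R x \<noteq> {}" for x
    using that some_in_eq[of "R x"] by (simp add: r_def)
  show thesis
  proof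
    show "r ` topspace X \<subseteq> topspace X"
    proof safe
      fix x assume "x \<in> topspace X"
      moreover have "r x \<in> S" if "x \<notin> S" "R x \<noteq> {}"
        using r[OF that] unfolding R_def by blast
      moreover have "r x = x" if "x \<in> S \<or> R x = {}" using that by (simp add: r_def)
      ultimately show "r x \<in> topspace X" using SX by (cases "x \<in> S \<or> R x = {}") auto
    qed
    show "r x = x" if "x \<in> S" for x using that by (simp add: r_def)
    fix s assume s: "s \<in> S"
    then obtain t where t: "t \<in> T" "s \<in> Q t" using T(3) by blast
    \<comment> \<open>Removing the closed sets that miss \<open>s\<close> ensures that every
      \<open>F t\<close> containing a point of \<open>V\<close> also contains \<open>s\<close>.
      Hence \<open>s\<close> is a candidate for the image of that point, and the choice in
      \<open>r\<close> is a genuine one.\<close>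
    define V where "V = Q t \<inter> (topspace X - \<Union>(F ` {t \<in> T. s \<notin> F t}))"
    have "openin X V"
    proof -
      have "closedin X (\<Union>(F ` {t \<in> T. s \<notin> F t}))"
        using T W by (intro closedin_Union) auto
      then show ?thesis using W t(1) T(2) unfolding V_def by (intro openin_Int) auto
    qed
    moreover have "s \<in> V" using t s SX by (auto simp: V_def)
    moreover have "V \<subseteq> W t" using W t(1) T(2) unfolding V_def by blast
    moreover have "r x \<in> W t \<inter> S" if "x \<in> V" for x
    proof (cases "x \<in> S")
      case True
      then show ?thesis using that \<open>V \<subseteq> W t\<close> by (auto simp: r_def)
    next
      case False
      have "s \<in> R x"
        using that s T(2) W unfolding R_def V_def by blast
      then have "r x \<in> R x" using r[OF False] by blast
      moreover have "x \<in> F t" using that t(1) T(2) W unfolding V_def by blast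
      ultimately show ?thesis using t(1) by (auto simp: R_def)
    qed
    ultimately show "\<exists>V W. openin X V \<and> s \<in> V \<and> openin X W \<and> P W \<and> V \<subseteq> W \<and> r ` V \<subseteq> W \<inter> S"
      using W t(1) T(2) by (intro exI[of _ V] exI[of _ "W t"]) auto
  qed
qed

text \<open>Here only tuples with all entries in \<open>S\<close> are tested, whereas
  \<open>null_near\<close> tests all tuples near \<open>S\<close>. Up to coboundaries the two
  conditions agree for cocycles: this is tautness.\<close>

definition relative_cochains :: "'a topology \<Rightarrow> 'a set \<Rightarrow> nat \<Rightarrow> 'a cochain set" where
  "relative_cochains X S q = {\<phi> \<in> cochains X q. cochain_support (subtopology X S) (restr X S \<phi>) = {}}"

lemma subgrp_relative_cochains: "subgrp (relative_cochains X S q)"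
  unfolding subgrp_def
proof (intro conjI ballI)
  have "restr X S 0 = 0" using pullback_diff[of "subtopology X S" id 0 0] by simp
  then show "0 \<in> relative_cochains X S q"
    using subgrp_0[OF subgrp_cochains] by (simp add: relative_cochains_def)
  show "\<phi> - \<psi> \<in> relative_cochains X S q"
    if "\<phi> \<in> relative_cochains X S q" "\<psi> \<in> relative_cochains X S q" for \<phi> \<psi>
    using that subgrp_diff[OF subgrp_cochains, of \<phi> X q \<psi>]
      cochain_support_diff[of "subtopology X S" "restr X S \<phi>" "restr X S \<psi>"]
    by (simp add: relative_cochains_def pullback_diff)
qed

lemma coboundary_relative:
  assumes "\<phi> \<in> relative_cochains X S q"
  shows "coboundary X \<phi> \<in> relative_cochains X S (Suc q)"
  using assms coboundary_cochains[of \<phi> X q] cochain_support_coboundary[of "subtopology X S" "restr X S \<phi>"]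
  by (simp add: relative_cochains_def restr_coboundary)

lemma restr_support_subset: "cochain_support (subtopology X S) (restr X S \<phi>) \<subseteq> cochain_support X \<phi> \<inter> S"
  using pullback_support[of "subtopology X S" X id \<phi>] by (auto simp: continuous_map_from_subtopology)

lemma relative_support_disjoint:
  "\<phi> \<in> cochains X q \<Longrightarrow> S \<inter> cochain_support X \<phi> = {} \<Longrightarrow> \<phi> \<in> relative_cochains X S q"
  using restr_support_subset[of X S \<phi>] by (auto simp: relative_cochains_def)

text \<open>Prescribe for \<open>r\<close> a cover by sets \<open>W\<close> on which \<phi> vanishes
  along \<open>S\<close> and its coboundary vanishes. Near \<open>S\<close> the map \<open>r\<close>
  then lands where \<phi> is zero, and the homotopy formula loses both the term with
  \<open>map r\<close> and the one with the coboundary of \<phi>.\<close>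

lemma relative_prism:
  assumes X: "compact_space X" "Hausdorff_space X" and S: "closedin X S"
    and \<phi>: "\<phi> \<in> relative_cochains X S q" and d\<phi>: "S \<inter> cochain_support X (coboundary X \<phi>) = {}"
  obtains r where "r ` topspace X \<subseteq> topspace X"
    "\<And>s. s \<in> S \<Longrightarrow> \<exists>V. openin X V \<and> s \<in> V \<and>
       (\<forall>xs. set xs \<subseteq> V \<longrightarrow> \<phi> xs = - alt_faces (prism r \<phi>) xs) \<and>
       (\<forall>xs. set xs \<subseteq> V \<inter> S \<longrightarrow> prism r \<phi> xs = 0)"
proof -
  have SX: "S \<subseteq> topspace X" using S closedin_subset by blast
  define P where "P = (\<lambda>W. (\<forall>xs. set xs \<subseteq> W \<inter> S \<longrightarrow> \<phi> xs = 0) \<and> (\<forall>xs. set xs \<subseteq> W \<longrightarrow> coboundary X \<phi> xs = 0))"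
  have "\<exists>W. openin X W \<and> s \<in> W \<and> P W" if s: "s \<in> S" for s
  proof -
    have "s \<in> topspace (subtopology X S)" using s SX by auto
    then obtain A where A: "openin (subtopology X S) A" "s \<in> A" "\<And>xs. set xs \<subseteq> A \<Longrightarrow> restr X S \<phi> xs = 0"
      using \<phi> unfolding relative_cochains_def cochain_support_def by blast
    then obtain A' where A': "openin X A'" "A = A' \<inter> S" by (auto simp: openin_subtopology)
    have "s \<notin> cochain_support X (coboundary X \<phi>)" "s \<in> topspace X" using d\<phi> s SX by blast+
    then obtain B where B: "openin X B" "s \<in> B" "\<And>xs. set xs \<subseteq> B \<Longrightarrow> coboundary X \<phi> xs = 0"
      unfolding cochain_support_def by blast
    have "\<phi> xs = 0" if "set xs \<subseteq> A' \<inter> B \<inter> S" for xs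
    proof -
      have "set xs \<subseteq> topspace X \<inter> S" "set xs \<subseteq> A" using that SX A'(2) by blast+
      then show ?thesis using A(3)[of xs] unfolding restr_apply by simp
    qed
    then have "P (A' \<inter> B)" using B(3) unfolding P_def by blast
    then show ?thesis using A' A(2) B(1,2) by (intro exI[of _ "A' \<inter> B"]) auto
  qed
  then obtain r where r: "r ` topspace X \<subseteq> topspace X" "\<And>x. x \<in> S \<Longrightarrow> r x = x"
    "\<And>s. s \<in> S \<Longrightarrow> \<exists>V W. openin X V \<and> s \<in> V \<and> openin X W \<and> P W \<and> V \<subseteq> W \<and> r ` V \<subseteq> W \<inter> S"
    using approximate_retraction[OF X S, of P] by metis
  show thesis
  proof
    show "r ` topspace X \<subseteq> topspace X" by fact
    fix s assume "s \<in> S"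
    then obtain V W where V: "openin X V" "s \<in> V" "openin X W" "P W" "V \<subseteq> W" "r ` V \<subseteq> W \<inter> S"
      using r(3) by blast
    have "\<phi> xs = - alt_faces (prism r \<phi>) xs" if xs: "set xs \<subseteq> V" for xs
    proof -
      have "set (map r xs) \<subseteq> W \<inter> S" using xs V(6) by auto
      then have "\<phi> (map r xs) = 0" using V(4) unfolding P_def by blast
      moreover have "prism r (alt_faces \<phi>) xs = 0"
      proof (rule prism_zero)
        show "alt_faces \<phi> ys = 0" if "set ys \<subseteq> W" for ys
        proof -
          have "coboundary X \<phi> ys = 0" using that V(4) unfolding P_def by blast
          moreover have "set ys \<subseteq> topspace X" using that openin_subset[OF V(3)] by blast
          ultimately show ?thesis by (simp add: coboundary_alt_faces)
        qed
      qed (use xs V(5,6) in auto)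
      ultimately show ?thesis using prism_homotopy[of r \<phi> xs] by simp
    qed
    moreover have "prism r \<phi> xs = 0" if xs: "set xs \<subseteq> V \<inter> S" for xs
    proof (rule prism_zero)
      show "\<phi> ys = 0" if "set ys \<subseteq> W \<inter> S" for ys using that V(4) unfolding P_def by blast
    qed (use xs V(5,6) in \<open>auto 0 3\<close>)
    ultimately show "\<exists>V. openin X V \<and> s \<in> V \<and>
       (\<forall>xs. set xs \<subseteq> V \<longrightarrow> \<phi> xs = - alt_faces (prism r \<phi>) xs) \<and>
       (\<forall>xs. set xs \<subseteq> V \<inter> S \<longrightarrow> prism r \<phi> xs = 0)"
      using V(1,2) by blast
  qed
qed

text \<open>For a single point, \<open>alt_faces (prism r \<phi>)\<close> only involves the empty
  list and vanishes; so there is no primitive to subtract.\<close>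

lemma taut_0:
  assumes X: "compact_space X" "Hausdorff_space X" and S: "closedin X S"
    and \<phi>: "\<phi> \<in> relative_cochains X S 0" and d\<phi>: "S \<inter> cochain_support X (coboundary X \<phi>) = {}"
  shows "S \<inter> cochain_support X \<phi> = {}"
proof -
  obtain r where r: "\<And>s. s \<in> S \<Longrightarrow> \<exists>V. openin X V \<and> s \<in> V \<and>
       (\<forall>xs. set xs \<subseteq> V \<longrightarrow> \<phi> xs = - alt_faces (prism r \<phi>) xs)"
    using relative_prism[OF X S \<phi> d\<phi>] by metis
  have "alt_faces (prism r \<phi>) xs = 0" if "length xs = 1" for xs
    using that by (cases xs) auto
  then have *: "\<phi> xs = - alt_faces (prism r \<phi>) xs \<Longrightarrow> \<phi> xs = 0" for xs
    using \<phi> cochainsD(2)[of \<phi> X 0 xs] by (cases "length xs = 1") (auto simp: relative_cochains_def)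
  have "s \<notin> cochain_support X \<phi>" if "s \<in> S" for s
    using r[OF that] * not_in_supportI by metis
  then show ?thesis by blast
qed

text \<open>The primitive is minus the prism of \<phi>, cut down to lists of the right length. It is
  relative because the prism vanishes along \<open>S\<close>.\<close>

lemma taut_Suc:
  assumes X: "compact_space X" "Hausdorff_space X" and S: "closedin X S"
    and \<phi>: "\<phi> \<in> relative_cochains X S (Suc q)" and d\<phi>: "S \<inter> cochain_support X (coboundary X \<phi>) = {}"
  shows "\<exists>\<psi>\<in>relative_cochains X S q. S \<inter> cochain_support X (\<phi> - coboundary X \<psi>) = {}"
proof -
  have \<phi>c: "\<phi> \<in> cochains X (Suc q)" using \<phi> by (simp add: relative_cochains_def)
  obtain r where r: "\<And>s. s \<in> S \<Longrightarrow> \<exists>V. openin X V \<and> s \<in> V \<and>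
       (\<forall>xs. set xs \<subseteq> V \<longrightarrow> \<phi> xs = - alt_faces (prism r \<phi>) xs) \<and>
       (\<forall>xs. set xs \<subseteq> V \<inter> S \<longrightarrow> prism r \<phi> xs = 0)"
    using relative_prism[OF X S \<phi> d\<phi>] by metis
  define h where "h = (\<lambda>xs. if set xs \<subseteq> topspace X \<and> length xs = Suc q then - prism r \<phi> xs else 0)"
  have hc: "h \<in> cochains X q"
  proof (rule cochainsI)
    obtain V where "finite V" "\<And>xs. length xs = Suc q \<Longrightarrow> prism r \<phi> xs \<in> V"
      using prism_finite[OF cochainsD(1)[OF \<phi>c], of "Suc q" r] by blast
    moreover from this(2) have "h ` {xs. length xs = Suc q} \<subseteq> insert 0 (uminus ` V)"
      by (auto simp: h_def)
    ultimately show "finite (h ` {xs. length xs = Suc q})"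
      by (meson finite.insertI finite_imageI finite_subset)
  qed (auto simp: h_def split: if_splits)
  have "cochain_support (subtopology X S) (restr X S h) = {}"
  proof -
    have "s \<notin> cochain_support (subtopology X S) (restr X S h)" if s: "s \<in> S" for s
    proof -
      obtain V where V: "openin X V" "s \<in> V" "\<forall>xs. set xs \<subseteq> V \<inter> S \<longrightarrow> prism r \<phi> xs = 0"
        using r[OF s] by blast
      show ?thesis
      proof (rule not_in_supportI)
        show "openin (subtopology X S) (V \<inter> S)" using V(1) by (auto simp: openin_subtopology)
        show "restr X S h xs = 0" if "set xs \<subseteq> V \<inter> S" for xs
          using that V(3) by (auto simp: restr_apply h_def)
      qed (use V s in auto)
    qed
    then show ?thesis using cochain_support_subset[of "subtopology X S"] by auto
  qed
  then have "h \<in> relative_cochains X S q" using hc by (simp add: relative_cochains_def)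
  moreover have "s \<notin> cochain_support X (\<phi> - coboundary X h)" if s: "s \<in> S" for s
  proof -
    obtain V where V: "openin X V" "s \<in> V" "\<forall>xs. set xs \<subseteq> V \<longrightarrow> \<phi> xs = - alt_faces (prism r \<phi>) xs"
      using r[OF s] by blast
    show ?thesis
    proof (rule not_in_supportI[OF V(1,2)])
      fix xs assume xs: "set xs \<subseteq> V"
      show "(\<phi> - coboundary X h) xs = 0"
      proof (cases "length xs = Suc (Suc q)")
        case True
        have "set xs \<subseteq> topspace X" using xs openin_subset[OF V(1)] by blast
        moreover from this True have "alt_faces h xs = alt_faces (\<lambda>ys. - prism r \<phi> ys) xs"
          by (intro alt_faces_cong) (auto simp: h_def)
        moreover have "alt_faces (\<lambda>ys. - prism r \<phi> ys) xs = - alt_faces (prism r \<phi>) xs"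
          using alt_faces_diff[of "\<lambda>_. 0" "prism r \<phi>" xs] alt_faces_zero[of xs "\<lambda>_. 0"] by simp
        ultimately show ?thesis using V(3) xs by (simp add: coboundary_alt_faces)
      next
        case False
        then show ?thesis using cochainsD(2)[OF \<phi>c, of xs] cochainsD(2)[OF coboundary_cochains[OF hc], of xs] by fastforce
      qed
    qed
  qed
  ultimately show ?thesis by blast
qed

text \<open>Tautness and the vanishing of \<open>Ext\<close> replace the long exact sequence of the pair.\<close>

lemma cycle_vanishing_off_closed:
  assumes X: "compact_space X" "Hausdorff_space X" and S: "closedin X S"
    and acyclic: "infinite_cycles (subtopology X S) q \<subseteq> infinite_boundaries (subtopology X S) q"
    and c: "c \<in> infinite_cycles X q" "\<And>\<phi>. \<phi> \<in> cochains_in X (topspace X - S) q \<Longrightarrow> c \<phi> = 0"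
  obtains b where "b \<in> infinite_chains X (Suc q)" "\<And>\<phi>. \<phi> \<in> cochains_in X (topspace X - S) (Suc q) \<Longrightarrow> b \<phi> = 0"
    "c = boundary X q b"
proof -
  let ?U = "topspace X - S" and ?XS = "subtopology X S"
  have cXS: "compact_space ?XS"
    using X(1) S closedin_compact_space compact_space_subtopology by blast
  note cc = compact_cochains_eq[OF X(1)] and ccS = compact_cochains_eq[OF cXS]
  have CU: "cochains_in X ?U p = {\<phi> \<in> cochains X p. S \<inter> cochain_support X \<phi> = {}}" for p
    using cochain_support_subset[of X] by (auto simp: cochains_in_def cc)
  have CU_rel: "cochains_in X ?U p \<subseteq> relative_cochains X S p" for p
    using relative_support_disjoint by (auto simp: CU)
  have c_add: "additive_on (cochains X q) c"
    using chain_additive[OF infinite_cyclesD[OF c(1)]] by (simp add: cc)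
  have rel_c: "relative_cochains X S p \<subseteq> cochains X p" for p by (auto simp: relative_cochains_def)
  \<comment> \<open>Such a relative cochain is a cocycle near \<open>S\<close>, so by tautness it
    differs from a coboundary by a cochain supported off \<open>S\<close>. The chain
    \<open>c\<close> kills both.\<close>
  have c_rel: "c \<psi> = 0" if \<psi>: "\<psi> \<in> relative_cochains X S q" "coboundary X \<psi> \<in> cochains_in X ?U (Suc q)" for \<psi>
  proof (cases q)
    case 0
    then have "\<psi> \<in> cochains_in X ?U q"
      using taut_0[OF X S] \<psi> rel_c by (auto simp: CU)
    then show ?thesis by (rule c(2))
  next
    case (Suc p)
    then obtain \<theta> where \<theta>: "\<theta> \<in> relative_cochains X S p" "S \<inter> cochain_support X (\<psi> - coboundary X \<theta>) = {}"
      using taut_Suc[OF X S, of \<psi> p] \<psi> unfolding CU Suc by blast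
    have dc: "coboundary X \<theta> \<in> cochains X q"
      using \<theta>(1) rel_c coboundary_cochains unfolding Suc by blast
    have "\<psi> - coboundary X \<theta> \<in> cochains_in X ?U q"
      using \<psi>(1) rel_c \<theta>(2) dc subgrp_diff[OF subgrp_cochains, of \<psi> X q] by (auto simp: CU)
    then have "c (\<psi> - coboundary X \<theta>) = 0" by (rule c(2))
    moreover have "c (coboundary X \<theta>) = 0"
      using c(1) cycle_coboundary[of c X p \<theta>] \<theta>(1) rel_c by (auto simp: Suc cc)
    ultimately show ?thesis
      using additive_on_diff[OF c_add subgrp_cochains, OF subsetD[OF rel_c \<psi>(1)] dc] by simp
  qed
  \<comment> \<open>On relative cochains \<open>c\<close> is thus a function of the coboundary
    alone. The exactness needed to extend that function is again tautness, in the next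
    degree.\<close>
  obtain b0 where b0: "additive_on (relative_cochains X S (Suc q)) b0"
    "\<And>x. x \<in> cochains_in X ?U (Suc q) \<Longrightarrow> b0 x = 0"
    "\<And>y. y \<in> relative_cochains X S q \<Longrightarrow> b0 (coboundary X y) = c y"
  proof (rule dual_exact[where T = "coboundary X" and J = "null_near X S" and c = c and \<delta> = "coboundary X"
        and ?G0.0 = "relative_cochains X S q" and ?G1.0 = "relative_cochains X S (Suc q)"
        and ?N1.0 = "cochains_in X ?U (Suc q)"])
    show "additive_on (relative_cochains X S q) c"
      using c_add rel_c unfolding additive_on_def by blast
    show "finite (range (coboundary X x))" if "x \<in> relative_cochains X S (Suc q)" for x
      using that rel_c coboundary_cochains cochainsD(1) by blast
    fix x assume x: "x \<in> relative_cochains X S (Suc q)"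
    show "coboundary X x \<in> null_near X S \<longleftrightarrow> (\<exists>y\<in>relative_cochains X S q. x - coboundary X y \<in> cochains_in X ?U (Suc q))"
    proof
      assume "coboundary X x \<in> null_near X S"
      then obtain y where "y \<in> relative_cochains X S q" "S \<inter> cochain_support X (x - coboundary X y) = {}"
        using taut_Suc[OF X S x] by (auto simp: null_near_def)
      then show "\<exists>y\<in>relative_cochains X S q. x - coboundary X y \<in> cochains_in X ?U (Suc q)"
        using x coboundary_relative[of y X S q] rel_c subgrp_diff[OF subgrp_relative_cochains, of x X S "Suc q"]
        unfolding CU by blast
    next
      assume "\<exists>y\<in>relative_cochains X S q. x - coboundary X y \<in> cochains_in X ?U (Suc q)"
      then obtain y where "S \<inter> cochain_support X (x - coboundary X y) = {}" by (auto simp: CU)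
      moreover have "coboundary X (x - coboundary X y) = coboundary X x"
        by (simp add: coboundary_diff coboundary_coboundary)
      ultimately have "S \<inter> cochain_support X (coboundary X x) = {}"
        using cochain_support_coboundary[of X "x - coboundary X y"] by auto
      then show "coboundary X x \<in> null_near X S"
        using x rel_c coboundary_cochains cochainsD(1) unfolding null_near_def by blast
    qed
  qed (use c_rel CU_rel coboundary_add coboundary_relative null_near_finite_range
      in \<open>auto intro: subgrp_relative_cochains subgrp_cochains_in subgrp_null_near support_closed_null_near\<close>)
  have rel_iff: "relative_cochains X S p = {\<phi> \<in> cochains X p. restr X S \<phi> \<in> null_near ?XS S}" for p
    using pullback_cochains[of _ X p ?XS id] cochainsD(1)[of _ ?XS p] cochain_support_subset[of ?XS]
    by (fastforce simp: relative_cochains_def null_near_def)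
  \<comment> \<open>Relative cochains are those whose restriction to \<open>S\<close> is locally
    zero, so \<open>restr X S\<close> can serve as \<open>T\<close> for the extension to all
    cochains.\<close>
  obtain b1 where b1: "additive_on (cochains X (Suc q)) b1"
    "\<And>\<phi>. \<phi> \<in> relative_cochains X S (Suc q) \<Longrightarrow> b1 \<phi> = b0 \<phi>"
  proof (rule extend_additive[where G = "cochains X (Suc q)" and T = "restr X S" and J = "null_near ?XS S" and c = b0])
    show "finite (range (restr X S x))" if "x \<in> cochains X (Suc q)" for x
      using that pullback_cochains cochainsD(1) by blast
    show "additive_on {x \<in> cochains X (Suc q). restr X S x \<in> null_near ?XS S} b0"
      using b0(1) by (simp add: rel_iff)
  qed (auto simp: rel_iff pullback_add null_near_finite_range
      intro: subgrp_cochains subgrp_null_near support_closed_null_near)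
  have b1_0: "b1 \<phi> = 0" if "\<phi> \<in> cochains_in X ?U (Suc q)" for \<phi>
    using that b1(2) b0(2) CU_rel by fastforce
  \<comment> \<open>After the correction the chain vanishes on all relative cochains and hence comes
    from a cycle \<open>cS\<close> of the subspace \<open>S\<close>, to which the acyclicity of
    \<open>S\<close> applies.\<close>
  define e where "e = (\<lambda>\<phi>. c \<phi> - b1 (coboundary X \<phi>))"
  have e_add: "additive_on (cochains X q) e"
    using c_add b1(1) by (auto simp: additive_on_def e_def coboundary_add coboundary_cochains)
  have e_rel: "e \<phi> = 0" if "\<phi> \<in> relative_cochains X S q" for \<phi>
    using that b1(2) b0(3) coboundary_relative[OF that] by (simp add: e_def)
  have sub: "cochains ?XS p \<subseteq> cochains X p" for p
    by (auto simp: cochains_def)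
  have restr_id: "restr X S \<phi> = \<phi>" if "\<phi> \<in> cochains ?XS p" for \<phi> p
    using that cochainsD(3)[OF that] by (fastforce simp: restr_apply)
  have restr_rel: "\<phi> - restr X S \<phi> \<in> relative_cochains X S p" if "\<phi> \<in> cochains X p" for \<phi> p
  proof -
    have r: "restr X S \<phi> \<in> cochains ?XS p" using that pullback_cochains by blast
    then have "restr X S (\<phi> - restr X S \<phi>) = 0" using restr_id[OF r] by (simp add: pullback_diff)
    moreover have "\<phi> - restr X S \<phi> \<in> cochains X p"
      using that r sub subgrp_diff[OF subgrp_cochains] by blast
    ultimately show ?thesis by (simp add: relative_cochains_def)
  qed
  have e_restr: "e \<phi> = e (restr X S \<phi>)" if "\<phi> \<in> cochains X q" for \<phi>
  proof -
    have "restr X S \<phi> \<in> cochains X q" using pullback_cochains[OF that, of ?XS id] sub by blast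
    then show ?thesis
      using e_rel[OF restr_rel[OF that]] additive_on_diff[OF e_add subgrp_cochains that] by simp
  qed
  define cS where "cS = (\<lambda>\<phi>. if \<phi> \<in> compact_cochains ?XS q then e \<phi> else 0)"
  have "cS \<in> infinite_cycles ?XS q"
  proof (rule cycleI)
    show "cS \<in> infinite_chains ?XS q"
      unfolding cS_def
    proof (rule chainI)
      show "additive_on (compact_cochains ?XS q) e"
        using e_add sub unfolding ccS additive_on_def by blast
      show "e \<phi> = 0" if "\<phi> \<in> compact_cochains ?XS q" "cochain_support ?XS \<phi> = {}" for \<phi>
        using that sub restr_id[of \<phi> q] by (intro e_rel) (auto simp: relative_cochains_def ccS)
    qed
    fix p \<phi> assume *: "q = Suc p" "\<phi> \<in> compact_cochains ?XS p"
    then have \<phi>: "\<phi> \<in> cochains ?XS p" "\<phi> \<in> cochains X p" using sub by (auto simp: ccS)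
    have "coboundary ?XS \<phi> = restr X S (coboundary X \<phi>)"
      using restr_id[OF \<phi>(1)] by (simp add: restr_coboundary)
    then have "cS (coboundary ?XS \<phi>) = e (coboundary X \<phi>)"
      using e_restr[of "coboundary X \<phi>"] coboundary_cochains[OF \<phi>(1)] coboundary_cochains[OF \<phi>(2)] *
      by (simp add: cS_def ccS)
    also have "\<dots> = 0"
      using cycle_coboundary[of c X p \<phi>] c(1) \<phi>(2) additive_on_0[OF b1(1) subgrp_cochains]
      by (simp add: e_def coboundary_coboundary cc *(1))
    finally show "cS (coboundary ?XS \<phi>) = 0" .
  qed
  then obtain bS where bS: "bS \<in> infinite_chains ?XS (Suc q)" "cS = boundary ?XS q bS"
    using acyclic unfolding infinite_boundaries_def by blast
  \<comment> \<open>The primitive found off \<open>S\<close> plus the one found on \<open>S\<close>;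
    both parts vanish on cochains supported off \<open>S\<close>.\<close>
  define b where "b = (\<lambda>\<phi>. if \<phi> \<in> compact_cochains X (Suc q) then b1 \<phi> + bS (restr X S \<phi>) else 0)"
  have bS_0: "bS (restr X S \<phi>) = 0" if "\<phi> \<in> relative_cochains X S (Suc q)" for \<phi>
    using that pullback_cochains by (intro chain_zero[OF bS(1)]) (auto simp: relative_cochains_def ccS)
  have b_0: "b1 \<phi> + bS (restr X S \<phi>) = 0" if "\<phi> \<in> cochains_in X ?U (Suc q)" for \<phi>
    using that bS_0 b1_0 CU_rel by fastforce
  show thesis
  proof
    show "b \<in> infinite_chains X (Suc q)"
      unfolding b_def
    proof (rule chainI)
      show "additive_on (compact_cochains X (Suc q)) (\<lambda>\<phi>. b1 \<phi> + bS (restr X S \<phi>))"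
        using b1(1) chain_additive[OF bS(1)] pullback_cochains[of _ X "Suc q" ?XS id]
        by (simp add: additive_on_def cc ccS pullback_add)
      show "b1 \<phi> + bS (restr X S \<phi>) = 0"
        if "\<phi> \<in> compact_cochains X (Suc q)" "cochain_support X \<phi> = {}" for \<phi>
        using that by (intro b_0) (auto simp: CU cc)
    qed
    show "b \<phi> = 0" if "\<phi> \<in> cochains_in X ?U (Suc q)" for \<phi>
      using b_0[OF that] by (simp add: b_def)
    have "c \<phi> = b (coboundary X \<phi>)" if \<phi>: "\<phi> \<in> cochains X q" for \<phi>
    proof -
      have r: "restr X S \<phi> \<in> cochains ?XS q" using \<phi> pullback_cochains by blast
      have "e \<phi> = cS (restr X S \<phi>)" using e_restr[OF \<phi>] r by (simp add: cS_def ccS)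
      also have "\<dots> = bS (restr X S (coboundary X \<phi>))"
        using r by (simp add: bS(2) boundary_def ccS restr_coboundary)
      finally show ?thesis using coboundary_cochains[OF \<phi>] by (simp add: e_def b_def cc)
    qed
    then show "c = boundary X q b"
      using infinite_cyclesD[OF c(1)] by (auto simp: boundary_def infinite_chains_iff cc fun_eq_iff)
  qed
qed

text \<open>Chains of the open complement extend to \<open>X\<close>: here \<open>T\<close> is the
  identity and \<open>J\<close> is \<open>null_near X S\<close>.\<close>

lemma extend_local_chain:
  assumes X: "compact_space X" and S: "S \<subseteq> topspace X" and a: "local_chain X (topspace X - S) q a"
  obtains c where "c \<in> infinite_chains X q" "\<And>\<phi>. \<phi> \<in> cochains_in X (topspace X - S) q \<Longrightarrow> c \<phi> = a \<phi>"
proof -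
  note cc = compact_cochains_eq[OF X]
  have CU: "cochains_in X (topspace X - S) q = {\<phi> \<in> cochains X q. \<phi> \<in> null_near X S}"
    using cochain_support_subset[of X] cochainsD(1)[of _ X q]
    unfolding cochains_in_def null_near_def cc by blast
  obtain c where c: "additive_on (cochains X q) c" "\<And>\<phi>. \<phi> \<in> cochains_in X (topspace X - S) q \<Longrightarrow> c \<phi> = a \<phi>"
  proof (rule extend_additive[where G = "cochains X q" and T = "\<lambda>\<phi>. \<phi>" and J = "null_near X S" and c = a])
    show "additive_on {x \<in> cochains X q. x \<in> null_near X S} a"
      using a by (simp add: local_chain_def CU)
  qed (auto simp: CU null_near_finite_range cochainsD(1)
      intro: subgrp_cochains subgrp_null_near support_closed_null_near)
  show thesis
  proof
    show "(\<lambda>\<phi>. if \<phi> \<in> compact_cochains X q then c \<phi> else 0) \<in> infinite_chains X q"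
    proof (rule chainI)
      show "c \<phi> = 0" if "\<phi> \<in> compact_cochains X q" "cochain_support X \<phi> = {}" for \<phi>
        using that c(2)[of \<phi>] a by (simp add: cochains_in_def local_chain_def)
    qed (use c(1) cc in simp)
  qed (use c(2) cochains_in_subset[of X _ q] in auto)
qed

text \<open>Extend the primitive \<open>b\<close> to all of \<open>X\<close> and subtract its
  boundary. What remains is a cycle vanishing off \<open>S\<close>, which bounds by
  \<open>cycle_vanishing_off_closed\<close>.\<close>

lemma restriction_injective:
  assumes X: "compact_space X" "Hausdorff_space X" and S: "closedin X S"
    and acyclic: "infinite_cycles (subtopology X S) q \<subseteq> infinite_boundaries (subtopology X S) q"
    and c: "c \<in> infinite_cycles X q" and b: "local_chain X (topspace X - S) (Suc q) b"
    and eq: "\<And>\<phi>. \<phi> \<in> cochains_in X (topspace X - S) q \<Longrightarrow> c \<phi> = b (coboundary X \<phi>)"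
  shows "c \<in> infinite_boundaries X q"
proof -
  obtain b' where b': "b' \<in> infinite_chains X (Suc q)"
    "\<And>\<phi>. \<phi> \<in> cochains_in X (topspace X - S) (Suc q) \<Longrightarrow> b' \<phi> = b \<phi>"
    using extend_local_chain[OF X(1) closedin_subset[OF S] b] by blast
  have bb: "boundary X q b' \<in> infinite_boundaries X q"
    using b'(1) by (auto simp: infinite_boundaries_def)
  have "c - boundary X q b' \<in> infinite_cycles X q"
    using c bb infinite_boundaries_cycles subgrp_diff[OF subgrp_infinite_cycles] by blast
  moreover have "(c - boundary X q b') \<phi> = 0" if "\<phi> \<in> cochains_in X (topspace X - S) q" for \<phi>
    using that eq b'(2) coboundary_in[OF that] cochains_in_subset[of X "topspace X - S" q]
    by (auto simp: boundary_def)
  ultimately obtain b'' where "b'' \<in> infinite_chains X (Suc q)" "c - boundary X q b' = boundary X q b''"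
    using cycle_vanishing_off_closed[OF X S acyclic] by metis
  then have "c - boundary X q b' \<in> infinite_boundaries X q" by (auto simp: infinite_boundaries_def)
  from subgrp_add[OF subgrp_infinite_boundaries this bb] show ?thesis by simp
qed

text \<open>Extend the cycle to a chain. Its boundary vanishes off \<open>S\<close>, so acyclicity
  one degree lower makes it the boundary of a chain that also vanishes off \<open>S\<close>;
  subtract that chain. In degree \<open>0\<close> every chain is a cycle.\<close>

lemma restriction_surjective:
  assumes X: "compact_space X" "Hausdorff_space X" and S: "closedin X S"
    and acyclic: "\<And>p. q = Suc p \<Longrightarrow>
      infinite_cycles (subtopology X S) p \<subseteq> infinite_boundaries (subtopology X S) p"
    and a: "local_chain X (topspace X - S) q a"
    and z: "\<And>p \<phi>. q = Suc p \<Longrightarrow> \<phi> \<in> cochains_in X (topspace X - S) p \<Longrightarrow> a (coboundary X \<phi>) = 0"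
  obtains c where "c \<in> infinite_cycles X q" "\<And>\<phi>. \<phi> \<in> cochains_in X (topspace X - S) q \<Longrightarrow> c \<phi> = a \<phi>"
proof -
  obtain c where c: "c \<in> infinite_chains X q" "\<And>\<phi>. \<phi> \<in> cochains_in X (topspace X - S) q \<Longrightarrow> c \<phi> = a \<phi>"
    using extend_local_chain[OF X(1) closedin_subset[OF S] a] by blast
  show thesis
  proof (cases q)
    case 0
    then have "c \<in> infinite_cycles X q" using c(1) by (intro cycleI) auto
    then show thesis using c(2) that by blast
  next
    case (Suc p)
    have "boundary X p c \<in> infinite_cycles X p"
      using c(1) infinite_boundaries_cycles unfolding Suc infinite_boundaries_def by blast
    moreover have "boundary X p c \<phi> = 0" if "\<phi> \<in> cochains_in X (topspace X - S) p" for \<phi>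
      using that z[OF Suc that] c(2) coboundary_in[OF that] by (simp add: boundary_def Suc)
    ultimately obtain b where b: "b \<in> infinite_chains X q"
      "\<And>\<phi>. \<phi> \<in> cochains_in X (topspace X - S) q \<Longrightarrow> b \<phi> = 0" "boundary X p c = boundary X p b"
      using cycle_vanishing_off_closed[OF X S acyclic[OF Suc]] unfolding Suc by metis
    have "c - b \<in> infinite_cycles X q"
      using subgrp_diff[OF subgrp_infinite_chains c(1) b(1)] b(3) boundary_diff[of X p c b] Suc
      by (auto simp: infinite_cycles_def)
    then show thesis using that[of "c - b"] c(2) b(2) by simp
  qed
qed

subsection \<open>Vanishing of cohomology above the dimension\<close>

text \<open>The induction removes a vertex \<open>v\<close> and uses the link of \<open>v\<close>, whose dimension is smaller by one.\<close>

lemma simplicial_vanishing: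
  fixes F :: "'v list \<Rightarrow> int"
  assumes "finite V" and "\<And>\<sigma>. \<sigma> \<in> K \<Longrightarrow> \<sigma> \<subseteq> V"
    and "\<And>\<sigma> \<tau>. \<sigma> \<in> K \<Longrightarrow> \<tau> \<subseteq> \<sigma> \<Longrightarrow> \<tau> \<in> K" and "\<And>\<sigma> \<tau>. \<sigma> \<in> L \<Longrightarrow> \<tau> \<subseteq> \<sigma> \<Longrightarrow> \<tau> \<in> L"
    and "\<And>\<sigma>. \<sigma> \<in> K \<Longrightarrow> card \<sigma> \<le> k"
    and "\<And>xs. length xs = Suc (Suc k) \<Longrightarrow> set xs \<in> K \<Longrightarrow> alt_faces F xs = 0"
    and "\<And>xs. length xs = Suc k \<Longrightarrow> set xs \<in> L \<Longrightarrow> F xs = 0"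
  shows "\<exists>G. (\<forall>xs. length xs = Suc k \<longrightarrow> set xs \<in> K \<longrightarrow> alt_faces G xs = F xs) \<and>
             (\<forall>xs. length xs = k \<longrightarrow> set xs \<in> L \<longrightarrow> G xs = 0)"
  using assms
\<comment> \<open>Lists may repeat vertices. A list of length \<open>Suc k\<close> whose vertex set
  has at most \<open>k\<close> elements is degenerate, so the claim is that degenerate ordered
  simplices carry no cohomology in degree \<open>k\<close>.\<close>
proof (induction V arbitrary: K L F k rule: finite_induct)
  case empty
  have "set xs \<notin> K" if "length xs = Suc k" for xs :: "'v list"
    using empty(1)[of "set xs"] that by (cases xs) auto
  then show ?case by (intro exI[of _ "\<lambda>_. 0"]) auto
next
  case (insert v V)
  note KV = insert.prems(1) and Kd = insert.prems(2) and Ld = insert.prems(3) and Kc = insert.prems(4)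
    and cocycle = insert.prems(5) and rel = insert.prems(6)
  have fin: "finite \<sigma>" if "\<sigma> \<in> K" for \<sigma>
    using KV[OF that] insert.hyps(1) finite_subset by blast
  show ?case
  proof (cases k)
    case 0
    have "set xs \<notin> K" if "length xs = Suc k" for xs :: "'v list"
      using Kc[of "set xs"] that 0 by (cases xs) auto
    then show ?thesis by (intro exI[of _ "\<lambda>_. 0"]) auto
  next
    case (Suc k')
    \<comment> \<open>Away from \<open>v\<close> the induction hypothesis applies with the same
      bound \<open>k\<close>.\<close>
    have "\<exists>G. (\<forall>xs. length xs = Suc k \<longrightarrow> set xs \<in> {\<sigma> \<in> K. v \<notin> \<sigma>} \<longrightarrow> alt_faces G xs = F xs) \<and>
             (\<forall>xs. length xs = k \<longrightarrow> set xs \<in> {\<sigma> \<in> L. v \<notin> \<sigma>} \<longrightarrow> G xs = 0)"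
    proof (rule insert.IH)
      show "\<sigma> \<subseteq> V" if "\<sigma> \<in> {\<sigma> \<in> K. v \<notin> \<sigma>}" for \<sigma> using that KV by blast
      show "\<tau> \<in> {\<sigma> \<in> K. v \<notin> \<sigma>}" if "\<sigma> \<in> {\<sigma> \<in> K. v \<notin> \<sigma>}" "\<tau> \<subseteq> \<sigma>" for \<sigma> \<tau> using that Kd by blast
      show "\<tau> \<in> {\<sigma> \<in> L. v \<notin> \<sigma>}" if "\<sigma> \<in> {\<sigma> \<in> L. v \<notin> \<sigma>}" "\<tau> \<subseteq> \<sigma>" for \<sigma> \<tau> using that Ld by blast
    qed (use Kc cocycle rel in auto)
    then obtain \<alpha> where \<alpha>: "\<And>xs. length xs = Suc k \<Longrightarrow> set xs \<in> K \<Longrightarrow> v \<notin> set xs \<Longrightarrow> alt_faces \<alpha> xs = F xs"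
      "\<And>xs. length xs = k \<Longrightarrow> set xs \<in> L \<Longrightarrow> v \<notin> set xs \<Longrightarrow> \<alpha> xs = 0"
      by auto
    \<comment> \<open>Extension by zero does not affect lists without \<open>v\<close>. After
      subtracting its coboundary, the cocycle \<open>F1\<close> vanishes on all simplices of
      \<open>K\<close> avoiding \<open>v\<close>.\<close>
    define \<alpha>' where "\<alpha>' = (\<lambda>xs. if v \<in> set xs then 0 else \<alpha> xs)"
    have \<alpha>'L: "\<alpha>' xs = 0" if "length xs = k" "set xs \<in> L" for xs
      using \<alpha>(2) that by (simp add: \<alpha>'_def)
    define F1 where "F1 = (\<lambda>xs. F xs - alt_faces \<alpha>' xs)"
    have P1: "F1 xs = 0" if "length xs = Suc k" "set xs \<in> K" "v \<notin> set xs" for xs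
    proof -
      have "alt_faces \<alpha>' xs = alt_faces \<alpha> xs"
        using that(3) by (intro alt_faces_cong) (auto simp: \<alpha>'_def)
      then show ?thesis using \<alpha>(1)[OF that] by (simp add: F1_def)
    qed
    have P2: "alt_faces F1 xs = 0" if "length xs = Suc (Suc k)" "set xs \<in> K" for xs
      using cocycle[OF that] by (simp add: F1_def alt_faces_diff alt_faces_alt_faces)
    have P3: "F1 xs = 0" if "length xs = Suc k" "set xs \<in> L" for xs
    proof -
      have "alt_faces \<alpha>' xs = 0"
        using that Ld by (intro alt_faces_zero \<alpha>'L) auto
      then show ?thesis using rel[OF that] by (simp add: F1_def)
    qed
    \<comment> \<open>Prefixing \<open>v\<close> contracts the star of \<open>v\<close>, which is
      \<open>Q1\<close>. On the link \<open>F1\<close> vanishes, so there \<beta> is itself a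
      cocycle, of one degree less and with the bound \<open>k'\<close>.\<close>
    define \<beta> where "\<beta> = (\<lambda>xs. F1 (v # xs))"
    have Q1: "alt_faces \<beta> xs = F1 xs" if "length xs = Suc k" "insert v (set xs) \<in> K" for xs
      using P2[of "v # xs"] that by (simp add: \<beta>_def)
    define LK where "LK = {\<sigma>. v \<notin> \<sigma> \<and> insert v \<sigma> \<in> K}"
    define LL where "LL = {\<sigma>. v \<notin> \<sigma> \<and> insert v \<sigma> \<in> L}"
    have "\<exists>G. (\<forall>xs. length xs = Suc k' \<longrightarrow> set xs \<in> LK \<longrightarrow> alt_faces G xs = \<beta> xs) \<and>
             (\<forall>xs. length xs = k' \<longrightarrow> set xs \<in> LL \<longrightarrow> G xs = 0)"
    proof (rule insert.IH)
      show "\<sigma> \<subseteq> V" if "\<sigma> \<in> LK" for \<sigma> using that KV[of "insert v \<sigma>"] by (auto simp: LK_def)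
      show "\<tau> \<in> LK" if "\<sigma> \<in> LK" "\<tau> \<subseteq> \<sigma>" for \<sigma> \<tau>
        using that Kd[of "insert v \<sigma>" "insert v \<tau>"] by (auto simp: LK_def)
      show "\<tau> \<in> LL" if "\<sigma> \<in> LL" "\<tau> \<subseteq> \<sigma>" for \<sigma> \<tau>
        using that Ld[of "insert v \<sigma>" "insert v \<tau>"] by (auto simp: LL_def)
      show "card \<sigma> \<le> k'" if "\<sigma> \<in> LK" for \<sigma>
        using that Kc[of "insert v \<sigma>"] fin[of "insert v \<sigma>"] Suc by (simp add: LK_def)
      show "alt_faces \<beta> xs = 0" if "length xs = Suc (Suc k')" "set xs \<in> LK" for xs
        using that Q1[of xs] P1[of xs] Kd[of "insert v (set xs)" "set xs"] Suc by (auto simp: LK_def)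
      show "\<beta> xs = 0" if "length xs = Suc k'" "set xs \<in> LL" for xs
        using that P3[of "v # xs"] Suc by (simp add: LL_def \<beta>_def)
    qed
    then obtain \<gamma> where \<gamma>: "\<And>xs. length xs = k \<Longrightarrow> set xs \<in> LK \<Longrightarrow> alt_faces \<gamma> xs = \<beta> xs"
      "\<And>xs. length xs = k' \<Longrightarrow> set xs \<in> LL \<Longrightarrow> \<gamma> xs = 0"
      unfolding Suc by blast
    define \<gamma>' where "\<gamma>' = (\<lambda>xs. if v \<in> set xs then 0 else \<gamma> xs)"
    \<comment> \<open>Outside the star the solution must vanish on lists avoiding \<open>v\<close>.
      Subtracting the coboundary of \<open>\<gamma>'\<close>, which equals \<beta> on the link,
      achieves this without changing the coboundary of \<beta>.\<close>
    define \<beta>' where "\<beta>' = (\<lambda>xs. if v \<in> set xs then \<beta> xs - alt_faces \<gamma>' xs else 0)"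
    have *: "alt_faces \<beta>' xs = F1 xs" if xs: "length xs = Suc k" "set xs \<in> K" for xs
    proof (cases "v \<in> set xs")
      case False
      then have "alt_faces \<beta>' xs = 0" by (intro alt_faces_zero) (auto simp: \<beta>'_def)
      then show ?thesis using P1[OF xs False] by simp
    next
      case True
      have "\<beta> ys = alt_faces \<gamma>' ys" if "set ys \<subseteq> set xs" "length ys = k" "v \<notin> set ys" for ys
      proof -
        have "set ys \<in> LK" using that True Kd[OF xs(2), of "insert v (set ys)"] by (simp add: LK_def)
        then have "alt_faces \<gamma> ys = \<beta> ys" using \<gamma>(1) that by blast
        moreover have "alt_faces \<gamma>' ys = alt_faces \<gamma> ys"
          using that(3) by (intro alt_faces_cong) (auto simp: \<gamma>'_def)
        ultimately show ?thesis by simp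
      qed
      then have "alt_faces \<beta>' xs = alt_faces (\<lambda>ys. \<beta> ys - alt_faces \<gamma>' ys) xs"
        using xs(1) by (intro alt_faces_cong) (auto simp: \<beta>'_def)
      also have "\<dots> = F1 xs"
        using Q1[of xs] xs True by (simp add: alt_faces_diff alt_faces_alt_faces insert_absorb)
      finally show ?thesis .
    qed
    show ?thesis
    proof (intro exI[of _ "\<lambda>xs. \<alpha>' xs + \<beta>' xs"] conjI allI impI)
      show "alt_faces (\<lambda>xs. \<alpha>' xs + \<beta>' xs) xs = F xs" if "length xs = Suc k" "set xs \<in> K" for xs
        using *[OF that] by (simp add: alt_faces_add F1_def)
      fix xs assume xs: "length xs = k" "set xs \<in> L"
      have "alt_faces \<gamma>' xs = 0" if v: "v \<in> set xs"
      proof (rule alt_faces_zero)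
        fix ys assume ys: "set ys \<subseteq> set xs" "length xs = Suc (length ys)"
        show "\<gamma>' ys = 0"
        proof (cases "v \<in> set ys")
          case False
          then have "set ys \<in> LL" using Ld[OF xs(2), of "insert v (set ys)"] v ys by (simp add: LL_def)
          then show ?thesis using False \<gamma>(2) ys xs(1) Suc by (simp add: \<gamma>'_def)
        qed (simp add: \<gamma>'_def)
      qed
      moreover have "\<beta> xs = 0" if "v \<in> set xs"
        using P3[of "v # xs"] xs that by (simp add: \<beta>_def insert_absorb)
      ultimately show "\<alpha>' xs + \<beta>' xs = 0" using \<alpha>'L[OF xs] by (simp add: \<beta>'_def)
    qed
  qed
qed

text \<open>The fibres of \<open>v\<close> on \<open>N\<close> are the pieces of the partition.\<close>

definition fine_partitions :: "'a topology \<Rightarrow> nat \<Rightarrow> bool" where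
  "fine_partitions X n \<longleftrightarrow> (\<forall>K \<U>. compactin X K \<and> (\<forall>U\<in>\<U>. openin X U) \<and> topspace X \<subseteq> \<Union>\<U> \<longrightarrow>
     (\<exists>N (v :: 'a \<Rightarrow> nat). openin X N \<and> K \<subseteq> N \<and> finite (v ` N) \<and>
        (\<forall>x\<in>N. \<exists>B. openin X B \<and> x \<in> B \<and> B \<subseteq> N \<and> card (v ` B) \<le> Suc n \<and>
           (\<exists>U\<in>\<U>. \<forall>y\<in>B. \<forall>z\<in>N. v z = v y \<longrightarrow> z \<in> U))))"

text \<open>Vanishing of compactly supported cohomology in degree \<open>Suc p\<close>; the index is
  the degree of the primitive.\<close>

definition acyclic_cochains :: "'a topology \<Rightarrow> nat \<Rightarrow> bool" where
  "acyclic_cochains X p \<longleftrightarrow> (\<forall>\<phi>\<in>compact_cochains X (Suc p). cochain_support X (coboundary X \<phi>) = {} \<longrightarrow>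
     (\<exists>\<psi>\<in>compact_cochains X p. cochain_support X (\<phi> - coboundary X \<psi>) = {}))"

text \<open>Let \<open>r\<close> move each point to a representative of its piece. Then the cocycle
  becomes the pullback of one on the nerve, whose simplices have at most \<open>Suc n\<close>
  vertices, so it has a primitive \<open>G\<close> there; \<open>prism r\<close> accounts for the
  move.\<close>

lemma fine_partitions_acyclic:
  assumes X: "Hausdorff_space X" "locally_compact_space X" and n: "fine_partitions X n" "n \<le> p"
  shows "acyclic_cochains X p"
  unfolding acyclic_cochains_def
proof (intro ballI impI)
  fix \<phi> assume \<phi>: "\<phi> \<in> compact_cochains X (Suc p)" and d\<phi>: "cochain_support X (coboundary X \<phi>) = {}"
  have \<phi>c: "\<phi> \<in> cochains X (Suc p)" using \<phi> by (rule compact_cochainsD)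
  have "compactin X (cochain_support X \<phi>)" using \<phi> by (simp add: compact_cochains_def)
  then obtain V L where V: "openin X V" "compactin X L" "closedin X L" "cochain_support X \<phi> \<subseteq> V" "V \<subseteq> L"
    using locally_compact_space_compact_closed_compact[of X] X by metis
  define null where "null = (\<lambda>U. \<forall>xs. set xs \<subseteq> U \<longrightarrow> \<phi> xs = 0)"
  \<comment> \<open>The cocycle condition holds on each member, and a member that leaves
    \<open>V\<close> sees only the zero values of \<phi>. The second property serves to keep the
    support of the primitive compact.\<close>
  define \<U> where "\<U> = {U. openin X U \<and> (\<forall>xs. set xs \<subseteq> U \<longrightarrow> coboundary X \<phi> xs = 0) \<and> (U \<subseteq> V \<or> null U)}"
  have "\<exists>U\<in>\<U>. x \<in> U" if x: "x \<in> topspace X" for x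
  proof -
    obtain A where A: "openin X A" "x \<in> A" "\<And>xs. set xs \<subseteq> A \<Longrightarrow> coboundary X \<phi> xs = 0"
      using d\<phi> x unfolding cochain_support_def by blast
    show ?thesis
    proof (cases "x \<in> V")
      case True
      then show ?thesis using A V(1) by (intro bexI[of _ "A \<inter> V"]) (auto simp: \<U>_def)
    next
      case False
      then have "x \<notin> cochain_support X \<phi>" using V(4) by blast
      then obtain B where B: "openin X B" "x \<in> B" "\<And>xs. set xs \<subseteq> B \<Longrightarrow> \<phi> xs = 0"
        using x unfolding cochain_support_def by blast
      then show ?thesis using A by (intro bexI[of _ "A \<inter> B"]) (auto simp: \<U>_def null_def)
    qed
  qed
  then have "topspace X \<subseteq> \<Union>\<U>" by blast
  moreover have "\<forall>U\<in>\<U>. openin X U" by (simp add: \<U>_def)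
  ultimately obtain N and v :: "'a \<Rightarrow> nat" where N: "openin X N" "L \<subseteq> N" "finite (v ` N)"
    and "\<forall>x\<in>N. \<exists>B. openin X B \<and> x \<in> B \<and> B \<subseteq> N \<and> card (v ` B) \<le> Suc n \<and>
           (\<exists>U\<in>\<U>. \<forall>y\<in>B. \<forall>z\<in>N. v z = v y \<longrightarrow> z \<in> U)"
    using n(1)[unfolded fine_partitions_def, rule_format, of L \<U>] V(2) by blast
  then have "\<forall>x\<in>N. \<exists>B U. openin X B \<and> x \<in> B \<and> B \<subseteq> N \<and> card (v ` B) \<le> Suc n \<and>
           U \<in> \<U> \<and> (\<forall>y\<in>B. \<forall>z\<in>N. v z = v y \<longrightarrow> z \<in> U)" by (simp add: Bex_def)
  then obtain B where "\<forall>x\<in>N. \<exists>U. openin X (B x) \<and> x \<in> B x \<and> B x \<subseteq> N \<and> card (v ` B x) \<le> Suc n \<and>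
           U \<in> \<U> \<and> (\<forall>y\<in>B x. \<forall>z\<in>N. v z = v y \<longrightarrow> z \<in> U)"
    by (rule bchoice[THEN exE])
  then obtain U where "\<forall>x\<in>N. openin X (B x) \<and> x \<in> B x \<and> B x \<subseteq> N \<and> card (v ` B x) \<le> Suc n \<and>
           U x \<in> \<U> \<and> (\<forall>y\<in>B x. \<forall>z\<in>N. v z = v y \<longrightarrow> z \<in> U x)"
    by (rule bchoice[THEN exE])
  then have B: "\<And>x. x \<in> N \<Longrightarrow> openin X (B x)" "\<And>x. x \<in> N \<Longrightarrow> x \<in> B x" "\<And>x. x \<in> N \<Longrightarrow> B x \<subseteq> N"
      "\<And>x. x \<in> N \<Longrightarrow> card (v ` B x) \<le> Suc n"
    and U: "\<And>x. x \<in> N \<Longrightarrow> U x \<in> \<U>" "\<And>x y z. x \<in> N \<Longrightarrow> y \<in> B x \<Longrightarrow> z \<in> N \<Longrightarrow> v z = v y \<Longrightarrow> z \<in> U x"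
    by simp_all
  define pt where "pt = (\<lambda>i. SOME z. z \<in> N \<and> v z = i)"
  define r where "r = pt \<circ> v"
  have pt: "pt (v x) \<in> N" "v (pt (v x)) = v x" if "x \<in> N" for x
    using that someI_ex[of "\<lambda>z. z \<in> N \<and> v z = v x"] unfolding pt_def by blast+
  have BU: "y \<in> U x" "pt (v y) \<in> U x" if "x \<in> N" "y \<in> B x" for x y
  proof -
    have "y \<in> N" using B(3)[OF that(1)] that(2) by blast
    then show "y \<in> U x" "pt (v y) \<in> U x" using U(2)[OF that] pt[of y] by auto
  qed
  have UX: "U x \<subseteq> topspace X" if "x \<in> N" for x
    using U(1)[OF that] openin_subset by (auto simp: \<U>_def)
  have dU: "alt_faces \<phi> xs = 0" if "x \<in> N" "set xs \<subseteq> U x" for x xs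
  proof -
    have "coboundary X \<phi> xs = 0" using U(1)[OF that(1)] that(2) by (simp add: \<U>_def)
    moreover have "set xs \<subseteq> topspace X" using that UX by blast
    ultimately show ?thesis by (simp add: coboundary_alt_faces)
  qed
  \<comment> \<open>The nerve: sets of pieces coming together at a point. The subcomplex
    \<open>LL\<close> consists of those that do so where \<phi> is zero; the primitive on the nerve
    is chosen to vanish there.\<close>
  define KK where "KK = {\<sigma>. \<exists>x\<in>N. \<sigma> \<subseteq> v ` B x}"
  define LL where "LL = {\<sigma>. \<exists>x\<in>N. \<sigma> \<subseteq> v ` B x \<and> null (U x)}"
  have ptU: "set (map pt is) \<subseteq> U x" if "x \<in> N" "set is \<subseteq> v ` B x" for x "is"
    using that BU(2) by (auto 4 3)
  have "\<exists>G. (\<forall>xs. length xs = Suc (Suc p) \<longrightarrow> set xs \<in> KK \<longrightarrow> alt_faces G xs = \<phi> (map pt xs)) \<and>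
             (\<forall>xs. length xs = Suc p \<longrightarrow> set xs \<in> LL \<longrightarrow> G xs = 0)"
  proof (rule simplicial_vanishing[OF N(3)])
    show "\<sigma> \<subseteq> v ` N" if "\<sigma> \<in> KK" for \<sigma> using that B(3) unfolding KK_def by blast
    show "\<tau> \<in> KK" if "\<sigma> \<in> KK" "\<tau> \<subseteq> \<sigma>" for \<sigma> \<tau> using that unfolding KK_def by blast
    show "\<tau> \<in> LL" if "\<sigma> \<in> LL" "\<tau> \<subseteq> \<sigma>" for \<sigma> \<tau> using that unfolding LL_def by blast
    show "card \<sigma> \<le> Suc p" if "\<sigma> \<in> KK" for \<sigma>
    proof -
      obtain x where x: "x \<in> N" "\<sigma> \<subseteq> v ` B x" using \<open>\<sigma> \<in> KK\<close> by (auto simp: KK_def)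
      have "finite (v ` B x)" using N(3) B(3)[OF x(1)] by (meson finite_subset image_mono)
      then have "card \<sigma> \<le> card (v ` B x)" using x(2) card_mono by blast
      then show ?thesis using B(4)[OF x(1)] n(2) by simp
    qed
    show "alt_faces (\<lambda>xs. \<phi> (map pt xs)) xs = 0" if "set xs \<in> KK" for xs
      using that ptU dU unfolding KK_def alt_faces_map[symmetric] by blast
    show "\<phi> (map pt xs) = 0" if "set xs \<in> LL" for xs
      using that ptU unfolding LL_def null_def by blast
  qed
  then obtain G where G: "\<And>xs. length xs = Suc (Suc p) \<Longrightarrow> set xs \<in> KK \<Longrightarrow> alt_faces G xs = \<phi> (map pt xs)"
    "\<And>xs. length xs = Suc p \<Longrightarrow> set xs \<in> LL \<Longrightarrow> G xs = 0" by blast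
  define g where "g = (\<lambda>xs. G (map v xs) - prism r \<phi> xs)"
  \<comment> \<open>Cutting off outside \<open>V\<close> yields a compact support and creates no
    jump. At a point \<open>x\<close> of \<open>N\<close> outside \<open>V\<close> the set
    \<open>U x\<close> is not contained in \<open>V\<close>, hence is \<open>null\<close>, and both
    terms of \<open>g\<close> vanish near \<open>x\<close>; other points outside \<open>V\<close>
    have a neighbourhood off \<open>L\<close>.\<close>
  define h where "h = (\<lambda>xs. if set xs \<subseteq> V \<and> length xs = Suc p then g xs else 0)"
  have hc: "h \<in> cochains X p"
  proof (rule cochainsI)
    obtain W where W: "finite W" "\<And>xs. length xs = Suc p \<Longrightarrow> prism r \<phi> xs \<in> W"
      using prism_finite[OF cochainsD(1)[OF \<phi>c], of "Suc p" r] by blast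
    have fin: "finite {is. set is \<subseteq> v ` N \<and> length is = Suc p}"
      by (rule finite_lists_length_eq[OF N(3)])
    have "h xs \<in> insert 0 ((\<lambda>(a, b). a - b) ` (G ` {is. set is \<subseteq> v ` N \<and> length is = Suc p} \<times> W))"
      if "length xs = Suc p" for xs
    proof (cases "set xs \<subseteq> V")
      case True
      then have "set (map v xs) \<subseteq> v ` N" using V(5) N(2) by auto
      then have "(G (map v xs), prism r \<phi> xs) \<in> G ` {is. set is \<subseteq> v ` N \<and> length is = Suc p} \<times> W"
        using W(2)[OF that] that by auto
      then show ?thesis using True that unfolding h_def g_def by force
    qed (simp add: h_def)
    then have "h ` {xs. length xs = Suc p} \<subseteq>
        insert 0 ((\<lambda>(a, b). a - b) ` (G ` {is. set is \<subseteq> v ` N \<and> length is = Suc p} \<times> W))"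
      by blast
    then show "finite (h ` {xs. length xs = Suc p})"
      using fin W(1) by (meson finite.insertI finite_SigmaI finite_imageI finite_subset)
    show "length xs = Suc p \<and> set xs \<subseteq> topspace X" if "h xs \<noteq> 0" for xs
      using that openin_subset[OF V(1)] by (auto simp: h_def split: if_splits)
  qed
  have hL: "x \<notin> cochain_support X h" if "x \<in> topspace X" "x \<notin> L" for x
  proof (rule not_in_supportI)
    show "openin X (topspace X - L)" using V(3) by blast
    show "x \<in> topspace X - L" using that by simp
    show "h xs = 0" if "set xs \<subseteq> topspace X - L" for xs
      using that V(5) by (cases xs) (auto simp: h_def)
  qed
  have "cochain_support X h \<subseteq> L" using hL cochain_support_subset[of X h] by blast
  then have "h \<in> compact_cochains X p"
    using hc V(2) closed_compactin closedin_cochain_support unfolding compact_cochains_def by blast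
  moreover have "x \<notin> cochain_support X (\<phi> - coboundary X h)" if x: "x \<in> topspace X" for x
  proof (cases "x \<in> V")
    case True
    then have xN: "x \<in> N" using V(5) N(2) by blast
    show ?thesis
    proof (rule not_in_supportI)
      show "openin X (B x \<inter> V)" using B(1)[OF xN] V(1) by blast
      show "x \<in> B x \<inter> V" using B(2)[OF xN] True by simp
      fix xs assume xs: "set xs \<subseteq> B x \<inter> V"
      show "(\<phi> - coboundary X h) xs = 0"
      proof (cases "length xs = Suc (Suc p)")
        case True
        have "set xs \<subseteq> topspace X" using xs openin_subset[OF V(1)] by blast
        moreover have "alt_faces h xs = alt_faces g xs"
          using True xs by (intro alt_faces_cong) (auto simp: h_def)
        moreover have "alt_faces g xs = alt_faces G (map v xs) - alt_faces (prism r \<phi>) xs"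
          by (simp add: g_def alt_faces_diff alt_faces_map)
        moreover have "alt_faces G (map v xs) = \<phi> (map r xs)"
          using G(1)[of "map v xs"] True xs xN by (force simp: KK_def r_def)
        moreover have "prism r (alt_faces \<phi>) xs = 0"
        proof (rule prism_zero)
          show "alt_faces \<phi> ys = 0" if "set ys \<subseteq> U x" for ys using dU[OF xN that] .
        qed (use xs BU[OF xN] in \<open>auto simp: r_def\<close>)
        ultimately show ?thesis using prism_homotopy[of r \<phi> xs] by (simp add: coboundary_alt_faces)
      next
        case False
        then have "\<phi> xs = 0" "coboundary X h xs = 0"
          using cochainsD(2)[OF \<phi>c, of xs] cochainsD(2)[OF coboundary_cochains[OF hc], of xs] by blast+
        then show ?thesis by simp
      qed
    qed
  next
    case False
    then have "x \<notin> cochain_support X \<phi>" using V(4) by blast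
    moreover have "x \<notin> cochain_support X h"
    proof (cases "x \<in> N")
      case True
      then have nullU: "null (U x)" using U(1) BU(1)[OF True B(2)[OF True]] False by (auto simp: \<U>_def)
      show ?thesis
      proof (rule not_in_supportI[OF B(1,2)[OF True]])
        fix xs assume xs: "set xs \<subseteq> B x"
        have "prism r \<phi> xs = 0"
        proof (rule prism_zero)
          show "\<phi> ys = 0" if "set ys \<subseteq> U x" for ys using nullU that by (simp add: null_def)
        qed (use xs BU[OF True] in \<open>auto simp: r_def\<close>)
        moreover have "G (map v xs) = 0" if "length xs = Suc p"
          using G(2)[of "map v xs"] that xs True nullU by (force simp: LL_def)
        ultimately show "h xs = 0" by (simp add: h_def g_def)
      qed
    qed (use hL x N(2) in blast)
    ultimately show ?thesis
      using cochain_support_coboundary[of X h] cochain_support_diff[of X \<phi> "coboundary X h"] by blast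
  qed
  then have "cochain_support X (\<phi> - coboundary X h) = {}" using cochain_support_subset[of X] by blast
  ultimately show "\<exists>\<psi>\<in>compact_cochains X p. cochain_support X (\<phi> - coboundary X \<psi>) = {}" by blast
qed

subsection \<open>Universal coefficients\<close>

text \<open>The injective half of universal coefficients: the obstruction is an Ext of cohomology in
  degree \<open>Suc q\<close>, which is zero by assumption. The locally zero cochains appear as
  \<open>cochains_in X {} (Suc q)\<close>.\<close>

lemma boundary_if_zero_on_cocycles:
  assumes c: "c \<in> infinite_chains X q" and X: "acyclic_cochains X q"
    and z: "\<And>\<phi>. \<phi> \<in> compact_cochains X q \<Longrightarrow> cochain_support X (coboundary X \<phi>) = {} \<Longrightarrow> c \<phi> = 0"
  shows "c \<in> infinite_boundaries X q"
proof -
  have fin: "finite (range (coboundary X \<phi>))" if "\<phi> \<in> compact_cochains X p" for p \<phi>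
    using that compact_cochainsD coboundary_cochains cochainsD(1) by blast
  obtain b where b: "additive_on (compact_cochains X (Suc q)) b"
    "\<And>x. x \<in> cochains_in X {} (Suc q) \<Longrightarrow> b x = 0"
    "\<And>y. y \<in> compact_cochains X q \<Longrightarrow> b (coboundary X y) = c y"
  proof (rule dual_exact[where T = "coboundary X" and J = "null_near X (topspace X)" and c = c and \<delta> = "coboundary X"
        and ?G0.0 = "compact_cochains X q" and ?G1.0 = "compact_cochains X (Suc q)"
        and ?N1.0 = "cochains_in X {} (Suc q)"])
    show "c y = 0" if "y \<in> compact_cochains X q" "coboundary X y \<in> cochains_in X {} (Suc q)" for y
      using that z by (simp add: cochains_in_def)
    fix x assume x: "x \<in> compact_cochains X (Suc q)"
    have "coboundary X x \<in> null_near X (topspace X) \<longleftrightarrow> cochain_support X (coboundary X x) = {}"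
      using fin[OF x] cochain_support_subset[of X "coboundary X x"] by (auto simp: null_near_def)
    also have "\<dots> \<longleftrightarrow> (\<exists>y\<in>compact_cochains X q. cochain_support X (x - coboundary X y) = {})"
    proof
      assume "\<exists>y\<in>compact_cochains X q. cochain_support X (x - coboundary X y) = {}"
      then obtain y where "cochain_support X (x - coboundary X y) = {}" by blast
      moreover have "coboundary X (x - coboundary X y) = coboundary X x"
        by (simp add: coboundary_diff coboundary_coboundary)
      ultimately show "cochain_support X (coboundary X x) = {}"
        using cochain_support_coboundary[of X "x - coboundary X y"] by auto
    qed (use X x in \<open>simp add: acyclic_cochains_def\<close>)
    also have "\<dots> \<longleftrightarrow> (\<exists>y\<in>compact_cochains X q. x - coboundary X y \<in> cochains_in X {} (Suc q))"
      using compact_cochains_diff[OF x coboundary_compact] unfolding cochains_in_def by blast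
    finally show "coboundary X x \<in> null_near X (topspace X) \<longleftrightarrow>
      (\<exists>y\<in>compact_cochains X q. x - coboundary X y \<in> cochains_in X {} (Suc q))" .
  qed (use chain_additive[OF c] fin cochains_in_subset[of X "{}" "Suc q"] coboundary_add coboundary_compact null_near_finite_range
      in \<open>auto intro: subgrp_compact_cochains subgrp_cochains_in subgrp_null_near support_closed_null_near\<close>)
  show ?thesis
    by (rule boundaryI[OF c b(1)]) (use b(2,3) in \<open>auto simp: cochains_in_def\<close>)
qed

text \<open>The surjective half: cochains modulo cocycles embed, by the coboundary, into finitely
  valued functions modulo locally zero ones, so nothing obstructs the extension.\<close>

lemma chain_of_cocycle_functional:
  assumes "additive_on {\<phi> \<in> compact_cochains X q. cochain_support X (coboundary X \<phi>) = {}} l"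
    and "\<And>\<phi>. \<phi> \<in> compact_cochains X q \<Longrightarrow> cochain_support X \<phi> = {} \<Longrightarrow> l \<phi> = 0"
  obtains c where "c \<in> infinite_chains X q"
    "\<And>\<phi>. \<phi> \<in> compact_cochains X q \<Longrightarrow> cochain_support X (coboundary X \<phi>) = {} \<Longrightarrow> c \<phi> = l \<phi>"
proof -
  have fin: "finite (range (coboundary X \<phi>))" if "\<phi> \<in> compact_cochains X q" for \<phi>
    using that compact_cochainsD coboundary_cochains cochainsD(1) by blast
  have null: "coboundary X \<phi> \<in> null_near X (topspace X) \<longleftrightarrow> cochain_support X (coboundary X \<phi>) = {}"
    if "\<phi> \<in> compact_cochains X q" for \<phi>
    using fin[OF that] cochain_support_subset[of X "coboundary X \<phi>"] by (auto simp: null_near_def)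
  obtain c where c: "additive_on (compact_cochains X q) c"
    "\<And>\<phi>. \<phi> \<in> compact_cochains X q \<Longrightarrow> cochain_support X (coboundary X \<phi>) = {} \<Longrightarrow> c \<phi> = l \<phi>"
  proof (rule extend_additive[where G = "compact_cochains X q" and T = "coboundary X" and J = "null_near X (topspace X)" and c = l])
    show "additive_on {x \<in> compact_cochains X q. coboundary X x \<in> null_near X (topspace X)} l"
      using assms(1) by (simp add: null cong: conj_cong)
  qed (auto simp: null coboundary_add fin null_near_finite_range
      intro: subgrp_compact_cochains subgrp_null_near support_closed_null_near)
  show thesis
  proof
    show "(\<lambda>\<phi>. if \<phi> \<in> compact_cochains X q then c \<phi> else 0) \<in> infinite_chains X q"
    proof (rule chainI[OF c(1)])
      show "c \<phi> = 0" if "\<phi> \<in> compact_cochains X q" "cochain_support X \<phi> = {}" for \<phi>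
        using that assms(2) c(2) cochain_support_coboundary[of X \<phi>] by auto
    qed
  qed (use c(2) in auto)
qed

subsection \<open>Euclidean space\<close>

definition euclidean_box :: "nat \<Rightarrow> (nat \<Rightarrow> real) \<Rightarrow> real \<Rightarrow> (nat \<Rightarrow> real) set" where
  "euclidean_box d x e = {y \<in> topspace (Euclidean_space d). \<forall>i<d. \<bar>y i - x i\<bar> < e}"

lemma continuous_map_Euclidean_coordinate: "continuous_map (Euclidean_space d) euclideanreal (\<lambda>y. y i)"
  unfolding Euclidean_space_def
  by (intro continuous_map_from_subtopology continuous_map_product_projection) auto

lemma openin_euclidean_box: "openin (Euclidean_space d) (euclidean_box d x e)"
proof -
  have "openin (Euclidean_space d) {y \<in> topspace (Euclidean_space d). y i \<in> ball (x i) e}" for i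
    by (rule openin_continuous_map_preimage[OF continuous_map_Euclidean_coordinate]) simp
  then have "openin (Euclidean_space d) (topspace (Euclidean_space d) \<inter>
      (\<Inter>i\<in>{..<d}. {y \<in> topspace (Euclidean_space d). y i \<in> ball (x i) e}))"
    by (cases "d = 0") (auto intro!: openin_Int openin_INT2)
  moreover have "euclidean_box d x e = topspace (Euclidean_space d) \<inter>
      (\<Inter>i\<in>{..<d}. {y \<in> topspace (Euclidean_space d). y i \<in> ball (x i) e})"
    by (auto simp: euclidean_box_def dist_real_def abs_minus_commute)
  ultimately show ?thesis by simp
qed

lemma euclidean_box_exists:
  assumes "openin (Euclidean_space d) U" "x \<in> U"
  obtains e where "e > 0" "euclidean_box d x e \<subseteq> U"
proof -
  obtain T where T: "openin (powertop_real UNIV) T" "U = T \<inter> {x. \<forall>i\<ge>d. x i = 0}"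
    using assms(1) unfolding Euclidean_space_def by (auto simp: openin_subtopology)
  obtain A where A: "x \<in> (\<Pi>\<^sub>E i\<in>UNIV. A i)" "\<And>i. open (A i)" "finite {i. A i \<noteq> UNIV}"
    "(\<Pi>\<^sub>E i\<in>UNIV. A i) \<subseteq> T"
    using product_topology_open_contains_basis[OF T(1), of x] assms(2) T(2) by auto
  have "\<exists>e>0. ball (x i) e \<subseteq> A i" for i
    using A(1,2) open_contains_ball by (metis PiE_mem UNIV_I)
  then obtain e where e: "\<And>i. e i > 0" "\<And>i. ball (x i) (e i) \<subseteq> A i" by metis
  define \<epsilon> where "\<epsilon> = Min (insert 1 (e ` {..<d}))"
  have \<epsilon>: "\<epsilon> > 0" "\<And>i. i < d \<Longrightarrow> \<epsilon> \<le> e i"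
    using e(1) by (auto simp: \<epsilon>_def)
  have "euclidean_box d x \<epsilon> \<subseteq> U"
  proof
    fix y assume y: "y \<in> euclidean_box d x \<epsilon>"
    have "y i \<in> A i" for i
    proof (cases "i < d")
      case True
      then have "\<bar>y i - x i\<bar> < e i" using y \<epsilon>(2)[OF True] by (auto simp: euclidean_box_def)
      then show ?thesis using e(2)[of i] by (auto simp: dist_real_def abs_minus_commute)
    next
      case False
      then have "y i = x i" using y assms(2) T(2)
        by (auto simp: euclidean_box_def topspace_Euclidean_space)
      then show ?thesis using A(1) by (auto simp: PiE_iff)
    qed
    then show "y \<in> U" using y A(4) T(2) by (auto simp: euclidean_box_def topspace_Euclidean_space)
  qed
  then show thesis using that \<epsilon>(1) by blast
qed

lemma continuous_map_real_divide_nonzero: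
  assumes "continuous_map X euclideanreal f" "continuous_map X euclideanreal g"
    "\<And>x. x \<in> topspace X \<Longrightarrow> g x \<noteq> 0"
  shows "continuous_map X euclideanreal (\<lambda>x. f x / g x)"
  using assms by (auto simp: continuous_map_atin intro!: tendsto_divide)

text \<open>In each coordinate \<open>t / (e - \<bar>t\<bar>)\<close> stretches the open interval of
  radius \<open>e\<close> to the line, with inverse
  \<open>e * z / (1 + \<bar>z\<bar>)\<close>.\<close>

lemma euclidean_box_homeomorphic:
  assumes "e > 0"
  shows "subtopology (Euclidean_space d) (euclidean_box d x e) homeomorphic_space Euclidean_space d"
proof -
  let ?B = "subtopology (Euclidean_space d) (euclidean_box d x e)"
  define f :: "(nat \<Rightarrow> real) \<Rightarrow> nat \<Rightarrow> real"
    where "f = (\<lambda>y i. if i < d then (y i - x i) / (e - \<bar>y i - x i\<bar>) else 0)"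
  define g :: "(nat \<Rightarrow> real) \<Rightarrow> nat \<Rightarrow> real"
    where "g = (\<lambda>z i. if i < d then x i + e * z i / (1 + \<bar>z i\<bar>) else 0)"
  have coord: "continuous_map ?B euclideanreal (\<lambda>y. y i)" for i
    using continuous_map_Euclidean_coordinate continuous_map_from_subtopology by blast
  have "continuous_map ?B (Euclidean_space d) f"
    unfolding f_def continuous_map_componentwise_Euclidean_space
    by (intro allI impI continuous_map_real_divide_nonzero continuous_intros coord)
      (auto simp: euclidean_box_def)
  moreover have "continuous_map (Euclidean_space d) (Euclidean_space d) g"
    unfolding g_def continuous_map_componentwise_Euclidean_space
    by (intro allI impI continuous_map_real_divide_nonzero continuous_intros continuous_map_Euclidean_coordinate)
      auto
  moreover have "g z \<in> euclidean_box d x e" for z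
  proof -
    have "\<bar>e * z i / (1 + \<bar>z i\<bar>)\<bar> < e" for i
    proof -
      have "\<bar>e * z i / (1 + \<bar>z i\<bar>)\<bar> = e * (\<bar>z i\<bar> / (1 + \<bar>z i\<bar>))"
        using assms by (simp add: abs_mult)
      moreover have "\<bar>z i\<bar> / (1 + \<bar>z i\<bar>) < 1" by simp
      ultimately show ?thesis using assms mult_strict_left_mono[of _ 1 e] by fastforce
    qed
    then show ?thesis by (auto simp: euclidean_box_def topspace_Euclidean_space g_def)
  qed
  ultimately have "continuous_map (Euclidean_space d) ?B g" "continuous_map ?B (Euclidean_space d) f"
    by (auto simp: continuous_map_in_subtopology)
  moreover have "g (f y) = y" if "y \<in> topspace ?B" for y
  proof
    fix i
    show "g (f y) i = y i"
    proof (cases "i < d")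
      case True
      define u where "u = y i - x i"
      have u: "\<bar>u\<bar> < e" using that True by (auto simp: u_def euclidean_box_def)
      then have "1 + \<bar>u / (e - \<bar>u\<bar>)\<bar> = e / (e - \<bar>u\<bar>)" by (simp add: abs_divide field_simps)
      then have "e * (u / (e - \<bar>u\<bar>)) / (1 + \<bar>u / (e - \<bar>u\<bar>)\<bar>) = u" using u assms by simp
      then show ?thesis using True by (simp add: f_def g_def u_def)
    next
      case False
      then show ?thesis using that by (auto simp: g_def topspace_Euclidean_space)
    qed
  qed
  moreover have "f (g z) = z" if "z \<in> topspace (Euclidean_space d)" for z
  proof
    fix i
    show "f (g z) i = z i"
    proof (cases "i < d")
      case True
      have "\<bar>e * z i / (1 + \<bar>z i\<bar>)\<bar> = e * \<bar>z i\<bar> / (1 + \<bar>z i\<bar>)"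
        using assms by (simp add: abs_mult abs_divide)
      then have "e - \<bar>e * z i / (1 + \<bar>z i\<bar>)\<bar> = e / (1 + \<bar>z i\<bar>)"
        by (simp add: field_simps add_nonneg_eq_0_iff)
      then show ?thesis using True assms by (simp add: f_def g_def)
    next
      case False
      then show ?thesis using that by (auto simp: f_def topspace_Euclidean_space)
    qed
  qed
  ultimately show ?thesis unfolding homeomorphic_space_def homeomorphic_maps_def by blast
qed

text \<open>Intersections of charts need not be Euclidean; preimages of small boxes are, and they
  allow any two charts to be compared.\<close>

lemma euclidean_open_basis:
  assumes "topological_manifold d M" "openin M W" "x \<in> W"
  obtains V where "euclidean_open d M V" "x \<in> V" "V \<subseteq> W"
proof -
  have "x \<in> topspace M" using assms(2,3) openin_subset by blast
  then obtain U where U: "openin M U" "x \<in> U" "subtopology M U homeomorphic_space Euclidean_space d"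
    using assms(1) unfolding topological_manifold_def euclidean_open_def by blast
  have UM: "U \<subseteq> topspace M" using U(1) openin_subset by blast
  then have top: "topspace (subtopology M U) = U" by auto
  obtain h where h: "homeomorphic_map (subtopology M U) (Euclidean_space d) h"
    using U(3) homeomorphic_space by blast
  have "openin (Euclidean_space d) (h ` (W \<inter> U))"
    using homeomorphic_imp_open_map[OF h] assms(2) unfolding open_map_def by (auto simp: openin_subtopology_Int)
  then obtain e where e: "e > 0" "euclidean_box d (h x) e \<subseteq> h ` (W \<inter> U)"
    using euclidean_box_exists[of d _ "h x"] assms(3) U(2) by blast
  define V where "V = {y \<in> U. h y \<in> euclidean_box d (h x) e}"
  have "openin (subtopology M U) V"
    using openin_continuous_map_preimage[OF homeomorphic_imp_continuous_map[OF h]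
        openin_euclidean_box[of d "h x" e]]
    unfolding V_def top .
  then have V: "openin M V" using U(1) openin_open_subtopology by blast
  have "homeomorphic_map (subtopology (subtopology M U) V)
      (subtopology (Euclidean_space d) (euclidean_box d (h x) e)) h"
    by (rule homeomorphic_map_subtopologies_alt[OF h]) (auto simp: V_def top)
  moreover have "subtopology (subtopology M U) V = subtopology M V"
    by (simp add: subtopology_subtopology V_def inf.absorb2 Collect_conj_eq inf_commute)
  ultimately have "subtopology M V homeomorphic_space Euclidean_space d"
    using euclidean_box_homeomorphic[OF e(1)] homeomorphic_space_trans homeomorphic_map_imp_homeomorphic_space by metis
  moreover have "x \<in> V"
    using U(2) e(1) homeomorphic_imp_continuous_map[OF h] top
    by (auto simp: V_def euclidean_box_def continuous_map_def)
  moreover have "V \<subseteq> W"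
  proof
    fix y assume y: "y \<in> V"
    then obtain w where w: "w \<in> W \<inter> U" "h y = h w" using e(2) by (auto simp: V_def)
    moreover have "inj_on h U" using homeomorphic_imp_injective_map[OF h] by (simp only: top)
    ultimately have "y = w" using y by (auto simp: V_def dest: inj_onD)
    then show "y \<in> W" using w by blast
  qed
  ultimately show thesis using that V unfolding euclidean_open_def by blast
qed

text \<open>Bricks of side \<open>s\<close>. The layers of bricks in direction \<open>k\<close> are shifted by an amount that
  depends injectively on the previous indices, so that near any point at most one of them has
  a wall there.\<close>

definition brick_shift :: "int list \<Rightarrow> real" where
  "brick_shift a = 1 / (2 + real (to_nat a))"

fun brick :: "real \<Rightarrow> nat \<Rightarrow> (nat \<Rightarrow> real) \<Rightarrow> int list" where
  "brick s 0 y = []"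
| "brick s (Suc k) y = \<lfloor>y k / s + brick_shift (brick s k y)\<rfloor> # brick s k y"

text \<open>With all shifts strictly between \<open>0\<close> and \<open>1\<close>, two distinct
  ones never differ by an integer. This is what the constant \<open>2\<close> in the denominator is
  for.\<close>

lemma brick_shift_bounds: "0 < brick_shift a" "brick_shift a < 1"
  by (auto simp: brick_shift_def)

lemma brick_shift_inj: "brick_shift a = brick_shift b \<longleftrightarrow> a = b"
  by (auto simp: brick_shift_def)

lemma brick_diameter:
  assumes "s > 0" "brick s k y = brick s k z" "i < k"
  shows "\<bar>y i - z i\<bar> < s"
  using assms(2,3)
proof (induction k)
  case (Suc k)
  have eq: "\<lfloor>y k / s + brick_shift (brick s k z)\<rfloor> = \<lfloor>z k / s + brick_shift (brick s k z)\<rfloor>"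
    and tl: "brick s k y = brick s k z" using Suc.prems(1) by auto
  show ?case
  proof (cases "i = k")
    case True
    have "\<bar>y k / s - z k / s\<bar> < 1" using eq by linarith
    then have "\<bar>y k - z k\<bar> / s < 1" using assms(1) by (simp add: abs_divide flip: diff_divide_distrib)
    then show ?thesis using True assms(1) by simp
  qed (use Suc tl in auto)
qed simp

lemma brick_finite:
  assumes "s > 0"
  shows "finite (brick s k ` {y. \<forall>i<k. \<bar>y i - x i\<bar> \<le> R})"
proof (induction k)
  case (Suc k)
  have "brick s (Suc k) y \<in> (\<lambda>(j, a). j # a) `
      ({\<lfloor>(x k - R) / s\<rfloor>..\<lfloor>(x k + R) / s + 1\<rfloor>} \<times> brick s k ` {y. \<forall>i<k. \<bar>y i - x i\<bar> \<le> R})"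
    if y: "\<forall>i<Suc k. \<bar>y i - x i\<bar> \<le> R" for y
  proof -
    have "(x k - R) / s \<le> y k / s" "y k / s \<le> (x k + R) / s"
      using y[rule_format, of k] assms by (auto intro!: divide_right_mono)
    then have "\<lfloor>y k / s + brick_shift (brick s k y)\<rfloor> \<in> {\<lfloor>(x k - R) / s\<rfloor>..\<lfloor>(x k + R) / s + 1\<rfloor>}"
      using brick_shift_bounds[of "brick s k y"] unfolding atLeastAtMost_iff
      by (intro conjI floor_mono) linarith+
    then show ?thesis using y by force
  qed
  then have "brick s (Suc k) ` {y. \<forall>i<Suc k. \<bar>y i - x i\<bar> \<le> R} \<subseteq> (\<lambda>(j, a). j # a) `
      ({\<lfloor>(x k - R) / s\<rfloor>..\<lfloor>(x k + R) / s + 1\<rfloor>} \<times> brick s k ` {y. \<forall>i<k. \<bar>y i - x i\<bar> \<le> R})"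
    by blast
  moreover have "finite ((\<lambda>(j, a). j # a) `
      ({\<lfloor>(x k - R) / s\<rfloor>..\<lfloor>(x k + R) / s + 1\<rfloor>} \<times> brick s k ` {y. \<forall>i<k. \<bar>y i - x i\<bar> \<le> R}))"
    using Suc by blast
  ultimately show ?case by (rule finite_subset)
qed simp

text \<open>The second value of the floor occurs only if \<open>t\<close> lies on a wall, which is
  what makes the count of bricks in \<open>brick_local\<close> work.\<close>

lemma floor_near:
  fixes t :: real
  obtains e where "e > 0" "\<And>u. \<bar>u - t\<bar> < e \<Longrightarrow> \<lfloor>u\<rfloor> = \<lfloor>t\<rfloor> \<or> t \<in> \<int> \<and> \<lfloor>u\<rfloor> = \<lfloor>t\<rfloor> - 1"
proof (cases "t \<in> \<int>")
  case True
  then obtain k where "t = of_int k" by (auto elim: Ints_cases)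
  show thesis
  proof
    show "\<lfloor>u\<rfloor> = \<lfloor>t\<rfloor> \<or> t \<in> \<int> \<and> \<lfloor>u\<rfloor> = \<lfloor>t\<rfloor> - 1" if "\<bar>u - t\<bar> < 1" for u
    proof (cases "u < t")
      case True
      then have "\<lfloor>u\<rfloor> = k - 1" using that \<open>t = of_int k\<close> by (simp add: floor_eq_iff)
      then show ?thesis using \<open>t \<in> \<int>\<close> \<open>t = of_int k\<close> by simp
    next
      case False
      then have "\<lfloor>u\<rfloor> = k" using that \<open>t = of_int k\<close> by (simp add: floor_eq_iff)
      then show ?thesis using \<open>t = of_int k\<close> by simp
    qed
  qed simp
next
  case False
  then have "of_int \<lfloor>t\<rfloor> < t" by (metis Ints_of_int of_int_floor_le order_le_less)
  then show thesis
    using that[of "min (t - of_int \<lfloor>t\<rfloor>) (of_int \<lfloor>t\<rfloor> + 1 - t)"] by (auto simp: floor_eq_iff abs_less_iff; linarith)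
qed

text \<open>Each of the at most \<open>Suc k\<close> previous bricks near the point contributes one
  index in the new direction, and a second one only if it has a wall exactly there. Two such walls
  would make two distinct shifts differ by an integer, so the count grows by at most one.\<close>

lemma brick_local:
  assumes "s > 0"
  shows "\<exists>e>0. finite (brick s k ` {y. \<forall>i<k. \<bar>y i - x i\<bar> < e}) \<and>
    card (brick s k ` {y. \<forall>i<k. \<bar>y i - x i\<bar> < e}) \<le> Suc k"
proof (induction k)
  case 0
  then show ?case by (auto intro!: exI[of _ 1])
next
  case (Suc k)
  then obtain e where e: "e > 0" "finite (brick s k ` {y. \<forall>i<k. \<bar>y i - x i\<bar> < e})"
    "card (brick s k ` {y. \<forall>i<k. \<bar>y i - x i\<bar> < e}) \<le> Suc k" by blast
  define P where "P = brick s k ` {y. \<forall>i<k. \<bar>y i - x i\<bar> < e}"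
  define t where "t = (\<lambda>a. x k / s + brick_shift a)"
  have "\<exists>\<delta>>0. \<forall>u. \<bar>u - t a\<bar> < \<delta> \<longrightarrow> \<lfloor>u\<rfloor> = \<lfloor>t a\<rfloor> \<or> t a \<in> \<int> \<and> \<lfloor>u\<rfloor> = \<lfloor>t a\<rfloor> - 1" for a
    using floor_near by metis
  then obtain \<delta> where \<delta>: "\<And>a. \<delta> a > 0"
    "\<And>a u. \<bar>u - t a\<bar> < \<delta> a \<Longrightarrow> \<lfloor>u\<rfloor> = \<lfloor>t a\<rfloor> \<or> t a \<in> \<int> \<and> \<lfloor>u\<rfloor> = \<lfloor>t a\<rfloor> - 1" by metis
  define \<eta> where "\<eta> = Min (insert e ((\<lambda>a. s * \<delta> a) ` P))"
  have \<eta>: "\<eta> > 0" "\<eta> \<le> e" "\<And>a. a \<in> P \<Longrightarrow> \<eta> \<le> s * \<delta> a"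
    using e \<delta>(1) assms by (auto simp: \<eta>_def P_def)
  define Q where "Q = {a \<in> P. t a \<in> \<int>}"
  define A where "A = (\<lambda>a. \<lfloor>t a\<rfloor> # a) ` P"
  define B where "B = (\<lambda>a. (\<lfloor>t a\<rfloor> - 1) # a) ` Q"
  have fP: "finite P" "card P \<le> Suc k" using e(2,3) by (simp_all add: P_def)
  have "a = b" if "a \<in> Q" "b \<in> Q" for a b
  proof -
    have "t a - t b \<in> \<int>" using that by (auto simp: Q_def)
    then obtain j where j: "brick_shift a - brick_shift b = of_int j" by (auto simp: t_def elim: Ints_cases)
    then have "\<bar>real_of_int j\<bar> < 1" using brick_shift_bounds[of a] brick_shift_bounds[of b] by linarith
    then have "j = 0" by linarith
    then show ?thesis using j brick_shift_inj by simp
  qed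
  then have "card Q \<le> 1" using fP by (simp add: Q_def card_le_Suc0_iff_eq)
  then have "card B \<le> 1" using fP card_image_le[of Q "\<lambda>a. (\<lfloor>t a\<rfloor> - 1) # a"] by (simp add: B_def Q_def)
  moreover have "card A \<le> Suc k" using fP card_image_le[of P "\<lambda>a. \<lfloor>t a\<rfloor> # a"] by (simp add: A_def)
  ultimately have card: "card (A \<union> B) \<le> Suc (Suc k)" using card_Un_le[of A B] by linarith
  have fin: "finite (A \<union> B)" using fP by (auto simp: A_def B_def Q_def)
  have "brick s (Suc k) y \<in> A \<union> B" if y: "\<forall>i<Suc k. \<bar>y i - x i\<bar> < \<eta>" for y
  proof -
    define a where "a = brick s k y"
    have "\<forall>i<k. \<bar>y i - x i\<bar> < e" using y \<eta>(2) by (meson less_SucI order_less_le_trans)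
    then have a: "a \<in> P" unfolding a_def P_def by blast
    have "\<bar>y k - x k\<bar> < s * \<delta> a" using y \<eta>(3)[OF a] by force
    then have "\<bar>y k - x k\<bar> / s < \<delta> a" using assms by (simp add: divide_less_eq mult.commute)
    then have "\<bar>(y k / s + brick_shift a) - t a\<bar> < \<delta> a"
      using assms by (simp add: t_def abs_divide flip: diff_divide_distrib)
    from \<delta>(2)[OF this] show ?thesis using a by (auto simp: A_def B_def Q_def a_def)
  qed
  then have sub: "brick s (Suc k) ` {y. \<forall>i<Suc k. \<bar>y i - x i\<bar> < \<eta>} \<subseteq> A \<union> B" by blast
  show ?case
    using \<eta>(1) finite_subset[OF sub fin] card_mono[OF fin sub] card by (intro exI[of _ \<eta>]) linarith
qed

text \<open>The pieces are small bricks. It is enough that the cover contains \<open>K\<close>,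
  since the partition is needed only on a neighbourhood \<open>N\<close> of \<open>K\<close>; this
  flexibility permits the transfer to arbitrary open subsets of a chart.\<close>

lemma euclidean_fine_partitions:
  assumes K: "compactin (Euclidean_space d) K" and \<U>: "\<forall>U\<in>\<U>. openin (Euclidean_space d) U" "K \<subseteq> \<Union>\<U>"
  shows "\<exists>N (v :: (nat \<Rightarrow> real) \<Rightarrow> nat). openin (Euclidean_space d) N \<and> K \<subseteq> N \<and> finite (v ` N) \<and>
    (\<forall>x\<in>N. \<exists>B. openin (Euclidean_space d) B \<and> x \<in> B \<and> B \<subseteq> N \<and> card (v ` B) \<le> Suc d \<and>
       (\<exists>U\<in>\<U>. \<forall>y\<in>B. \<forall>z\<in>N. v z = v y \<longrightarrow> z \<in> U))"
proof -
  let ?E = "Euclidean_space d"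
  \<comment> \<open>The factor \<open>3\<close> pays for three distances: from the centre
    \<open>t\<close> to \<open>x\<close>, from \<open>x\<close> to \<open>y\<close>, and from
    \<open>y\<close> to a point \<open>z\<close> of the same brick.\<close>
  have "\<exists>U e. U \<in> \<U> \<and> e > 0 \<and> euclidean_box d x (3 * e) \<subseteq> U" if "x \<in> K" for x
  proof -
    obtain U where U: "U \<in> \<U>" "x \<in> U" using \<U>(2) \<open>x \<in> K\<close> by blast
    then obtain e where "e > 0" "euclidean_box d x e \<subseteq> U" using \<U>(1) euclidean_box_exists by blast
    then show ?thesis using U by (intro exI[of _ U] exI[of _ "e / 3"]) auto
  qed
  then obtain U e where Ue: "\<And>x. x \<in> K \<Longrightarrow> U x \<in> \<U> \<and> e x > 0 \<and> euclidean_box d x (3 * e x) \<subseteq> U x"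
    by metis
  have KE: "K \<subseteq> topspace ?E" using K compactin_subset_topspace by blast
  have "\<forall>B\<in>(\<lambda>x. euclidean_box d x (e x)) ` K. openin ?E B" using openin_euclidean_box by blast
  moreover have "K \<subseteq> \<Union>((\<lambda>x. euclidean_box d x (e x)) ` K)"
    using Ue KE by (force simp: euclidean_box_def)
  ultimately obtain \<F> where "finite \<F>" "\<F> \<subseteq> (\<lambda>x. euclidean_box d x (e x)) ` K" "K \<subseteq> \<Union>\<F>"
    using K unfolding compactin_def by meson
  moreover from this obtain T where "finite T" "T \<subseteq> K" "\<F> = (\<lambda>x. euclidean_box d x (e x)) ` T"
    using finite_subset_image by meson
  ultimately have T: "finite T" "T \<subseteq> K" "K \<subseteq> \<Union>((\<lambda>x. euclidean_box d x (e x)) ` T)"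
    by simp_all
  define N where "N = \<Union>((\<lambda>x. euclidean_box d x (e x)) ` T)"
  define s where "s = Min (insert 1 (e ` T))"
  have s: "s > 0" "\<And>t. t \<in> T \<Longrightarrow> s \<le> e t" using T Ue by (auto simp: s_def)
  define v where "v = (\<lambda>y. to_nat (brick s d y))"
  have v: "brick s d y = brick s d z" if "v y = v z" for y z using that by (simp add: v_def)
  have N: "openin ?E N" unfolding N_def using openin_euclidean_box by blast
  show ?thesis
  proof (rule exI[of _ N], rule exI[of _ v], intro conjI ballI)
    show "openin ?E N" unfolding N_def using openin_euclidean_box by blast
    show "K \<subseteq> N" using T(3) by (simp add: N_def)
    have "finite (brick s d ` euclidean_box d t (e t))" for t
      by (rule finite_subset[OF image_mono brick_finite[OF s(1), of d t "e t"]])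
        (auto simp: euclidean_box_def)
    then have "finite (to_nat ` (\<Union>t\<in>T. brick s d ` euclidean_box d t (e t)))" using T(1) by blast
    moreover have "v ` N = to_nat ` (\<Union>t\<in>T. brick s d ` euclidean_box d t (e t))"
      by (auto simp: v_def N_def image_iff)
    ultimately show "finite (v ` N)" by simp
    fix x assume x: "x \<in> N"
    then obtain t where t: "t \<in> T" "x \<in> euclidean_box d t (e t)" by (auto simp: N_def)
    obtain r where r: "r > 0" "finite (brick s d ` {y. \<forall>i<d. \<bar>y i - x i\<bar> < r})"
      "card (brick s d ` {y. \<forall>i<d. \<bar>y i - x i\<bar> < r}) \<le> Suc d"
      using brick_local[OF s(1)] by blast
    define B where "B = N \<inter> euclidean_box d x (min r s)"
    have "openin ?E B" unfolding B_def using N openin_euclidean_box by blast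
    moreover have "x \<in> B" using x r(1) s(1) t(2) by (auto simp: B_def euclidean_box_def)
    moreover have "card (v ` B) \<le> Suc d"
    proof -
      have sub: "brick s d ` B \<subseteq> brick s d ` {y. \<forall>i<d. \<bar>y i - x i\<bar> < r}"
        by (auto simp: B_def euclidean_box_def)
      have "v ` B = to_nat ` brick s d ` B" by (auto simp: v_def)
      then have "card (v ` B) \<le> card (brick s d ` B)"
        using card_image_le finite_subset[OF sub r(2)] by metis
      then show ?thesis using card_mono[OF r(2) sub] r(3) by linarith
    qed
    moreover have "z \<in> U t" if "y \<in> B" "z \<in> N" "v z = v y" for y z
    proof -
      have "\<bar>z i - t i\<bar> < 3 * e t" if "i < d" for i
      proof -
        have "\<bar>z i - y i\<bar> < s" using brick_diameter[OF s(1) v[OF \<open>v z = v y\<close>] that] .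
        moreover have "\<bar>y i - x i\<bar> < s" using \<open>y \<in> B\<close> that by (auto simp: B_def euclidean_box_def)
        moreover have "\<bar>x i - t i\<bar> < e t" using t(2) that by (auto simp: euclidean_box_def)
        ultimately show ?thesis using s(2)[OF t(1)] by linarith
      qed
      moreover have "z \<in> topspace ?E" using \<open>z \<in> N\<close> openin_subset[OF N] by blast
      ultimately show ?thesis using Ue[of t] t(1) T(2) by (auto simp: euclidean_box_def)
    qed
    ultimately show "\<exists>B. openin ?E B \<and> x \<in> B \<and> B \<subseteq> N \<and> card (v ` B) \<le> Suc d \<and>
           (\<exists>U\<in>\<U>. \<forall>y\<in>B. \<forall>z\<in>N. v z = v y \<longrightarrow> z \<in> U)"
      using Ue[of t] t(1) T(2) by (intro exI[of _ B]) (auto simp: B_def)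
  qed
qed

text \<open>Here \<open>W\<close> is any open subset of a chart. The Mayer-Vietoris argument meets
  intersections of a chart with unions of charts, which need not be Euclidean themselves.\<close>

lemma euclidean_open_fine_partitions:
  assumes U: "euclidean_open d M U" and W: "openin M W" "W \<subseteq> U"
  shows "fine_partitions (subtopology M W) d"
  unfolding fine_partitions_def
proof (intro allI impI)
  let ?E = "Euclidean_space d"
  have UM: "U \<subseteq> topspace M" "openin M U" using U openin_subset by (auto simp: euclidean_open_def)
  obtain h where h: "homeomorphic_map (subtopology M U) ?E h"
    using U homeomorphic_space unfolding euclidean_open_def by blast
  have open_h: "openin ?E (h ` A)" if "openin M A" "A \<subseteq> U" for A
    using homeomorphic_imp_open_map[OF h] that UM unfolding open_map_def by (simp add: openin_open_subtopology)
  have cont: "continuous_map (subtopology M W) ?E h"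
    using homeomorphic_imp_continuous_map[OF h] continuous_map_from_subtopology_mono W(2) by blast
  have inj: "inj_on h W"
    using homeomorphic_imp_injective_map[OF h] W(2) UM(1) by (auto intro: inj_on_subset)
  fix K \<U> assume K\<U>: "compactin (subtopology M W) K \<and> (\<forall>U\<in>\<U>. openin (subtopology M W) U) \<and> topspace (subtopology M W) \<subseteq> \<Union>\<U>"
  then have KW: "K \<subseteq> W" "\<And>A. A \<in> \<U> \<Longrightarrow> openin M A \<and> A \<subseteq> W"
    using compactin_subset_topspace[of "subtopology M W" K] openin_open_subtopology[OF W(1)] by auto
  have "compactin ?E (h ` K)" using image_compactin K\<U> cont by blast
  moreover have "\<forall>A\<in>(`) h ` \<U>. openin ?E A" using KW(2) W(2) open_h by blast
  moreover have "h ` K \<subseteq> \<Union>((`) h ` \<U>)"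
    using K\<U> KW(1) openin_subset[OF W(1)] by (fastforce simp: subset_iff)
  ultimately have "\<exists>N (v :: (nat \<Rightarrow> real) \<Rightarrow> nat). openin ?E N \<and> h ` K \<subseteq> N \<and> finite (v ` N) \<and>
    (\<forall>x\<in>N. \<exists>B. openin ?E B \<and> x \<in> B \<and> B \<subseteq> N \<and> card (v ` B) \<le> Suc d \<and>
       (\<exists>U\<in>(`) h ` \<U>. \<forall>y\<in>B. \<forall>z\<in>N. v z = v y \<longrightarrow> z \<in> U))"
    by (rule euclidean_fine_partitions)
  then obtain N and v :: "(nat \<Rightarrow> real) \<Rightarrow> nat" where N: "openin ?E N" "h ` K \<subseteq> N" "finite (v ` N)"
    "\<forall>x\<in>N. \<exists>B. openin ?E B \<and> x \<in> B \<and> B \<subseteq> N \<and> card (v ` B) \<le> Suc d \<and>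
           (\<exists>U\<in>(`) h ` \<U>. \<forall>y\<in>B. \<forall>z\<in>N. v z = v y \<longrightarrow> z \<in> U)"
    by (elim exE conjE) (rule that)
  have top: "topspace (subtopology M W) = W" using openin_subset[OF W(1)] by auto
  define N' where "N' = {x \<in> W. h x \<in> N}"
  have pre: "openin (subtopology M W) {x \<in> W. h x \<in> A}" if "openin ?E A" for A
    using openin_continuous_map_preimage[OF cont that] unfolding top .
  have "\<exists>B. openin (subtopology M W) B \<and> x \<in> B \<and> B \<subseteq> N' \<and> card ((v \<circ> h) ` B) \<le> Suc d \<and>
           (\<exists>U\<in>\<U>. \<forall>y\<in>B. \<forall>z\<in>N'. (v \<circ> h) z = (v \<circ> h) y \<longrightarrow> z \<in> U)" if x: "x \<in> N'" for x
  proof -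
    obtain B A where B: "openin ?E B" "h x \<in> B" "B \<subseteq> N" "card (v ` B) \<le> Suc d"
      "A \<in> \<U>" "\<And>y z. y \<in> B \<Longrightarrow> z \<in> N \<Longrightarrow> v z = v y \<Longrightarrow> z \<in> h ` A"
      using bspec[OF N(4), of "h x"] x by (auto simp: N'_def)
    have sub: "(v \<circ> h) ` {x \<in> W. h x \<in> B} \<subseteq> v ` B" by auto
    have "finite (v ` B)" using B(3) N(3) by (meson finite_subset image_mono)
    from card_mono[OF this sub] have "card ((v \<circ> h) ` {x \<in> W. h x \<in> B}) \<le> Suc d" using B(4) by linarith
    moreover have "z \<in> A" if "h y \<in> B" "z \<in> N'" "v (h z) = v (h y)" for y z
    proof -
      have "h z \<in> h ` A" using B(6) that by (simp add: N'_def)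
      moreover have "z \<in> W" "A \<subseteq> W" using that(2) KW(2)[OF B(5)] by (auto simp: N'_def)
      ultimately show ?thesis using inj by (auto dest: inj_onD)
    qed
    ultimately show ?thesis using B x pre[OF B(1)]
      by (intro exI[of _ "{x \<in> W. h x \<in> B}"]) (auto simp: N'_def)
  qed
  moreover have "finite ((v \<circ> h) ` N')"
    by (rule finite_subset[OF _ N(3)]) (auto simp: N'_def)
  moreover have "openin (subtopology M W) N'" using pre[OF N(1)] by (simp add: N'_def)
  moreover have "K \<subseteq> N'" using KW(1) N(2) by (auto simp: N'_def)
  ultimately show "\<exists>N (v :: 'a \<Rightarrow> nat). openin (subtopology M W) N \<and> K \<subseteq> N \<and> finite (v ` N) \<and>
        (\<forall>x\<in>N. \<exists>B. openin (subtopology M W) B \<and> x \<in> B \<and> B \<subseteq> N \<and> card (v ` B) \<le> Suc d \<and>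
           (\<exists>U\<in>\<U>. \<forall>y\<in>B. \<forall>z\<in>N. v z = v y \<longrightarrow> z \<in> U))"
    by blast
qed

subsection \<open>Covering dimension\<close>

text \<open>Shrink around each point, pass to a finite subcover, and collect the closed sets
  assigned to the same \<open>V\<close>. Sets that receive none get the empty set, so
  \<open>F\<close> can be defined on all sets.\<close>

lemma closed_shrinking:
  assumes X: "compact_space X" "Hausdorff_space X"
    and \<V>: "\<And>V. V \<in> \<V> \<Longrightarrow> openin X V" "topspace X \<subseteq> \<Union>\<V>"
  obtains F where "\<And>V. closedin X (F V)" "\<And>V. F V \<subseteq> V" "finite {V. F V \<noteq> {}}"
    "\<And>x. x \<in> topspace X \<Longrightarrow> \<exists>V\<in>\<V>. x \<in> F V"
proof -
  have "\<exists>V P C. V \<in> \<V> \<and> openin X P \<and> closedin X C \<and> x \<in> P \<and> P \<subseteq> C \<and> C \<subseteq> V" if x: "x \<in> topspace X" for x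
  proof -
    obtain V where V: "V \<in> \<V>" "x \<in> V" using \<V>(2) x by blast
    from nbhd_closed[OF X \<V>(1)[OF V(1)] V(2)] V(1) show ?thesis by metis
  qed
  then obtain V P C where V: "\<And>x. x \<in> topspace X \<Longrightarrow> V x \<in> \<V> \<and> openin X (P x) \<and> closedin X (C x)
      \<and> x \<in> P x \<and> P x \<subseteq> C x \<and> C x \<subseteq> V x"
    by metis
  have "\<forall>B\<in>P ` topspace X. openin X B" "topspace X \<subseteq> \<Union>(P ` topspace X)" using V by blast+
  then obtain \<F> where F: "finite \<F>" "\<F> \<subseteq> P ` topspace X" "topspace X \<subseteq> \<Union>\<F>"
    using X(1) unfolding compact_space_alt by meson
  obtain T where "finite T" "T \<subseteq> topspace X" "\<F> = P ` T"
    using finite_subset_image[OF F(1,2)] by blast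
  then have T: "finite T" "T \<subseteq> topspace X" "topspace X \<subseteq> \<Union>(P ` T)" using F(3) by simp_all
  define F where "F = (\<lambda>U. \<Union>(C ` {t \<in> T. V t = U}))"
  show thesis
  proof
    show "closedin X (F U)" for U
      unfolding F_def using T V by (intro closedin_Union) auto
    show "F U \<subseteq> U" for U unfolding F_def using T(2) V by blast
    show "finite {U. F U \<noteq> {}}"
      by (rule finite_subset[of _ "V ` T"]) (use T(1) in \<open>auto simp: F_def\<close>)
    fix x assume "x \<in> topspace X"
    then obtain t where "t \<in> T" "x \<in> P t" using T(3) by blast
    then show "\<exists>U\<in>\<V>. x \<in> F U"
      using T(2) V unfolding F_def by (intro bexI[of _ "V t"]) blast+
  qed
qed

text \<open>This is the neighbourhood of \<open>x\<close> that meets only those \<open>F V\<close>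
  to which \<open>x\<close> itself belongs.\<close>

lemma openin_avoiding:
  assumes "\<And>V. closedin X (F V)" "finite {V. F V \<noteq> {}}"
  shows "openin X (topspace X - \<Union>{F V |V. x \<notin> F V})"
proof -
  have "\<Union>{F V |V. x \<notin> F V} = \<Union>(F ` {V. F V \<noteq> {} \<and> x \<notin> F V})" by auto
  moreover have "closedin X \<dots>"
    using assms by (intro closedin_Union) auto
  ultimately show ?thesis using openin_diff[OF openin_topspace] by metis
qed

text \<open>The set attached to \<open>y\<close> avoids every \<open>F V\<close> not containing
  \<open>y\<close> and lies in every \<open>V\<close> with \<open>y \<in> F V\<close>. If it
  contains a point \<open>x\<close> of \<open>F U\<close>, then \<open>y \<in> F U\<close>, and so
  it lies in \<open>U\<close>, which depends on \<open>x\<close> only.\<close>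

lemma barycentric_refinement:
  assumes X: "compact_space X" "Hausdorff_space X"
    and \<U>: "\<And>U. U \<in> \<U> \<Longrightarrow> openin X U" "topspace X \<subseteq> \<Union>\<U>"
  obtains \<W> where "\<And>W. W \<in> \<W> \<Longrightarrow> openin X W" "topspace X \<subseteq> \<Union>\<W>"
    "\<And>x. x \<in> topspace X \<Longrightarrow> \<exists>U\<in>\<U>. \<forall>W\<in>\<W>. x \<in> W \<longrightarrow> W \<subseteq> U"
proof -
  obtain F where F: "\<And>V. closedin X (F V)" "\<And>V. F V \<subseteq> V" "finite {V. F V \<noteq> {}}"
    "\<And>x. x \<in> topspace X \<Longrightarrow> \<exists>V\<in>\<U>. x \<in> F V"
    using closed_shrinking[OF X \<U>] by metis
  define W where "W = (\<lambda>x. (topspace X - \<Union>{F V |V. x \<notin> F V}) \<inter> \<Inter>{V \<in> \<U>. x \<in> F V})"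
  have fin: "finite {V \<in> \<U>. x \<in> F V}" for x
    by (rule finite_subset[OF _ F(3)]) auto
  show thesis
  proof
    show "openin X A" if "A \<in> W ` topspace X" for A
    proof -
      obtain x where x: "x \<in> topspace X" "A = W x" using \<open>A \<in> W ` topspace X\<close> by blast
      have "openin X (\<Inter>{V \<in> \<U>. x \<in> F V})"
        using fin F(4)[OF x(1)] \<U>(1) by (intro openin_Inter) auto
      then show ?thesis unfolding x(2) W_def using openin_avoiding[OF F(1,3)] by blast
    qed
    have "x \<in> W x" if "x \<in> topspace X" for x
      using that F(2) by (auto simp: W_def)
    then show "topspace X \<subseteq> \<Union>(W ` topspace X)" by blast
    fix x assume "x \<in> topspace X"
    then obtain U where U: "U \<in> \<U>" "x \<in> F U" using F(4) by blast
    have "W y \<subseteq> U" if "x \<in> W y" for y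
    proof -
      have "y \<in> F U" using that U(2) unfolding W_def by blast
      then show ?thesis using U(1) unfolding W_def by blast
    qed
    then show "\<exists>U\<in>\<U>. \<forall>A\<in>W ` topspace X. x \<in> A \<longrightarrow> A \<subseteq> U" using U(1) by blast
  qed
qed

text \<open>The function \<open>c\<close> assigns to each point one member of a shrunk cover of
  bounded order. Near \<open>x\<close> only members containing \<open>x\<close> are used, hence at
  most \<open>Suc n\<close> of them. A barycentric refinement is needed since all pieces seen near
  \<open>x\<close> must fit into a single \<open>U\<close>.\<close>

lemma covering_dim_fine_partitions:
  assumes X: "compact_space X" "Hausdorff_space X" and dim: "covering_dim_le X (int n)"
  shows "fine_partitions X n"
  unfolding fine_partitions_def
proof (intro allI impI)
  fix K \<U> assume *: "compactin X K \<and> (\<forall>U\<in>\<U>. openin X U) \<and> topspace X \<subseteq> \<Union>\<U>"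
  then obtain \<W> where W: "\<And>W. W \<in> \<W> \<Longrightarrow> openin X W" "topspace X \<subseteq> \<Union>\<W>"
    "\<And>x. x \<in> topspace X \<Longrightarrow> \<exists>U\<in>\<U>. \<forall>W\<in>\<W>. x \<in> W \<longrightarrow> W \<subseteq> U"
    using barycentric_refinement[OF X, of \<U>] by metis
  have "(\<forall>U\<in>\<W>. openin X U) \<and> topspace X \<subseteq> \<Union>\<W>" using W by blast
  then obtain \<V> where V: "\<forall>V\<in>\<V>. openin X V" "topspace X \<subseteq> \<Union>\<V>" "\<forall>V\<in>\<V>. \<exists>U\<in>\<W>. V \<subseteq> U"
    "\<forall>x\<in>topspace X. finite {V\<in>\<V>. x \<in> V} \<and> int (card {V\<in>\<V>. x \<in> V}) \<le> int n + 1"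
    using dim[unfolded covering_dim_le_def, rule_format, of \<W>] by blast
  obtain F where F: "\<And>V. closedin X (F V)" "\<And>V. F V \<subseteq> V" "finite {V. F V \<noteq> {}}"
    "\<And>x. x \<in> topspace X \<Longrightarrow> \<exists>V\<in>\<V>. x \<in> F V"
    using closed_shrinking[OF X, of \<V>] V(1,2) by metis
  define c where "c = (\<lambda>x. SOME V. V \<in> \<V> \<and> x \<in> F V)"
  have c: "c x \<in> \<V>" "x \<in> F (c x)" if "x \<in> topspace X" for x
    using someI_ex[of "\<lambda>V. V \<in> \<V> \<and> x \<in> F V"] F(4)[OF that] unfolding c_def by blast+
  obtain enum :: "'a set \<Rightarrow> nat" where enum: "inj_on enum {V. F V \<noteq> {}}"
    using finite_imp_inj_to_nat_seg[OF F(3)] by blast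
  have eq: "c y = c z" if "enum (c y) = enum (c z)" "y \<in> topspace X" "z \<in> topspace X" for y z
    using inj_onD[OF enum that(1)] c that(2,3) by blast
  have "c ` topspace X \<subseteq> {V. F V \<noteq> {}}" using c by blast
  then have fin: "finite ((enum \<circ> c) ` topspace X)"
    using F(3) by (metis finite_imageI finite_subset image_comp)
  have loc: "\<exists>B. openin X B \<and> x \<in> B \<and> B \<subseteq> topspace X \<and> card ((enum \<circ> c) ` B) \<le> Suc n \<and>
           (\<exists>U\<in>\<U>. \<forall>y\<in>B. \<forall>z\<in>topspace X. (enum \<circ> c) z = (enum \<circ> c) y \<longrightarrow> z \<in> U)" if x: "x \<in> topspace X" for x
  proof -
    define B where "B = topspace X - \<Union>{F V |V. x \<notin> F V}"
    have xc: "x \<in> F (c y)" if "y \<in> B" for y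
      using that c(2)[of y] by (auto simp: B_def)
    have Vx: "finite {V\<in>\<V>. x \<in> V}" "card {V\<in>\<V>. x \<in> V} \<le> Suc n" using V(4) x by auto
    have sub: "(enum \<circ> c) ` B \<subseteq> enum ` {V\<in>\<V>. x \<in> V}"
      using xc F(2) c(1) by (fastforce simp: B_def)
    have "card ((enum \<circ> c) ` B) \<le> Suc n"
      using card_mono[OF finite_imageI[OF Vx(1)] sub] card_image_le[OF Vx(1), of enum] Vx(2) by linarith
    moreover obtain U where U: "U \<in> \<U>" "\<And>W. W \<in> \<W> \<Longrightarrow> x \<in> W \<Longrightarrow> W \<subseteq> U"
      using W(3)[OF x] by blast
    moreover have "z \<in> U" if "y \<in> B" "z \<in> topspace X" "enum (c z) = enum (c y)" for y z
    proof -
      have "c z = c y" using eq that by (simp add: B_def)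
      then have "z \<in> F (c y)" using c(2)[OF that(2)] by simp
      then have "z \<in> c y" "x \<in> c y" "c y \<in> \<V>"
        using F(2) xc[OF that(1)] c(1)[of y] that(1) by (auto simp: B_def)
      then obtain A where "A \<in> \<W>" "c y \<subseteq> A" using V(3) by blast
      then show ?thesis using U(2) \<open>z \<in> c y\<close> \<open>x \<in> c y\<close> by blast
    qed
    moreover have "openin X B" unfolding B_def by (rule openin_avoiding[OF F(1,3)])
    moreover have "x \<in> B" using x by (auto simp: B_def)
    moreover have "B \<subseteq> topspace X" by (auto simp: B_def)
    ultimately show ?thesis by (intro exI[of _ B] conjI bexI[of _ U]) simp_all
  qed
  have "K \<subseteq> topspace X" using * compactin_subset_topspace by blast
  then show "\<exists>N (v :: 'a \<Rightarrow> nat). openin X N \<and> K \<subseteq> N \<and> finite (v ` N) \<and>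
        (\<forall>x\<in>N. \<exists>B. openin X B \<and> x \<in> B \<and> B \<subseteq> N \<and> card (v ` B) \<le> Suc n \<and>
           (\<exists>U\<in>\<U>. \<forall>y\<in>B. \<forall>z\<in>N. v z = v y \<longrightarrow> z \<in> U))"
    using fin loc openin_topspace by (intro exI[of _ "topspace X"] exI[of _ "enum \<circ> c"]) blast
qed

section \<open>Consequences of a bound on the covering dimension\<close>

lemma covering_dim_negative:
  assumes "covering_dim_le X m" "m < 0"
  shows "topspace X = {}"
proof -
  have "(\<forall>U\<in>{topspace X}. openin X U) \<and> topspace X \<subseteq> \<Union>{topspace X}" by auto
  from mp[OF spec[OF assms(1)[unfolded covering_dim_le_def]] this]
  obtain \<V> where "topspace X \<subseteq> \<Union>\<V>"
    "\<forall>x\<in>topspace X. finite {V\<in>\<V>. x \<in> V} \<and> int (card {V\<in>\<V>. x \<in> V}) \<le> m + 1"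
    by (elim exE conjE)
  moreover have "card {V\<in>\<V>. x \<in> V} \<noteq> 0" if "x \<in> \<Union>\<V>" "finite {V\<in>\<V>. x \<in> V}" for x
    using that by auto
  ultimately have False if "x \<in> topspace X" for x
    using that assms(2) by (meson linorder_not_less of_nat_0_less_iff add1_zle_eq neq0_conv order_trans subsetD)
  then show ?thesis by blast
qed

text \<open>Needed since the dimension of the image of \<open>S\<close> is what is given, while a
  pseudo-cycle asks for that of the smaller omega limit set.\<close>

lemma covering_dim_closed:
  assumes "covering_dim_le X m" "closedin X S"
  shows "covering_dim_le (subtopology X S) m"
  unfolding covering_dim_le_def
proof (intro allI impI)
  fix \<U> assume \<U>: "(\<forall>U\<in>\<U>. openin (subtopology X S) U) \<and> topspace (subtopology X S) \<subseteq> \<Union>\<U>"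
  define \<U>' where "\<U>' = insert (topspace X - S) {U. openin X U \<and> U \<inter> S \<in> \<U>}"
  have "topspace X \<subseteq> \<Union>\<U>'"
  proof
    fix x assume x: "x \<in> topspace X"
    show "x \<in> \<Union>\<U>'"
    proof (cases "x \<in> S")
      case True
      then obtain U where "U \<in> \<U>" "x \<in> U" using \<U> x by auto
      moreover from this obtain T where "openin X T" "U = T \<inter> S" using \<U> by (auto simp: openin_subtopology)
      ultimately show ?thesis unfolding \<U>'_def by blast
    qed (use x in \<open>auto simp: \<U>'_def\<close>)
  qed
  moreover have "\<forall>U\<in>\<U>'. openin X U" using assms(2) by (auto simp: \<U>'_def)
  ultimately obtain \<V> where V: "\<forall>V\<in>\<V>. openin X V" "topspace X \<subseteq> \<Union>\<V>" "\<forall>V\<in>\<V>. \<exists>U\<in>\<U>'. V \<subseteq> U"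
    "\<forall>x\<in>topspace X. finite {V\<in>\<V>. x \<in> V} \<and> int (card {V\<in>\<V>. x \<in> V}) \<le> m + 1"
    using assms(1)[unfolded covering_dim_le_def, rule_format, of \<U>'] by blast
  \<comment> \<open>Members missing \<open>S\<close> are discarded: they may refine the added set
    \<open>topspace X - S\<close> and nothing in the original cover.\<close>
  define \<V>' where "\<V>' = (\<lambda>V. V \<inter> S) ` {V \<in> \<V>. V \<inter> S \<noteq> {}}"
  show "\<exists>\<V>. (\<forall>V\<in>\<V>. openin (subtopology X S) V) \<and> topspace (subtopology X S) \<subseteq> \<Union>\<V> \<and>
      (\<forall>V\<in>\<V>. \<exists>U\<in>\<U>. V \<subseteq> U) \<and>
      (\<forall>x\<in>topspace (subtopology X S). finite {V\<in>\<V>. x \<in> V} \<and> int (card {V\<in>\<V>. x \<in> V}) \<le> m + 1)"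
  proof (intro exI[of _ \<V>'] conjI ballI)
    show "openin (subtopology X S) V" if "V \<in> \<V>'" for V
      using that V(1) by (auto simp: \<V>'_def openin_subtopology)
    show "topspace (subtopology X S) \<subseteq> \<Union>\<V>'" using V(2) by (auto simp: \<V>'_def)
    fix V assume "V \<in> \<V>'"
    then obtain A where A: "A \<in> \<V>" "A \<inter> S \<noteq> {}" "V = A \<inter> S" by (auto simp: \<V>'_def)
    then obtain U where "U \<in> \<U>'" "A \<subseteq> U" using V(3) by blast
    then have "U \<inter> S \<in> \<U>" using A(2) by (auto simp: \<U>'_def)
    then show "\<exists>U\<in>\<U>. V \<subseteq> U" using A(3) \<open>A \<subseteq> U\<close> by (intro bexI[of _ "U \<inter> S"]) auto
  next
    fix x assume "x \<in> topspace (subtopology X S)"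
    then have fin: "finite {V\<in>\<V>. x \<in> V}" "int (card {V\<in>\<V>. x \<in> V}) \<le> m + 1" using V(4) by auto
    have sub: "{V \<in> \<V>'. x \<in> V} \<subseteq> (\<lambda>V. V \<inter> S) ` {V\<in>\<V>. x \<in> V}" by (auto simp: \<V>'_def)
    then show "finite {V \<in> \<V>'. x \<in> V}" using fin(1) by (meson finite_imageI finite_subset)
    have "card {V \<in> \<V>'. x \<in> V} \<le> card {V\<in>\<V>. x \<in> V}"
      using card_mono[OF finite_imageI[OF fin(1)] sub] card_image_le[OF fin(1)] le_trans by blast
    then show "int (card {V \<in> \<V>'. x \<in> V}) \<le> m + 1" using fin(2) by linarith
  qed
qed

text \<open>Homology in degree \<open>q\<close> is governed by cohomology in the degrees
  \<open>q\<close> and \<open>Suc q\<close>, both above the dimension. The case of negative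
  \<open>m\<close>, which includes \<open>q = 0\<close>, concerns the empty space.\<close>

lemma covering_dim_acyclic:
  assumes X: "compact_space X" "Hausdorff_space X" and dim: "covering_dim_le X m" and q: "int q > m"
  shows "infinite_cycles X q \<subseteq> infinite_boundaries X q"
proof
  fix c assume c: "c \<in> infinite_cycles X q"
  show "c \<in> infinite_boundaries X q"
  proof (cases "m < 0")
    case True
    then have "topspace X = {}" using covering_dim_negative dim by blast
    then have "c \<phi> = 0" if "\<phi> \<in> compact_cochains X q" for \<phi>
      using chain_zero[OF infinite_cyclesD[OF c] that] cochain_support_subset[of X \<phi>] by simp
    then show ?thesis
      by (intro boundaryI[OF infinite_cyclesD[OF c], of "\<lambda>_. 0"]) (auto simp: additive_on_def)
  next
    case False
    then obtain n where n: "m = int n" "n < q" using q by (metis nat_0_le not_less of_nat_less_iff)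
    then obtain p where p: "q = Suc p" "n \<le> p" by (metis Suc_leI Suc_le_D Suc_le_mono)
    have "locally_compact_space X" using X compact_imp_locally_compact_space by blast
    then have ac: "acyclic_cochains X r" if "n \<le> r" for r
      using fine_partitions_acyclic[OF X(2) _ _ that] covering_dim_fine_partitions[OF X] dim n(1) by blast
    show ?thesis
    proof (rule boundary_if_zero_on_cocycles[OF infinite_cyclesD[OF c]])
      show "acyclic_cochains X q" using ac n(2) by simp
      fix \<phi> assume \<phi>: "\<phi> \<in> compact_cochains X q" "cochain_support X (coboundary X \<phi>) = {}"
      then obtain \<psi> where "\<psi> \<in> compact_cochains X p" "cochain_support X (\<phi> - coboundary X \<psi>) = {}"
        using ac[OF p(2)] unfolding acyclic_cochains_def p(1) by blast
      then show "c \<phi> = 0"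
        using chain_cong[OF infinite_cyclesD[OF c] \<phi>(1), of "coboundary X \<psi>"] cycle_coboundary[of c X p \<psi>]
          coboundary_compact[of \<psi> X p] c p(1) by simp
    qed
  qed
qed

subsection \<open>Decomposition of cocycles\<close>

text \<open>Cocycles of the quotient complex: the coboundary has to be locally zero only.\<close>

definition cocycles_in :: "'a topology \<Rightarrow> 'a set \<Rightarrow> nat \<Rightarrow> 'a cochain set" where
  "cocycles_in X U q = {\<phi> \<in> cochains_in X U q. cochain_support X (coboundary X \<phi>) = {}}"

lemma subgrp_cocycles_in: "subgrp (cocycles_in X U q)"
  unfolding subgrp_def
proof (intro conjI ballI)
  show "0 \<in> cocycles_in X U q" using subgrp_0[OF subgrp_cochains_in] by (simp add: cocycles_in_def)
  fix \<phi> \<psi> assume "\<phi> \<in> cocycles_in X U q" "\<psi> \<in> cocycles_in X U q"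
  then show "\<phi> - \<psi> \<in> cocycles_in X U q"
    using subgrp_diff[OF subgrp_cochains_in, of \<phi> X U q \<psi>] cochain_support_diff[of X "coboundary X \<phi>" "coboundary X \<psi>"]
    by (simp add: cocycles_in_def coboundary_diff)
qed

lemma cocycles_in_mono: "U \<subseteq> V \<Longrightarrow> cocycles_in X U q \<subseteq> cocycles_in X V q"
  using cochains_in_mono[of U V X q] by (auto simp: cocycles_in_def)

lemma cocycles_in_cochains: "\<phi> \<in> cocycles_in X U q \<Longrightarrow> \<phi> \<in> cochains_in X U q"
  by (simp add: cocycles_in_def)

lemma coboundary_cocycle: "\<psi> \<in> cochains_in X U q \<Longrightarrow> coboundary X \<psi> \<in> cocycles_in X U (Suc q)"
  using coboundary_in by (simp add: cocycles_in_def coboundary_coboundary)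

lemma cochain_support_cong:
  assumes "cochain_support X (\<phi> - \<psi>) = {}"
  shows "cochain_support X \<phi> = cochain_support X \<psi>"
proof -
  have "cochain_support X (\<psi> - \<phi>) = {}"
    using assms cochain_support_uminus[of X "\<phi> - \<psi>"] by simp
  then show ?thesis
    using assms cochain_support_add[of X "\<phi> - \<psi>" \<psi>] cochain_support_add[of X "\<psi> - \<phi>" \<phi>] by simp
qed

lemma null_add:
  "cochain_support X \<phi> = {} \<Longrightarrow> cochain_support X \<psi> = {} \<Longrightarrow> cochain_support X (\<phi> + \<psi>) = {}"
  using cochain_support_add[of X \<phi> \<psi>] by simp

lemma null_diff:
  "cochain_support X \<phi> = {} \<Longrightarrow> cochain_support X \<psi> = {} \<Longrightarrow> cochain_support X (\<phi> - \<psi>) = {}"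
  using cochain_support_diff[of X \<phi> \<psi>] by simp

lemma null_coboundary: "cochain_support X \<phi> = {} \<Longrightarrow> cochain_support X (coboundary X \<phi>) = {}"
  using cochain_support_coboundary[of X \<phi>] by simp

lemma compact_subset_open:
  assumes X: "Hausdorff_space X" "locally_compact_space X" and U: "openin X U" and K: "compactin X K" "K \<subseteq> U"
  obtains P L where "openin X P" "closedin X L" "K \<subseteq> P" "P \<subseteq> L" "L \<subseteq> U"
proof -
  have "locally_compact_space (subtopology X U)" "Hausdorff_space (subtopology X U)"
    using locally_compact_space_open_subset X U Hausdorff_space_subtopology by blast+
  moreover have "compactin (subtopology X U) K" using K by (simp add: compactin_subtopology)
  ultimately obtain P L where *: "openin (subtopology X U) P" "compactin (subtopology X U) L" "K \<subseteq> P" "P \<subseteq> L"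
    using locally_compact_space_compact_closed_compact[of "subtopology X U"] by metis
  then have "openin X P" "compactin X L" "L \<subseteq> U"
    using openin_open_subtopology[OF U] by (auto simp: compactin_subtopology)
  then show thesis using that[of P L] * compactin_imp_closedin[OF X(1)] by blast
qed

text \<open>Decide by the first entry of a tuple. On the open set \<open>P\<close> around the part
  of the support outside \<open>V\<close> everything goes to the first summand; the closed set
  \<open>L \<subseteq> U\<close> around \<open>P\<close> controls the support of that
  summand.\<close>

lemma cochain_split:
  assumes X: "Hausdorff_space X" "locally_compact_space X" and UV: "openin X U" "openin X V"
    and \<phi>: "\<phi> \<in> cochains_in X (U \<union> V) q"
  obtains \<phi>1 \<phi>2 where "\<phi>1 \<in> cochains_in X U q" "\<phi>2 \<in> cochains_in X V q" "\<phi> = \<phi>1 + \<phi>2"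
proof -
  let ?K = "cochain_support X \<phi>"
  have K: "compactin X ?K" "?K \<subseteq> U \<union> V" and \<phi>c: "\<phi> \<in> cochains X q"
    using \<phi> by (auto simp: cochains_in_def compact_cochains_def)
  have KV: "?K \<inter> (topspace X - V) = ?K - V" using cochain_support_subset[of X \<phi>] by blast
  have "compactin X (?K \<inter> (topspace X - V))"
    using K(1) UV(2) by (intro compact_Int_closedin) auto
  then have "compactin X (?K - V)" unfolding KV .
  moreover have "?K - V \<subseteq> U" using K(2) by blast
  ultimately obtain P L where P: "openin X P" "closedin X L" "?K - V \<subseteq> P" "P \<subseteq> L" "L \<subseteq> U"
    using compact_subset_open[OF X UV(1)] by metis
  define \<phi>1 where "\<phi>1 = (\<lambda>xs. if hd xs \<in> P then \<phi> xs else 0)"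
  define \<phi>2 where "\<phi>2 = (\<lambda>xs. if hd xs \<in> P then 0 else \<phi> xs)"
  have nil: "\<phi> [] = 0" using cochainsD(2)[OF \<phi>c, of "[]"] by auto
  have mem: "\<psi> \<in> cochains_in X W q" if \<psi>: "\<And>xs. \<psi> xs = \<phi> xs \<or> \<psi> xs = 0"
    and W: "cochain_support X \<psi> \<inter> ?K \<subseteq> W" for \<psi> W
  proof -
    have "cochain_support X \<psi> \<subseteq> ?K" using \<psi> by (intro cochain_support_mono) metis
    moreover have "\<psi> \<in> cochains X q"
    proof (rule cochainsI)
      have "\<psi> ` {xs. length xs = Suc q} \<subseteq> insert 0 (range \<phi>)" using \<psi> by blast
      then show "finite (\<psi> ` {xs. length xs = Suc q})"
        using cochainsD(1)[OF \<phi>c] by (meson finite.insertI finite_subset)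
      show "length xs = Suc q \<and> set xs \<subseteq> topspace X" if "\<psi> xs \<noteq> 0" for xs
        using \<psi>[of xs] that cochainsD(2,3)[OF \<phi>c, of xs] by auto
    qed
    ultimately show ?thesis
      using closed_compactin[OF K(1) _ closedin_cochain_support] W
      by (auto simp: cochains_in_def compact_cochains_def)
  qed
  have "\<phi>1 \<in> cochains_in X U q"
  proof (rule mem)
    have "x \<notin> cochain_support X \<phi>1" if "x \<in> topspace X" "x \<notin> L" for x
    proof (rule not_in_supportI)
      show "openin X (topspace X - L)" "x \<in> topspace X - L" using P(2) that by auto
      show "\<phi>1 xs = 0" if "set xs \<subseteq> topspace X - L" for xs
        using that P(4) nil by (cases xs) (auto simp: \<phi>1_def)
    qed
    then show "cochain_support X \<phi>1 \<inter> ?K \<subseteq> U" using P(5) cochain_support_subset[of X \<phi>1] by blast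
  qed (auto simp: \<phi>1_def)
  moreover have "\<phi>2 \<in> cochains_in X V q"
  proof (rule mem)
    have "x \<notin> cochain_support X \<phi>2" if "x \<in> P" for x
    proof (rule not_in_supportI[OF P(1) that])
      show "\<phi>2 xs = 0" if "set xs \<subseteq> P" for xs
        using that nil by (cases xs) (auto simp: \<phi>2_def)
    qed
    then show "cochain_support X \<phi>2 \<inter> ?K \<subseteq> V" using P(3) by blast
  qed (auto simp: \<phi>2_def)
  moreover have "\<phi> = \<phi>1 + \<phi>2" by (auto simp: \<phi>1_def \<phi>2_def)
  ultimately show thesis using that by blast
qed

text \<open>Restrict to the subspace, find a primitive there and extend it by zero;
  \<open>extension_unique\<close> carries the equation back to \<open>X\<close>.\<close>

lemma cocycle_bounds_in:
  assumes X: "Hausdorff_space X" "locally_compact_space X" and W: "openin X W"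
    and ac: "acyclic_cochains (subtopology X W) p" and \<phi>: "\<phi> \<in> cocycles_in X W (Suc p)"
  obtains \<psi> where "\<psi> \<in> cochains_in X W p" "cochain_support X (\<phi> - coboundary X \<psi>) = {}"
proof -
  have ext: "extendable X W"
    using extendable[OF X(1) W] locally_compact_space_open_subset X W by blast
  have \<phi>in: "\<phi> \<in> cochains_in X W (Suc p)" using \<phi> by (rule cocycles_in_cochains)
  have "cochain_support (subtopology X W) (coboundary (subtopology X W) (restr X W \<phi>)) = {}"
    using restr_support[OF W, of "coboundary X \<phi>"] \<phi> by (simp add: cocycles_in_def restr_coboundary)
  then obtain \<psi>' where \<psi>': "\<psi>' \<in> compact_cochains (subtopology X W) p"
    "cochain_support (subtopology X W) (restr X W \<phi> - coboundary (subtopology X W) \<psi>') = {}"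
    using ac restr_compact[OF W \<phi>in] unfolding acyclic_cochains_def by blast
  then obtain \<psi> where \<psi>: "\<psi> \<in> cochains_in X W p" "cochain_support (subtopology X W) (restr X W \<psi> - \<psi>') = {}"
    using ext unfolding extendable_def by blast
  have "cochain_support (subtopology X W) (coboundary (subtopology X W) (restr X W \<psi> - \<psi>')) = {}"
    using null_coboundary[OF \<psi>(2)] .
  from null_diff[OF \<psi>'(2) this]
  have "cochain_support (subtopology X W) (restr X W \<phi> - restr X W (coboundary X \<psi>)) = {}"
    by (simp add: coboundary_diff restr_coboundary)
  then have "cochain_support X (\<phi> - coboundary X \<psi>) = {}"
    by (rule extension_unique[OF W \<phi>in coboundary_in[OF \<psi>(1)]])
  then show thesis using that \<psi>(1) by blast
qed

text \<open>Mayer-Vietoris: the obstruction to splitting a cocycle lives on intersections, one degree up.\<close>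

lemma cocycle_decomposition:
  assumes X: "Hausdorff_space X" "locally_compact_space X" and "finite \<W>"
    and "\<And>W. W \<in> \<W> \<Longrightarrow> openin X W"
    and "\<And>W W'. W \<in> \<W> \<Longrightarrow> openin X W' \<Longrightarrow> W' \<subseteq> W \<Longrightarrow> acyclic_cochains (subtopology X W') q"
    and "\<phi> \<in> cocycles_in X (\<Union>\<W>) q"
  shows "\<exists>F. (\<forall>W\<in>\<W>. F W \<in> cocycles_in X W q) \<and> cochain_support X (\<phi> - (\<Sum>W\<in>\<W>. F W)) = {}"
  using assms(3-)
proof (induction \<W> arbitrary: \<phi> rule: finite_induct)
  case empty
  then show ?case by (auto simp: cocycles_in_def cochains_in_def)
next
  case (insert U \<W>)
  let ?V = "\<Union>\<W>"
  have U: "openin X U" and V: "openin X ?V" using insert.prems(1) by auto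
  have \<phi>: "\<phi> \<in> cochains_in X (U \<union> ?V) q" "cochain_support X (coboundary X \<phi>) = {}"
    using insert.prems(3) by (auto simp: cocycles_in_def)
  obtain \<phi>1 \<phi>2 where \<phi>12: "\<phi>1 \<in> cochains_in X U q" "\<phi>2 \<in> cochains_in X ?V q" "\<phi> = \<phi>1 + \<phi>2"
    using cochain_split[OF X U V \<phi>(1)] by blast
  \<comment> \<open>Up to a locally zero cochain the coboundaries of the two parts are opposite, so
    their support lies in both open sets.\<close>
  have "coboundary X \<phi>1 - (- coboundary X \<phi>2) = coboundary X \<phi>" by (simp add: \<phi>12(3) coboundary_add)
  then have "cochain_support X (coboundary X \<phi>1) = cochain_support X (- coboundary X \<phi>2)"
    using cochain_support_cong \<phi>(2) by metis
  then have "cochain_support X (coboundary X \<phi>1) \<subseteq> ?V"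
    using coboundary_in[OF \<phi>12(2)] by (simp add: cochain_support_uminus cochains_in_def)
  then have "coboundary X \<phi>1 \<in> cocycles_in X (U \<inter> ?V) (Suc q)"
    using coboundary_in[OF \<phi>12(1)] by (simp add: cocycles_in_def cochains_in_def coboundary_coboundary)
  moreover have "acyclic_cochains (subtopology X (U \<inter> ?V)) q"
    using insert.prems(2)[of U "U \<inter> ?V"] openin_Int[OF U V] by simp
  \<comment> \<open>The primitive of the obstruction, supported on the intersection: subtracted from
    \<phi>1 and added to \<phi>2 it turns both parts into cocycles.\<close>
  ultimately obtain \<theta> where \<theta>: "\<theta> \<in> cochains_in X (U \<inter> ?V) q"
    "cochain_support X (coboundary X \<phi>1 - coboundary X \<theta>) = {}"
    using cocycle_bounds_in[OF X openin_Int[OF U V]] by metis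
  have \<theta>in: "\<theta> \<in> cochains_in X U q" "\<theta> \<in> cochains_in X ?V q"
    using \<theta>(1) cochains_in_mono[of "U \<inter> ?V"] by blast+
  have "coboundary X (\<phi>2 + \<theta>) = coboundary X \<phi> - (coboundary X \<phi>1 - coboundary X \<theta>)"
    by (simp add: \<phi>12(3) coboundary_add)
  then have "\<phi>2 + \<theta> \<in> cocycles_in X ?V q"
    using null_diff[OF \<phi>(2) \<theta>(2)] subgrp_add[OF subgrp_cochains_in \<phi>12(2) \<theta>in(2)]
    by (simp add: cocycles_in_def)
  then obtain F where F: "\<And>W. W \<in> \<W> \<Longrightarrow> F W \<in> cocycles_in X W q"
    "cochain_support X (\<phi>2 + \<theta> - (\<Sum>W\<in>\<W>. F W)) = {}"
    using insert.IH[of "\<phi>2 + \<theta>"] insert.prems(1,2) by blast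
  have F1: "\<phi>1 - \<theta> \<in> cocycles_in X U q"
    using \<theta>(2) subgrp_diff[OF subgrp_cochains_in \<phi>12(1) \<theta>in(1)] by (simp add: cocycles_in_def coboundary_diff)
  have sum: "(\<Sum>W\<in>\<W>. (F(U := \<phi>1 - \<theta>)) W) = (\<Sum>W\<in>\<W>. F W)"
    using insert.hyps(2) by (intro sum.cong) auto
  have "(\<Sum>W\<in>insert U \<W>. (F(U := \<phi>1 - \<theta>)) W) = (\<phi>1 - \<theta>) + (\<Sum>W\<in>\<W>. F W)"
    using sum.insert[OF insert.hyps, of "F(U := \<phi>1 - \<theta>)"] unfolding sum by simp
  then have "\<phi> - (\<Sum>W\<in>insert U \<W>. (F(U := \<phi>1 - \<theta>)) W) = \<phi>2 + \<theta> - (\<Sum>W\<in>\<W>. F W)"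
    by (simp add: \<phi>12(3))
  then have "cochain_support X (\<phi> - (\<Sum>W\<in>insert U \<W>. (F(U := \<phi>1 - \<theta>)) W)) = {}"
    using F(2) by (simp only:)
  moreover have "\<forall>W\<in>insert U \<W>. (F(U := \<phi>1 - \<theta>)) W \<in> cocycles_in X W q"
    using F(1) F1 by simp
  ultimately show ?case by blast
qed

text \<open>By compactness of the support finitely many members of the cover suffice.\<close>

lemma cocycle_decomposition_cover:
  assumes X: "Hausdorff_space X" "locally_compact_space X"
    and \<W>: "\<And>W. W \<in> \<W> \<Longrightarrow> openin X W"
    "\<And>W W'. W \<in> \<W> \<Longrightarrow> openin X W' \<Longrightarrow> W' \<subseteq> W \<Longrightarrow> acyclic_cochains (subtopology X W') q"
    and \<phi>: "\<phi> \<in> cocycles_in X (\<Union>\<W>) q"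
  obtains \<A> F where "finite \<A>" "\<A> \<subseteq> \<W>" "\<And>W. W \<in> \<A> \<Longrightarrow> F W \<in> cocycles_in X W q"
    "cochain_support X (\<phi> - (\<Sum>W\<in>\<A>. F W)) = {}"
proof -
  have "compactin X (cochain_support X \<phi>)" "cochain_support X \<phi> \<subseteq> \<Union>\<W>"
    using \<phi> by (auto simp: cocycles_in_def cochains_in_def compact_cochains_def)
  then obtain \<A> where A: "finite \<A>" "\<A> \<subseteq> \<W>" "cochain_support X \<phi> \<subseteq> \<Union>\<A>"
    using \<W>(1) unfolding compactin_def by meson
  have "\<phi> \<in> cocycles_in X (\<Union>\<A>) q" using \<phi> A(3) by (simp add: cocycles_in_def cochains_in_def)
  then obtain F where "\<forall>W\<in>\<A>. F W \<in> cocycles_in X W q" "cochain_support X (\<phi> - (\<Sum>W\<in>\<A>. F W)) = {}"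
    using cocycle_decomposition[OF X A(1), of q \<phi>] \<W> A(2) by blast
  then show thesis using that A(1,2) by blast
qed

text \<open>Universal coefficients on \<open>U\<close>: in the top degree a homology class is
  determined by its values on cocycles, so the unknown \<open>b\<close> of
  \<open>restriction_eq_iff\<close> can be eliminated.\<close>

lemma restriction_eq_on_cocycles:
  assumes U: "extendable X U" and ac: "acyclic_cochains (subtopology X U) q"
    and c: "c \<in> infinite_cycles X q" and m: "m \<in> infinite_chains (subtopology X U) q"
  shows "steenrod_restriction X U q (hclass X q c) = hclass (subtopology X U) q m \<longleftrightarrow>
    (\<forall>\<phi>\<in>cocycles_in X U q. c \<phi> = m (restr X U \<phi>))"
  unfolding restriction_eq_iff[OF U c m]
proof
  assume "\<exists>b. local_chain X U (Suc q) b \<and> (\<forall>\<phi>\<in>cochains_in X U q. c \<phi> = m (restr X U \<phi>) + b (coboundary X \<phi>))"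
  then show "\<forall>\<phi>\<in>cocycles_in X U q. c \<phi> = m (restr X U \<phi>)"
    using coboundary_in by (fastforce simp: cocycles_in_def local_chain_def)
next
  assume eq: "\<forall>\<phi>\<in>cocycles_in X U q. c \<phi> = m (restr X U \<phi>)"
  define a where "a = (\<lambda>\<phi>. c \<phi> - m (restr X U \<phi>))"
  have a: "local_chain X U q a"
    using chain_local_chain[OF infinite_cyclesD[OF c]] local_chain_restr[OF extendableD(1)[OF U] m]
    by (auto simp: local_chain_def additive_on_def a_def)
  have "chain_restriction X U q a \<in> infinite_boundaries (subtopology X U) q"
  proof (rule boundary_if_zero_on_cocycles[OF chain_restriction_chain[OF U a] ac])
    fix \<phi> assume \<phi>: "\<phi> \<in> compact_cochains (subtopology X U) q"
      and d\<phi>: "cochain_support (subtopology X U) (coboundary (subtopology X U) \<phi>) = {}"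
    let ?\<epsilon> = "cochain_extension X U q \<phi>"
    have \<epsilon>: "?\<epsilon> \<in> cochains_in X U q" "cochain_support (subtopology X U) (restr X U ?\<epsilon> - \<phi>) = {}"
      using extendableD(2)[OF U \<phi>] by auto
    have "cochain_support (subtopology X U) (restr X U (coboundary X ?\<epsilon>)) = {}"
      using null_add[OF null_coboundary[OF \<epsilon>(2)] d\<phi>] by (simp add: restr_coboundary coboundary_diff)
    then have "cochain_support X (coboundary X ?\<epsilon>) = {}"
      using restr_support[OF extendableD(1)[OF U]] coboundary_in[OF \<epsilon>(1)] by (auto simp: cochains_in_def)
    then have "a ?\<epsilon> = 0" using eq \<epsilon>(1) by (simp add: cocycles_in_def a_def)
    then show "chain_restriction X U q a \<phi> = 0" using \<phi> by (simp add: chain_restriction_def)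
  qed
  then show "\<exists>b. local_chain X U (Suc q) b \<and> (\<forall>\<phi>\<in>cochains_in X U q. c \<phi> = m (restr X U \<phi>) + b (coboundary X \<phi>))"
    unfolding restriction_boundaries_iff[OF U a] by (simp add: a_def algebra_simps)
qed

subsection \<open>Fundamental classes\<close>

text \<open>Zero in the compactly supported cohomology of \<open>U\<close>, up to locally zero
  cochains. Degree \<open>0\<close> needs its own clause because it contains no
  coboundaries.\<close>

definition bounding :: "'a topology \<Rightarrow> 'a set \<Rightarrow> nat \<Rightarrow> 'a cochain \<Rightarrow> bool" where
  "bounding X U q \<phi> \<longleftrightarrow> (case q of 0 \<Rightarrow> cochain_support X \<phi> = {}
     | Suc p \<Rightarrow> \<exists>\<psi>\<in>cochains_in X U p. cochain_support X (\<phi> - coboundary X \<psi>) = {})"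

lemma bounding_cong:
  assumes "bounding X U q \<phi>" "cochain_support X (\<psi> - \<phi>) = {}"
  shows "bounding X U q \<psi>"
proof (cases q)
  case 0
  then show ?thesis using assms cochain_support_cong[OF assms(2)] by (simp add: bounding_def)
next
  case (Suc p)
  then obtain \<theta> where "\<theta> \<in> cochains_in X U p" "cochain_support X (\<phi> - coboundary X \<theta>) = {}"
    using assms(1) by (auto simp: bounding_def)
  then show ?thesis using null_add[OF assms(2)] Suc by (fastforce simp: bounding_def)
qed

text \<open>Split the primitive, not the cochain. The locally zero error is put into the second
  summand.\<close>

lemma bounding_split:
  assumes X: "Hausdorff_space X" "locally_compact_space X" and UV: "openin X U" "openin X V"
    and \<phi>: "\<phi> \<in> cochains X q" "bounding X (U \<union> V) q \<phi>"
  obtains \<phi>1 \<phi>2 where "\<phi>1 \<in> cocycles_in X U q" "bounding X U q \<phi>1" "\<phi>2 \<in> cochains_in X V q" "bounding X V q \<phi>2"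
    "\<phi> = \<phi>1 + \<phi>2"
proof (cases q)
  case 0
  then have "cochain_support X \<phi> = {}" using \<phi>(2) by (simp add: bounding_def)
  then have "\<phi> \<in> cochains_in X V q" using \<phi>(1) by (simp add: cochains_in_def compact_cochains_def)
  then show thesis
    using that[of 0 \<phi>] subgrp_0[OF subgrp_cocycles_in, of X U 0] 0 \<open>cochain_support X \<phi> = {}\<close>
    by (simp add: bounding_def)
next
  case (Suc p)
  then obtain \<psi> where \<psi>: "\<psi> \<in> cochains_in X (U \<union> V) p" "cochain_support X (\<phi> - coboundary X \<psi>) = {}"
    using \<phi>(2) by (auto simp: bounding_def)
  obtain \<psi>1 \<psi>2 where \<psi>12: "\<psi>1 \<in> cochains_in X U p" "\<psi>2 \<in> cochains_in X V p" "\<psi> = \<psi>1 + \<psi>2"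
    using cochain_split[OF X UV \<psi>(1)] by blast
  have eq: "cochain_support X (\<phi> - coboundary X \<psi>1 - coboundary X \<psi>2) = {}"
    using \<psi>(2) by (simp add: \<psi>12(3) coboundary_add algebra_simps)
  have "\<phi> - coboundary X \<psi>1 \<in> cochains X q"
    using \<phi>(1) coboundary_in[OF \<psi>12(1)] subgrp_diff[OF subgrp_cochains, of \<phi> X "Suc p" "coboundary X \<psi>1"]
    by (simp add: cochains_in_def compact_cochains_def Suc)
  then have "\<phi> - coboundary X \<psi>1 \<in> cochains_in X V q"
    using compact_cochains_cong[OF _ _ eq] coboundary_in[OF \<psi>12(2)] by (auto simp: cochains_in_def Suc)
  moreover have "bounding X V q (\<phi> - coboundary X \<psi>1)"
    using eq \<psi>12(2) by (auto simp: bounding_def Suc)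
  moreover have "bounding X U q (coboundary X \<psi>1)"
    using \<psi>12(1) unfolding bounding_def Suc by (auto intro!: bexI[of _ \<psi>1])
  ultimately show thesis
    using that[of "coboundary X \<psi>1" "\<phi> - coboundary X \<psi>1"] coboundary_cocycle[OF \<psi>12(1)] by (simp add: Suc)
qed

text \<open>Local compactness makes all open subsets \<open>extendable\<close>; here it comes from
  the compactification, in which \<open>M\<close> is open.\<close>

locale oriented_manifold =
  fixes d :: nat and M :: "'a topology" and ori :: "'a set \<Rightarrow> 'a infinite_chain set"
  assumes manifold: "topological_manifold d M" and orientation: "orientation d M ori"
    and loc_compact: "locally_compact_space M"
begin

lemma Hausdorff: "Hausdorff_space M"
  using manifold by (simp add: topological_manifold_def)

lemma extendable_open: "openin M U \<Longrightarrow> extendable M U"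
  using extendable Hausdorff locally_compact_space_open_subset loc_compact by blast

lemma euclidean_acyclic:
  assumes "euclidean_open d M U" "openin M W" "W \<subseteq> U" "d \<le> p"
  shows "acyclic_cochains (subtopology M W) p"
proof (rule fine_partitions_acyclic[OF _ _ euclidean_open_fine_partitions[OF assms(1-3)] assms(4)])
  show "Hausdorff_space (subtopology M W)" using Hausdorff Hausdorff_space_subtopology by blast
  show "locally_compact_space (subtopology M W)"
    using locally_compact_space_open_subset Hausdorff loc_compact assms(2) by blast
qed

lemma euclidean_openin: "euclidean_open d M U \<Longrightarrow> openin M U"
  by (simp add: euclidean_open_def)

lemma euclidean_cover: "topspace M = \<Union>(Collect (euclidean_open d M))"
  using manifold openin_subset by (fastforce simp: topological_manifold_def euclidean_open_def)

lemma euclidean_decomposition: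
  assumes "d \<le> q" "\<phi> \<in> compact_cochains M q" "cochain_support M (coboundary M \<phi>) = {}"
  obtains \<A> F where "finite \<A>" "\<And>W. W \<in> \<A> \<Longrightarrow> euclidean_open d M W" "\<And>W. W \<in> \<A> \<Longrightarrow> F W \<in> cocycles_in M W q"
    "cochain_support M (\<phi> - (\<Sum>W\<in>\<A>. F W)) = {}"
proof -
  have "\<phi> \<in> cocycles_in M (\<Union>(Collect (euclidean_open d M))) q"
    using assms(2,3) unfolding euclidean_cover[symmetric] by (simp add: cocycles_in_def cochains_in_topspace)
  then obtain \<A> F where "finite \<A>" "\<A> \<subseteq> Collect (euclidean_open d M)" "\<And>W. W \<in> \<A> \<Longrightarrow> F W \<in> cocycles_in M W q"
    "cochain_support M (\<phi> - (\<Sum>W\<in>\<A>. F W)) = {}"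
    using cocycle_decomposition_cover[OF Hausdorff loc_compact, of "Collect (euclidean_open d M)" q \<phi>]
      euclidean_openin euclidean_acyclic assms(1) by (metis mem_Collect_eq)
  then show thesis using that by blast
qed

text \<open>A cocycle above degree \<open>d\<close> is a sum of cocycles in charts, and each of
  these bounds within its chart.\<close>

lemma acyclic:
  assumes "d \<le> p"
  shows "acyclic_cochains M p"
  unfolding acyclic_cochains_def
proof (intro ballI impI)
  fix \<phi> assume "\<phi> \<in> compact_cochains M (Suc p)" "cochain_support M (coboundary M \<phi>) = {}"
  then obtain \<A> F where A: "finite \<A>" "\<And>W. W \<in> \<A> \<Longrightarrow> euclidean_open d M W"
    "\<And>W. W \<in> \<A> \<Longrightarrow> F W \<in> cocycles_in M W (Suc p)" "cochain_support M (\<phi> - (\<Sum>W\<in>\<A>. F W)) = {}"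
    using euclidean_decomposition[of "Suc p" \<phi>] assms by (metis le_SucI)
  have "\<exists>\<psi>. \<psi> \<in> cochains_in M W p \<and> cochain_support M (F W - coboundary M \<psi>) = {}" if "W \<in> \<A>" for W
    using cocycle_bounds_in[OF Hausdorff loc_compact euclidean_openin[OF A(2)[OF that]]
        euclidean_acyclic[OF A(2)[OF that] euclidean_openin[OF A(2)[OF that]] order_refl assms] A(3)[OF that]]
    by metis
  then obtain \<psi> where \<psi>: "\<And>W. W \<in> \<A> \<Longrightarrow> \<psi> W \<in> cochains_in M W p"
    "\<And>W. W \<in> \<A> \<Longrightarrow> cochain_support M (F W - coboundary M (\<psi> W)) = {}" by metis
  have "cochain_support M (\<Sum>W\<in>\<A>. F W - coboundary M (\<psi> W)) = {}"
    using cochain_support_sum[of M "\<lambda>W. F W - coboundary M (\<psi> W)" \<A>] \<psi>(2) by blast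
  from null_add[OF A(4) this] have "cochain_support M (\<phi> - coboundary M (sum \<psi> \<A>)) = {}"
    by (simp add: coboundary_sum sum_subtractf)
  moreover have "sum \<psi> \<A> \<in> compact_cochains M p"
    using \<psi>(1) cochains_in_subset by (intro subgrp_sum[OF subgrp_compact_cochains]) blast
  ultimately show "\<exists>\<psi>\<in>compact_cochains M p. cochain_support M (\<phi> - coboundary M \<psi>) = {}" by blast
qed

section \<open>Evaluation of top-degree cocycles by local orientations\<close>

definition orient_cycle :: "'a set \<Rightarrow> 'a infinite_chain" where
  "orient_cycle U = (SOME c. c \<in> infinite_cycles (subtopology M U) d \<and> ori U = hclass (subtopology M U) d c)"

text \<open>The local orientation as a functional. On cocycles supported in \<open>U\<close> its
  value depends only on the class \<open>ori U\<close>, not on the chosen cycle.\<close>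

definition orient :: "'a set \<Rightarrow> 'a cochain \<Rightarrow> int" where
  "orient U \<phi> = orient_cycle U (restr M U \<phi>)"

lemma orient_cycle:
  assumes "euclidean_open d M U"
  shows "orient_cycle U \<in> infinite_cycles (subtopology M U) d" "ori U = hclass (subtopology M U) d (orient_cycle U)"
proof -
  have "ori U \<in> carrier (steenrod_homology (subtopology M U) d)"
    using orientation assms by (simp add: orientation_def)
  then have "\<exists>c. c \<in> infinite_cycles (subtopology M U) d \<and> ori U = hclass (subtopology M U) d c"
    by (meson steenrod_homologyE)
  from someI_ex[OF this] show "orient_cycle U \<in> infinite_cycles (subtopology M U) d"
    "ori U = hclass (subtopology M U) d (orient_cycle U)" unfolding orient_cycle_def by blast+
qed

lemma orient_local_chain: "euclidean_open d M U \<Longrightarrow> local_chain M U d (orient U)"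
  unfolding orient_def[abs_def]
  by (rule local_chain_restr[OF euclidean_openin infinite_cyclesD[OF orient_cycle(1)]])

lemma orient_bounding:
  assumes U: "euclidean_open d M U" and \<phi>: "\<phi> \<in> cochains_in M U d" "bounding M U d \<phi>"
  shows "orient U \<phi> = 0"
proof (cases d)
  case 0
  then show ?thesis
    using \<phi> orient_local_chain[OF U] by (simp add: bounding_def local_chain_def)
next
  case (Suc p)
  then obtain \<psi> where \<psi>: "\<psi> \<in> cochains_in M U p" "cochain_support M (\<phi> - coboundary M \<psi>) = {}"
    using \<phi>(2) by (auto simp: bounding_def)
  then have "orient U \<phi> = orient U (coboundary M \<psi>)"
    using local_chain_cong[OF orient_local_chain[OF U] \<phi>(1), of "coboundary M \<psi>"] coboundary_in[OF \<psi>(1)] Suc by simp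
  also have "\<dots> = 0"
  proof -
    have "orient_cycle U \<in> infinite_cycles (subtopology M U) (Suc p)"
      using orient_cycle(1)[OF U] by (simp only: Suc)
    from cycle_coboundary[OF this restr_compact[OF euclidean_openin[OF U] \<psi>(1)]]
    show ?thesis unfolding orient_def restr_coboundary .
  qed
  finally show ?thesis .
qed

lemma restriction_eq_ori_iff:
  assumes "euclidean_open d M U" "c \<in> infinite_cycles M d"
  shows "steenrod_restriction M U d (hclass M d c) = ori U \<longleftrightarrow> (\<forall>\<phi>\<in>cocycles_in M U d. c \<phi> = orient U \<phi>)"
  unfolding orient_cycle(2)[OF assms(1)] orient_def
  using euclidean_openin[OF assms(1)]
  by (intro restriction_eq_on_cocycles[OF extendable_open euclidean_acyclic[OF assms(1)] assms(2)
        infinite_cyclesD[OF orient_cycle(1)[OF assms(1)]]]) auto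

text \<open>Coherence of the orientation, expressed by values on cocycles: the form in which
  overlapping charts are compared.\<close>

lemma orient_mono:
  assumes U: "euclidean_open d M U" and V: "euclidean_open d M V" and VU: "V \<subseteq> U" and \<phi>: "\<phi> \<in> cocycles_in M V d"
  shows "orient U \<phi> = orient V \<phi>"
proof -
  let ?MU = "subtopology M U"
  have sub: "subtopology ?MU V = subtopology M V" using VU by (simp add: subtopology_subtopology inf.absorb2)
  have V': "openin ?MU V"
    using euclidean_openin[OF U] euclidean_openin[OF V] VU openin_open_subtopology by blast
  have "locally_compact_space (subtopology M V)"
    using locally_compact_space_open_subset Hausdorff loc_compact euclidean_openin[OF V] by blast
  then have ext: "extendable ?MU V"
    using extendable[OF _ V'] Hausdorff Hausdorff_space_subtopology sub by metis
  have "steenrod_restriction ?MU V d (hclass ?MU d (orient_cycle U)) = hclass (subtopology ?MU V) d (orient_cycle V)"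
    using orientation U V VU orient_cycle(2)[OF U] orient_cycle(2)[OF V] unfolding orientation_def sub by metis
  moreover have "acyclic_cochains (subtopology ?MU V) d"
    unfolding sub by (rule euclidean_acyclic[OF V euclidean_openin[OF V]]) auto
  moreover have "orient_cycle V \<in> infinite_chains (subtopology ?MU V) d"
    unfolding sub using orient_cycle(1)[OF V] infinite_cyclesD by blast
  ultimately have eq: "\<And>\<psi>. \<psi> \<in> cocycles_in ?MU V d \<Longrightarrow> orient_cycle U \<psi> = orient_cycle V (restr ?MU V \<psi>)"
    using restriction_eq_on_cocycles[OF ext _ orient_cycle(1)[OF U]] by blast
  have \<phi>U: "\<phi> \<in> cochains_in M U d" using \<phi> cocycles_in_mono[OF VU] cocycles_in_cochains by blast
  have "restr M U \<phi> \<in> cocycles_in ?MU V d"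
    using restr_compact[OF euclidean_openin[OF U] \<phi>U] restr_support[OF euclidean_openin[OF U], of \<phi>]
      restr_support[OF euclidean_openin[OF U], of "coboundary M \<phi>"] \<phi>
    by (auto simp: cocycles_in_def cochains_in_def restr_coboundary)
  moreover have "restr ?MU V (restr M U \<phi>) = restr M V \<phi>"
    using VU by (auto simp: restr_apply fun_eq_iff)
  ultimately show ?thesis using eq by (simp add: orient_def)
qed

lemma orient_diff:
  "euclidean_open d M U \<Longrightarrow> \<phi> \<in> cocycles_in M U d \<Longrightarrow> \<psi> \<in> cocycles_in M U d \<Longrightarrow>
    orient U (\<phi> - \<psi>) = orient U \<phi> - orient U \<psi>"
  using local_chain_diff orient_local_chain cocycles_in_cochains by blast

lemma orient_0: "euclidean_open d M U \<Longrightarrow> orient U 0 = 0"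
  using orient_diff[of U 0 0] subgrp_0[OF subgrp_cocycles_in, of M U d] by simp

lemma orient_sum:
  assumes "euclidean_open d M U" "\<And>i. i \<in> I \<Longrightarrow> \<phi> i \<in> cocycles_in M U d"
  shows "orient U (sum \<phi> I) = (\<Sum>i\<in>I. orient U (\<phi> i))"
  using assms(2)
proof (induction I rule: infinite_finite_induct)
  case (insert i I)
  have "\<phi> j \<in> cochains_in M U d" if "j \<in> insert i I" for j
    using cocycles_in_cochains[OF insert.prems[OF that]] .
  then have "sum \<phi> I \<in> cochains_in M U d" "\<phi> i \<in> cochains_in M U d"
    by (auto intro!: subgrp_sum[OF subgrp_cochains_in])
  then have "orient U (\<phi> i + sum \<phi> I) = orient U (\<phi> i) + orient U (sum \<phi> I)"
    using orient_local_chain[OF assms(1)] unfolding local_chain_def additive_on_def by blast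
  moreover have "orient U (sum \<phi> I) = (\<Sum>i\<in>I. orient U (\<phi> i))"
    using insert.IH insert.prems by blast
  ultimately show ?case unfolding sum.insert[OF insert.hyps] by (simp only:)
qed (use orient_0[OF assms(1)] in simp_all)

text \<open>Peel off one open set \<open>U\<close>. What it shares with the union of the others is a cocycle on the
  intersection; cut into Euclidean pieces, it can be evaluated on either side.\<close>

lemma orient_sum_bounding_aux:
  assumes "finite \<W>" "\<And>W. W \<in> \<W> \<Longrightarrow> euclidean_open d M W" "\<And>W. W \<in> \<W> \<Longrightarrow> F W \<in> cocycles_in M W d"
    and "bounding M (\<Union>\<W>) d (\<Sum>W\<in>\<W>. F W)"
  shows "(\<Sum>W\<in>\<W>. orient W (F W)) = 0"
  using assms
proof (induction \<W> arbitrary: F rule: finite_induct)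
  case (insert U \<W>)
  let ?V = "\<Union>\<W>" and ?S = "\<Sum>W\<in>\<W>. F W"
  have U: "euclidean_open d M U" and E: "\<And>W. W \<in> \<W> \<Longrightarrow> euclidean_open d M W" using insert.prems(1) by auto
  have UV: "openin M U" "openin M ?V" using euclidean_openin U E by auto
  have FU: "F U \<in> cocycles_in M U d" and FW: "\<And>W. W \<in> \<W> \<Longrightarrow> F W \<in> cocycles_in M W d"
    using insert.prems(2) by auto
  have FV: "?S \<in> cocycles_in M ?V d"
    using FW cocycles_in_mono[of _ ?V M d] by (intro subgrp_sum[OF subgrp_cocycles_in]) blast
  have tot: "F U + ?S \<in> cochains M d" "bounding M (U \<union> ?V) d (F U + ?S)"
    using FU FV insert.prems(3) subgrp_add[OF subgrp_cochains, of "F U" M d ?S]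
    unfolding sum.insert[OF insert.hyps] Union_insert
    by (auto simp only: cocycles_in_def cochains_in_def compact_cochains_def)
  obtain \<phi>1 \<phi>2 where \<phi>: "\<phi>1 \<in> cocycles_in M U d" "bounding M U d \<phi>1" "\<phi>2 \<in> cochains_in M ?V d"
    "bounding M ?V d \<phi>2" "F U + ?S = \<phi>1 + \<phi>2"
    using bounding_split[OF Hausdorff loc_compact UV tot] by blast
  \<comment> \<open>What has to be moved between \<open>U\<close> and the other sets. It is a
    cocycle in \<open>U\<close>, and being also \<open>?S - \<phi>2\<close> it is supported in
    \<open>?V\<close>.\<close>
  define \<theta> where "\<theta> = \<phi>1 - F U"
  have "\<phi>1 = F U + (?S - \<phi>2)" using \<phi>(5) by (simp only: add_diff_eq add_diff_cancel_right')
  then have \<theta>2: "\<theta> = ?S - \<phi>2" unfolding \<theta>_def by (simp only: add_diff_cancel_left')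
  have \<theta>U: "\<theta> \<in> cocycles_in M U d" unfolding \<theta>_def using \<phi>(1) FU subgrp_diff[OF subgrp_cocycles_in] by blast
  have "\<theta> \<in> cochains_in M ?V d"
    unfolding \<theta>2 using \<phi>(3) cocycles_in_cochains[OF FV] subgrp_diff[OF subgrp_cochains_in] by blast
  \<comment> \<open>Charts contained both in \<open>U\<close> and in a single member of the family,
    so that \<open>orient_mono\<close> can be used in both directions.\<close>
  define \<B> where "\<B> = {A. euclidean_open d M A \<and> A \<subseteq> U \<and> (\<exists>W\<in>\<W>. A \<subseteq> W)}"
  have "\<exists>A\<in>\<B>. x \<in> A" if x: "x \<in> U" "x \<in> ?V" for x
  proof -
    obtain W where W: "W \<in> \<W>" "x \<in> W" using x by blast
    then obtain A where "euclidean_open d M A" "x \<in> A" "A \<subseteq> U \<inter> W"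
      using euclidean_open_basis[OF manifold, of "U \<inter> W" x] x(1) UV(1) euclidean_openin[OF E] by blast
    then show ?thesis using W by (auto simp: \<B>_def)
  qed
  then have "U \<inter> ?V \<subseteq> \<Union>\<B>" by blast
  then have "\<theta> \<in> cocycles_in M (\<Union>\<B>) d"
    using \<theta>U \<open>\<theta> \<in> cochains_in M ?V d\<close> by (auto simp: cocycles_in_def cochains_in_def)
  then obtain \<A> G where A: "finite \<A>" "\<A> \<subseteq> \<B>" "\<And>A. A \<in> \<A> \<Longrightarrow> G A \<in> cocycles_in M A d"
    "cochain_support M (\<theta> - (\<Sum>A\<in>\<A>. G A)) = {}"
    using cocycle_decomposition_cover[OF Hausdorff loc_compact, of \<B> d \<theta>] euclidean_openin euclidean_acyclic
    unfolding \<B>_def by (smt (verit, ccfv_threshold) mem_Collect_eq order_refl)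
  have AE: "euclidean_open d M A" "A \<subseteq> U" if "A \<in> \<A>" for A using that A(2) by (auto simp: \<B>_def)
  have "\<forall>A\<in>\<A>. \<exists>W. W \<in> \<W> \<and> A \<subseteq> W" using A(2) by (auto simp: \<B>_def)
  then obtain w where w: "\<And>A. A \<in> \<A> \<Longrightarrow> w A \<in> \<W>" "\<And>A. A \<in> \<A> \<Longrightarrow> A \<subseteq> w A" by metis
  have GU: "G A \<in> cocycles_in M U d" if "A \<in> \<A>" for A using A(3)[OF that] AE(2)[OF that] cocycles_in_mono by blast
  have Gw: "G A \<in> cocycles_in M W d" if "A \<in> \<A>" "w A = W" for A W
    using A(3)[OF that(1)] w(2)[OF that(1)] that(2) cocycles_in_mono by blast
  \<comment> \<open>The piece on \<open>A\<close> is handed to one member \<open>w A\<close>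
    containing it. The new sum differs from \<open>\<phi>2\<close> by a locally zero cochain, so it
    bounds in \<open>?V\<close> and the induction hypothesis applies.\<close>
  define F' where "F' = (\<lambda>W. F W - (\<Sum>A\<in>{A \<in> \<A>. w A = W}. G A))"
  have F': "F' W \<in> cocycles_in M W d" if "W \<in> \<W>" for W
    unfolding F'_def using FW[OF that] Gw
    by (intro subgrp_diff[OF subgrp_cocycles_in] subgrp_sum[OF subgrp_cocycles_in]) auto
  have group: "(\<Sum>W\<in>\<W>. \<Sum>A\<in>{A \<in> \<A>. w A = W}. g A) = (\<Sum>A\<in>\<A>. g A)" for g :: "'a set \<Rightarrow> 'h::comm_monoid_add"
    using sum.group[OF A(1) insert.hyps(1), of w g] w(1) by auto
  have "(\<Sum>W\<in>\<W>. F' W) = ?S - (\<Sum>A\<in>\<A>. G A)"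
    unfolding F'_def sum_subtractf group ..
  then have "(\<Sum>W\<in>\<W>. F' W) - \<phi>2 = \<theta> - (\<Sum>A\<in>\<A>. G A)" unfolding \<theta>2 by simp
  then have "bounding M ?V d (\<Sum>W\<in>\<W>. F' W)" using bounding_cong[OF \<phi>(4)] A(4) by metis
  then have "(\<Sum>W\<in>\<W>. orient W (F' W)) = 0" using insert.IH[of F'] E F' by blast
  moreover have "orient W (F' W) = orient W (F W) - (\<Sum>A\<in>{A \<in> \<A>. w A = W}. orient A (G A))" if "W \<in> \<W>" for W
  proof -
    have "orient W (F' W) = orient W (F W) - orient W (\<Sum>A\<in>{A \<in> \<A>. w A = W}. G A)"
      unfolding F'_def using E[OF that] FW[OF that] Gw
      by (intro orient_diff subgrp_sum[OF subgrp_cocycles_in]) auto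
    also have "orient W (\<Sum>A\<in>{A \<in> \<A>. w A = W}. G A) = (\<Sum>A\<in>{A \<in> \<A>. w A = W}. orient W (G A))"
      using E[OF that] Gw by (intro orient_sum) auto
    also have "\<dots> = (\<Sum>A\<in>{A \<in> \<A>. w A = W}. orient A (G A))"
      using E[OF that] AE(1) w(2) A(3) by (intro sum.cong orient_mono) auto
    finally show ?thesis .
  qed
  ultimately have "(\<Sum>W\<in>\<W>. orient W (F W)) = (\<Sum>A\<in>\<A>. orient A (G A))"
    by (simp add: sum_subtractf group)
  also have "\<dots> = (\<Sum>A\<in>\<A>. orient U (G A))"
    using U AE A(3) by (intro sum.cong orient_mono[symmetric]) auto
  also have "\<dots> = orient U (\<Sum>A\<in>\<A>. G A)" using orient_sum[OF U, of \<A> G] GU by (simp only:)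
  also have "\<dots> = orient U \<theta>"
  proof (rule local_chain_cong[OF orient_local_chain[OF U] cocycles_in_cochains[OF \<theta>U] _ A(4), symmetric])
    show "(\<Sum>A\<in>\<A>. G A) \<in> cochains_in M U d"
      using cocycles_in_cochains[OF GU] by (intro subgrp_sum[OF subgrp_cochains_in])
  qed
  also have "\<dots> = - orient U (F U)"
    unfolding \<theta>_def using orient_diff[OF U \<phi>(1) FU] orient_bounding[OF U cocycles_in_cochains[OF \<phi>(1)] \<phi>(2)] by simp
  finally show ?case using sum.insert[OF insert.hyps, of "\<lambda>W. orient W (F W)"] by simp
qed simp

text \<open>A primitive on \<open>M\<close> need not be supported in the union of the given charts.
  Its support is compact, so finitely many further charts with the zero cocycle make up for
  that.\<close>

lemma orient_sum_bounding:
  assumes W: "finite \<W>" "\<And>W. W \<in> \<W> \<Longrightarrow> euclidean_open d M W" "\<And>W. W \<in> \<W> \<Longrightarrow> F W \<in> cocycles_in M W d"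
    and b: "bounding M (topspace M) d (\<Sum>W\<in>\<W>. F W)"
  shows "(\<Sum>W\<in>\<W>. orient W (F W)) = 0"
proof -
  obtain \<A> where A: "finite \<A>" "\<And>W. W \<in> \<A> \<Longrightarrow> euclidean_open d M W" "bounding M (\<Union>\<A>) d (\<Sum>W\<in>\<W>. F W)"
  proof (cases d)
    case 0
    then show thesis using that[of "{}"] b by (simp add: bounding_def)
  next
    case (Suc p)
    then obtain \<psi> where \<psi>: "\<psi> \<in> cochains_in M (topspace M) p" "cochain_support M ((\<Sum>W\<in>\<W>. F W) - coboundary M \<psi>) = {}"
      using b by (auto simp: bounding_def)
    then have "compactin M (cochain_support M \<psi>)" "cochain_support M \<psi> \<subseteq> \<Union>(Collect (euclidean_open d M))"
      unfolding euclidean_cover[symmetric] by (auto simp: cochains_in_def compact_cochains_def)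
    then obtain \<A> where "finite \<A>" "\<A> \<subseteq> Collect (euclidean_open d M)" "cochain_support M \<psi> \<subseteq> \<Union>\<A>"
      using compactinD[of M _ "Collect (euclidean_open d M)"] euclidean_openin by (metis mem_Collect_eq)
    then show thesis using that[of \<A>] \<psi> Suc by (auto simp: bounding_def cochains_in_def)
  qed
  define F' where "F' = (\<lambda>W. if W \<in> \<W> then F W else 0)"
  have fin: "finite (\<W> \<union> \<A>)" using W(1) A(1) by simp
  have sum: "(\<Sum>W\<in>\<W> \<union> \<A>. F' W) = (\<Sum>W\<in>\<W>. F W)"
    using sum.mono_neutral_right[OF fin, of \<W> F'] by (simp add: F'_def)
  have "bounding M (\<Union>(\<W> \<union> \<A>)) d (\<Sum>W\<in>\<W>. F W)"
    using A(3) cochains_in_mono[of "\<Union>\<A>" "\<Union>(\<W> \<union> \<A>)" M] unfolding bounding_def by (cases d) auto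
  then have "(\<Sum>W\<in>\<W> \<union> \<A>. orient W (F' W)) = 0"
    unfolding sum[symmetric]
    using W(2,3) A(2) subgrp_0[OF subgrp_cocycles_in] by (intro orient_sum_bounding_aux[OF fin]) (auto simp: F'_def)
  moreover have "(\<Sum>W\<in>\<W> \<union> \<A>. orient W (F' W)) = (\<Sum>W\<in>\<W>. orient W (F W))"
    using sum.mono_neutral_right[OF fin, of \<W> "\<lambda>W. orient W (F' W)"] orient_0 A(2) by (auto simp: F'_def)
  ultimately show ?thesis by simp
qed

text \<open>Requiring \<open>F\<close> to vanish outside the family lets two decompositions be
  compared over the union of their families.\<close>

definition decomposes :: "'a set set \<Rightarrow> ('a set \<Rightarrow> 'a cochain) \<Rightarrow> 'a cochain \<Rightarrow> bool" where
  "decomposes \<W> F \<phi> \<longleftrightarrow> finite \<W> \<and> (\<forall>W\<in>\<W>. euclidean_open d M W \<and> F W \<in> cocycles_in M W d) \<and>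
     (\<forall>W. W \<notin> \<W> \<longrightarrow> F W = 0) \<and> cochain_support M (\<phi> - (\<Sum>W\<in>\<W>. F W)) = {}"

lemma decomposes_exists:
  assumes "\<phi> \<in> cocycles_in M (topspace M) d"
  shows "\<exists>\<W> F. decomposes \<W> F \<phi>"
proof -
  obtain \<A> F where A: "finite \<A>" "\<And>W. W \<in> \<A> \<Longrightarrow> euclidean_open d M W" "\<And>W. W \<in> \<A> \<Longrightarrow> F W \<in> cocycles_in M W d"
    "cochain_support M (\<phi> - (\<Sum>W\<in>\<A>. F W)) = {}"
    using euclidean_decomposition[OF order_refl, of \<phi>] assms by (auto simp: cocycles_in_def cochains_in_topspace)
  then have "decomposes \<A> (\<lambda>W. if W \<in> \<A> then F W else 0) \<phi>" by (simp add: decomposes_def)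
  then show ?thesis by blast
qed

lemma decomposes_superset:
  assumes "decomposes \<W> F \<phi>" "finite \<A>" "\<W> \<subseteq> \<A>" "\<And>W. W \<in> \<A> \<Longrightarrow> euclidean_open d M W"
  shows "decomposes \<A> F \<phi>" "(\<Sum>W\<in>\<A>. orient W (F W)) = (\<Sum>W\<in>\<W>. orient W (F W))"
proof -
  have F0: "F W = 0" if "W \<notin> \<W>" for W using assms(1) that by (simp add: decomposes_def)
  have "(\<Sum>W\<in>\<A>. F W) = (\<Sum>W\<in>\<W>. F W)" using assms(2,3) F0 by (intro sum.mono_neutral_right) auto
  moreover have "F W \<in> cocycles_in M W d" for W
    using assms(1) F0[of W] subgrp_0[OF subgrp_cocycles_in] by (cases "W \<in> \<W>") (auto simp: decomposes_def)
  ultimately show "decomposes \<A> F \<phi>" using assms F0 unfolding decomposes_def by auto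
  show "(\<Sum>W\<in>\<A>. orient W (F W)) = (\<Sum>W\<in>\<W>. orient W (F W))"
    using assms(2,3,4) F0 orient_0 by (intro sum.mono_neutral_right) auto
qed

lemma decomposes_diff:
  assumes "decomposes \<W> F \<phi>" "decomposes \<W> G \<psi>"
  shows "decomposes \<W> (\<lambda>W. F W - G W) (\<phi> - \<psi>)"
    "(\<Sum>W\<in>\<W>. orient W (F W - G W)) = (\<Sum>W\<in>\<W>. orient W (F W)) - (\<Sum>W\<in>\<W>. orient W (G W))"
proof -
  have "cochain_support M (\<phi> - \<psi> - (\<Sum>W\<in>\<W>. F W - G W)) = {}"
    using null_diff[of M "\<phi> - (\<Sum>W\<in>\<W>. F W)" "\<psi> - (\<Sum>W\<in>\<W>. G W)"] assms
    by (simp add: decomposes_def sum_subtractf algebra_simps)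
  then show "decomposes \<W> (\<lambda>W. F W - G W) (\<phi> - \<psi>)"
    using assms subgrp_diff[OF subgrp_cocycles_in, of _ M _ d] by (auto simp: decomposes_def)
  show "(\<Sum>W\<in>\<W>. orient W (F W - G W)) = (\<Sum>W\<in>\<W>. orient W (F W)) - (\<Sum>W\<in>\<W>. orient W (G W))"
    using assms by (simp add: orient_diff decomposes_def flip: sum_subtractf cong: sum.cong)
qed

lemma decomposes_bounding:
  assumes "decomposes \<W> F \<phi>" "bounding M (topspace M) d \<phi>"
  shows "(\<Sum>W\<in>\<W>. orient W (F W)) = 0"
proof (rule orient_sum_bounding)
  have "cochain_support M ((\<Sum>W\<in>\<W>. F W) - \<phi>) = {}"
    using assms(1) cochain_support_uminus[of M "\<phi> - (\<Sum>W\<in>\<W>. F W)"] by (simp add: decomposes_def)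
  then show "bounding M (topspace M) d (\<Sum>W\<in>\<W>. F W)" by (rule bounding_cong[OF assms(2)])
qed (use assms(1) in \<open>auto simp: decomposes_def\<close>)

text \<open>Over a common family the difference of the two is a decomposition of zero, which
  bounds.\<close>

lemma decomposes_unique:
  assumes "decomposes \<W> F \<phi>" "decomposes \<A> G \<phi>"
  shows "(\<Sum>W\<in>\<W>. orient W (F W)) = (\<Sum>W\<in>\<A>. orient W (G W))"
proof -
  have U: "finite (\<W> \<union> \<A>)" "\<And>W. W \<in> \<W> \<union> \<A> \<Longrightarrow> euclidean_open d M W" using assms by (auto simp: decomposes_def)
  note F = decomposes_superset[OF assms(1) U(1) Un_upper1 U(2)] and G = decomposes_superset[OF assms(2) U(1) Un_upper2 U(2)]
  have "bounding M (topspace M) d (\<phi> - \<phi>)"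
    unfolding bounding_def by (cases d) (auto intro!: bexI[of _ 0] subgrp_0[OF subgrp_cochains_in])
  then show ?thesis using decomposes_bounding[OF decomposes_diff(1)[OF F(1) G(1)]] decomposes_diff(2)[OF F(1) G(1)] F(2) G(2)
    by simp
qed

section \<open>Existence and uniqueness of the fundamental class\<close>

definition total_orient :: "'a cochain \<Rightarrow> int" where
  "total_orient \<phi> = (SOME n. \<exists>\<W> F. decomposes \<W> F \<phi> \<and> n = (\<Sum>W\<in>\<W>. orient W (F W)))"

lemma total_orient:
  assumes "decomposes \<W> F \<phi>"
  shows "total_orient \<phi> = (\<Sum>W\<in>\<W>. orient W (F W))"
proof -
  have "\<exists>n \<W> F. decomposes \<W> F \<phi> \<and> n = (\<Sum>W\<in>\<W>. orient W (F W))" using assms by blast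
  from someI_ex[OF this] obtain \<A> G where "decomposes \<A> G \<phi>" "total_orient \<phi> = (\<Sum>W\<in>\<A>. orient W (G W))"
    unfolding total_orient_def by blast
  then show ?thesis using decomposes_unique[OF assms] by metis
qed

lemma total_orient_diff:
  assumes "\<phi> \<in> cocycles_in M (topspace M) d" "\<psi> \<in> cocycles_in M (topspace M) d"
  shows "total_orient (\<phi> - \<psi>) = total_orient \<phi> - total_orient \<psi>"
proof -
  obtain \<W> F \<A> G where *: "decomposes \<W> F \<phi>" "decomposes \<A> G \<psi>" using assms decomposes_exists by metis
  have U: "finite (\<W> \<union> \<A>)" "\<And>W. W \<in> \<W> \<union> \<A> \<Longrightarrow> euclidean_open d M W" using * by (auto simp: decomposes_def)
  note F = decomposes_superset(1)[OF *(1) U(1) Un_upper1 U(2)] and G = decomposes_superset(1)[OF *(2) U(1) Un_upper2 U(2)]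
  show ?thesis
    using total_orient[OF decomposes_diff(1)[OF F G]] decomposes_diff(2)[OF F G] total_orient[OF F] total_orient[OF G] by simp
qed

text \<open>The functional \<open>total_orient\<close> extends from cocycles to a chain. This is a
  cycle because bounding cocycles have value \<open>0\<close>, and on a cocycle inside one chart the
  decomposition with a single member returns \<open>orient U\<close>.\<close>

lemma fundamental_cycle_exists:
  obtains c where "c \<in> infinite_cycles M d"
    "\<And>U. euclidean_open d M U \<Longrightarrow> steenrod_restriction M U d (hclass M d c) = ori U"
proof -
  have Z: "{\<phi> \<in> compact_cochains M d. cochain_support M (coboundary M \<phi>) = {}} = cocycles_in M (topspace M) d"
    by (simp add: cocycles_in_def cochains_in_topspace)
  have add: "additive_on (cocycles_in M (topspace M) d) total_orient"
    unfolding additive_on_def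
  proof (intro ballI)
    fix \<phi> \<psi> assume *: "\<phi> \<in> cocycles_in M (topspace M) d" "\<psi> \<in> cocycles_in M (topspace M) d"
    from total_orient_diff[OF subgrp_add[OF subgrp_cocycles_in *] *(2)]
    show "total_orient (\<phi> + \<psi>) = total_orient \<phi> + total_orient \<psi>" by simp
  qed
  \<comment> \<open>The empty family decomposes every locally zero cochain.\<close>
  have null: "total_orient \<phi> = 0" if "\<phi> \<in> compact_cochains M d" "cochain_support M \<phi> = {}" for \<phi>
    using total_orient[of "{}" "\<lambda>_. 0" \<phi>] that(2) by (simp add: decomposes_def)
  obtain c where c: "c \<in> infinite_chains M d" "\<And>\<phi>. \<phi> \<in> cocycles_in M (topspace M) d \<Longrightarrow> c \<phi> = total_orient \<phi>"
  proof (rule chain_of_cocycle_functional[of M d total_orient, unfolded Z, OF add null])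
    fix c assume "c \<in> infinite_chains M d"
      "\<And>\<phi>. \<phi> \<in> compact_cochains M d \<Longrightarrow> cochain_support M (coboundary M \<phi>) = {} \<Longrightarrow> c \<phi> = total_orient \<phi>"
    then show thesis using that Z by blast
  qed
  have cyc: "c \<in> infinite_cycles M d"
  proof (rule cycleI[OF c(1)])
    fix p \<psi> assume *: "d = Suc p" "\<psi> \<in> compact_cochains M p"
    have \<psi>: "coboundary M \<psi> \<in> cocycles_in M (topspace M) d"
      using coboundary_cocycle[of \<psi> M "topspace M" p] * by (simp add: cochains_in_topspace)
    obtain \<W> F where dec: "decomposes \<W> F (coboundary M \<psi>)" using decomposes_exists[OF \<psi>] by blast
    have "bounding M (topspace M) d (coboundary M \<psi>)"
      using * unfolding bounding_def by (auto simp: cochains_in_topspace intro!: bexI[of _ \<psi>])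
    then show "c (coboundary M \<psi>) = 0"
      using c(2)[OF \<psi>] total_orient[OF dec] decomposes_bounding[OF dec] by simp
  qed
  moreover have "steenrod_restriction M U d (hclass M d c) = ori U" if U: "euclidean_open d M U" for U
    unfolding restriction_eq_ori_iff[OF U cyc]
  proof
    fix \<phi> assume \<phi>: "\<phi> \<in> cocycles_in M U d"
    then have "decomposes {U} (\<lambda>W. if W = U then \<phi> else 0) \<phi>" using U by (simp add: decomposes_def)
    moreover have "\<phi> \<in> cocycles_in M (topspace M) d"
      using \<phi> cocycles_in_mono openin_subset[OF euclidean_openin[OF U]] by blast
    ultimately show "c \<phi> = orient U \<phi>" using c(2) total_orient by simp
  qed
  ultimately show thesis using that by blast
qed

text \<open>Both cycles take the same values on cocycles in charts, hence on all cocycles, and in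
  degree \<open>d\<close> these values determine the class.\<close>

lemma fundamental_cycle_unique:
  assumes c: "c \<in> infinite_cycles M d" "c' \<in> infinite_cycles M d"
    and eq: "\<And>U. euclidean_open d M U \<Longrightarrow> steenrod_restriction M U d (hclass M d c) = ori U"
      "\<And>U. euclidean_open d M U \<Longrightarrow> steenrod_restriction M U d (hclass M d c') = ori U"
  shows "hclass M d c = hclass M d c'"
  unfolding hclass_eq_iff
proof (rule boundary_if_zero_on_cocycles[OF _ acyclic[OF order_refl]])
  show ch: "c - c' \<in> infinite_chains M d"
    using c infinite_cyclesD subgrp_diff[OF subgrp_infinite_chains] by blast
  fix \<phi> assume \<phi>: "\<phi> \<in> compact_cochains M d" "cochain_support M (coboundary M \<phi>) = {}"
  then obtain \<A> F where A: "finite \<A>" "\<And>W. W \<in> \<A> \<Longrightarrow> euclidean_open d M W" "\<And>W. W \<in> \<A> \<Longrightarrow> F W \<in> cocycles_in M W d"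
    "cochain_support M (\<phi> - (\<Sum>W\<in>\<A>. F W)) = {}"
    using euclidean_decomposition[OF order_refl] by metis
  have FC: "F W \<in> compact_cochains M d" if "W \<in> \<A>" for W
    using A(3)[OF that] cocycles_in_cochains cochains_in_subset by blast
  have F0: "(c - c') (F W) = 0" if "W \<in> \<A>" for W
    using restriction_eq_ori_iff[OF A(2)[OF that]] c eq[OF A(2)[OF that]] A(3)[OF that] by simp
  have "(c - c') (\<Sum>W\<in>\<B>. F W) = 0" if "\<B> \<subseteq> \<A>" for \<B>
    using finite_subset[OF that A(1)] that
  proof (induction \<B> rule: finite_induct)
    case empty
    show ?case unfolding sum.empty by (rule additive_on_0[OF chain_additive[OF ch] subgrp_compact_cochains])
  next
    case (insert W \<B>)
    then have "(\<Sum>W\<in>\<B>. F W) \<in> compact_cochains M d" using FC by (intro subgrp_sum[OF subgrp_compact_cochains]) auto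
    then have "(c - c') (F W + (\<Sum>W\<in>\<B>. F W)) = (c - c') (F W) + (c - c') (\<Sum>W\<in>\<B>. F W)"
      using chain_additive[OF ch] FC insert.prems unfolding additive_on_def by blast
    moreover have "(c - c') (F W) = 0" "(c - c') (\<Sum>W\<in>\<B>. F W) = 0"
      using insert.IH insert.prems F0 by blast+
    ultimately show ?case unfolding sum.insert[OF insert.hyps] by (simp only: add_0)
  qed
  then show "(c - c') \<phi> = 0"
    using chain_cong[OF ch \<phi>(1) subgrp_sum[OF subgrp_compact_cochains FC] A(4)] by simp
qed

lemma fundamental_class:
  obtains c where "c \<in> infinite_cycles M d" "fundamental_class d M ori = hclass M d c"
    "\<And>U. euclidean_open d M U \<Longrightarrow> steenrod_restriction M U d (hclass M d c) = ori U"
proof -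
  obtain c where c: "c \<in> infinite_cycles M d"
    "\<And>U. euclidean_open d M U \<Longrightarrow> steenrod_restriction M U d (hclass M d c) = ori U"
    using fundamental_cycle_exists by blast
  have "fundamental_class d M ori = hclass M d c"
    unfolding fundamental_class_def
  proof (rule the_equality)
    show "hclass M d c \<in> carrier (steenrod_homology M d) \<and>
        (\<forall>U. euclidean_open d M U \<longrightarrow> steenrod_restriction M U d (hclass M d c) = ori U)"
      using c hclass_in_carrier by blast
    fix \<mu> assume "\<mu> \<in> carrier (steenrod_homology M d) \<and> (\<forall>U. euclidean_open d M U \<longrightarrow> steenrod_restriction M U d \<mu> = ori U)"
    then show "\<mu> = hclass M d c" using fundamental_cycle_unique c by (metis steenrod_homologyE)
  qed
  then show thesis using that c by blast
qed

end

subsection \<open>Thin compactifications and pseudo-cycles\<close>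

lemma steenrod_restriction_trans:
  assumes U: "extendable X U" and V: "extendable (subtopology X U) V" "extendable X V" and VU: "V \<subseteq> U"
    and c: "c \<in> infinite_cycles X q"
  shows "steenrod_restriction (subtopology X U) V q (steenrod_restriction X U q (hclass X q c))
    = steenrod_restriction X V q (hclass X q c)"
proof -
  have sub: "subtopology (subtopology X U) V = subtopology X V"
    using VU by (simp add: subtopology_subtopology inf.absorb2)
  have "chain_restriction (subtopology X U) V q (chain_restriction X U q c) = chain_restriction X V q c"
  proof
    fix \<phi>
    show "chain_restriction (subtopology X U) V q (chain_restriction X U q c) \<phi> = chain_restriction X V q c \<phi>"
    proof (cases "\<phi> \<in> compact_cochains (subtopology X V) q")
      case True
      let ?\<epsilon> = "cochain_extension X V q \<phi>"
      have \<epsilon>: "?\<epsilon> \<in> cochains_in X V q" "cochain_support (subtopology X V) (restr X V ?\<epsilon> - \<phi>) = {}"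
        using extendableD(2)[OF V(2) True] by auto
      have \<epsilon>U: "?\<epsilon> \<in> cochains_in X U q" using \<epsilon>(1) cochains_in_mono[OF VU] by blast
      have "restr (subtopology X U) V (restr X U ?\<epsilon>) = restr X V ?\<epsilon>"
        using VU by (auto simp: restr_apply fun_eq_iff)
      moreover have "restr X U ?\<epsilon> \<in> cochains_in (subtopology X U) V q"
        using restr_compact[OF extendableD(1)[OF U] \<epsilon>U] restr_support[OF extendableD(1)[OF U], of ?\<epsilon>] \<epsilon>(1)
        by (auto simp: cochains_in_def)
      ultimately have "chain_restriction (subtopology X U) V q (chain_restriction X U q c) \<phi>
          = chain_restriction X U q c (restr X U ?\<epsilon>)"
        using \<epsilon>(2) True sub
          chain_local_chain[OF chain_restriction_chain[OF U chain_local_chain[OF infinite_cyclesD[OF c]]]]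
        by (intro chain_restriction_eq[OF V(1)]) simp_all
      also have "\<dots> = c ?\<epsilon>"
        by (rule chain_restriction_restr[OF U chain_local_chain[OF infinite_cyclesD[OF c]] \<epsilon>U])
      finally show ?thesis using True by (simp add: chain_restriction_def)
    qed (simp add: chain_restriction_def sub)
  qed
  then show ?thesis
    using steenrod_restriction_hclass[OF V(1) chain_restriction_cycles[OF U c]]
    by (simp add: steenrod_restriction_hclass[OF U c] steenrod_restriction_hclass[OF V(2) c] sub)
qed

text \<open>Acyclicity of \<open>S\<close> in degree \<open>q\<close> gives uniqueness, in the
  degree below existence. The representative \<open>a\<close> is chosen to agree with
  \<open>m\<close> exactly on cochains supported in \<open>U\<close>, not just up to a boundary;
  this makes the final comparison a matter of evaluation.\<close>

lemma restriction_inverse: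
  assumes X: "compact_space X" "Hausdorff_space X" and S: "closedin X S"
    and acyclic: "infinite_cycles (subtopology X S) q \<subseteq> infinite_boundaries (subtopology X S) q"
      "\<And>p. q = Suc p \<Longrightarrow> infinite_cycles (subtopology X S) p \<subseteq> infinite_boundaries (subtopology X S) p"
    and U: "U = topspace X - S" and m: "m \<in> infinite_cycles (subtopology X U) q"
  obtains a where "a \<in> infinite_cycles X q" "\<And>\<phi>. \<phi> \<in> cochains_in X U q \<Longrightarrow> a \<phi> = m (restr X U \<phi>)"
    "(THE \<alpha>. \<alpha> \<in> carrier (steenrod_homology X q) \<and> steenrod_restriction X U q \<alpha> = hclass (subtopology X U) q m)
       = hclass X q a"
proof -
  have "openin X U" using S unfolding U by blast
  moreover have "locally_compact_space (subtopology X U)"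
    using locally_compact_space_open_subset X compact_imp_locally_compact_space \<open>openin X U\<close> by blast
  ultimately have ext: "extendable X U" using extendable X(2) by blast
  note m' = infinite_cyclesD[OF m]
  obtain a where a: "a \<in> infinite_cycles X q" "\<And>\<phi>. \<phi> \<in> cochains_in X U q \<Longrightarrow> a \<phi> = m (restr X U \<phi>)"
  proof (rule restriction_surjective[OF X S acyclic(2)])
    show "local_chain X (topspace X - S) q (\<lambda>\<phi>. m (restr X U \<phi>))"
      using local_chain_restr[OF extendableD(1)[OF ext] m'] unfolding U .
    show "m (restr X U (coboundary X \<phi>)) = 0" if "q = Suc p" "\<phi> \<in> cochains_in X (topspace X - S) p" for p \<phi>
      unfolding restr_coboundary
      using cycle_coboundary[of m _ p] m restr_compact[OF extendableD(1)[OF ext]] that unfolding U by blast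
  qed (use U in blast)+
  have ra: "steenrod_restriction X U q (hclass X q a) = hclass (subtopology X U) q m"
    unfolding restriction_eq_iff[OF ext a(1) m']
    by (intro exI[of _ "\<lambda>_. 0"]) (simp add: local_chain_def additive_on_def a(2))
  have "\<alpha> = hclass X q a" if \<alpha>: "\<alpha> \<in> carrier (steenrod_homology X q)"
    "steenrod_restriction X U q \<alpha> = hclass (subtopology X U) q m" for \<alpha>
  proof -
    obtain a' where a': "a' \<in> infinite_cycles X q" "\<alpha> = hclass X q a'" using \<alpha>(1) by (rule steenrod_homologyE)
    obtain b where b: "local_chain X U (Suc q) b"
      "\<And>\<phi>. \<phi> \<in> cochains_in X U q \<Longrightarrow> a' \<phi> = m (restr X U \<phi>) + b (coboundary X \<phi>)"
      using \<alpha>(2) restriction_eq_iff[OF ext a'(1) m'] a'(2) by blast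
    have "a' - a \<in> infinite_boundaries X q"
      using a(2) b subgrp_diff[OF subgrp_infinite_cycles a'(1) a(1)] unfolding U
      by (intro restriction_injective[OF X S acyclic(1)]) simp_all
    then show ?thesis by (simp add: a'(2) hclass_eq_iff)
  qed
  then have "(THE \<alpha>. \<alpha> \<in> carrier (steenrod_homology X q) \<and> steenrod_restriction X U q \<alpha> = hclass (subtopology X U) q m)
       = hclass X q a"
    using ra hclass_in_carrier[OF a(1)] by (intro the_equality) blast+
  then show thesis using that a by blast
qed

context oriented_manifold
begin

text \<open>The charts of an open subset are the charts of \<open>M\<close> contained in it, so the
  same function \<open>ori\<close> serves.\<close>

lemma oriented_manifold_open:
  assumes "openin M U"
  shows "oriented_manifold d (subtopology M U) ori"
proof
  have eu: "euclidean_open d (subtopology M U) V \<longleftrightarrow> euclidean_open d M V \<and> V \<subseteq> U"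
    and sub: "V \<subseteq> U \<Longrightarrow> subtopology (subtopology M U) V = subtopology M V" for V
  proof -
    show sub: "V \<subseteq> U \<Longrightarrow> subtopology (subtopology M U) V = subtopology M V" for V
      by (simp add: subtopology_subtopology inf.absorb2)
    show "euclidean_open d (subtopology M U) V \<longleftrightarrow> euclidean_open d M V \<and> V \<subseteq> U" for V
      using sub[of V] openin_open_subtopology[OF assms] unfolding euclidean_open_def by metis
  qed
  show "topological_manifold d (subtopology M U)"
    unfolding topological_manifold_def
  proof (intro conjI ballI)
    show "Hausdorff_space (subtopology M U)" using Hausdorff Hausdorff_space_subtopology by blast
    fix x assume "x \<in> topspace (subtopology M U)"
    then obtain V where "euclidean_open d M V" "x \<in> V" "V \<subseteq> U"
      using euclidean_open_basis[OF manifold assms, of x] by auto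
    then show "\<exists>V. euclidean_open d (subtopology M U) V \<and> x \<in> V" using eu by blast
  qed
  show "orientation d (subtopology M U) ori"
    using orientation unfolding orientation_def eu by (auto simp: sub)
  show "locally_compact_space (subtopology M U)"
    using locally_compact_space_open_subset Hausdorff loc_compact assms by blast
qed

text \<open>By uniqueness on the open subset it is enough to look at its charts, and there
  restriction in two stages equals restriction in one.\<close>

lemma fundamental_class_open:
  assumes U: "openin M U" and c: "c \<in> infinite_cycles M d"
    "\<And>V. euclidean_open d M V \<Longrightarrow> steenrod_restriction M V d (hclass M d c) = ori V"
  shows "fundamental_class d (subtopology M U) ori = hclass (subtopology M U) d (chain_restriction M U d c)"
proof -
  interpret N: oriented_manifold d "subtopology M U" ori by (rule oriented_manifold_open[OF U])
  obtain n where n: "n \<in> infinite_cycles (subtopology M U) d"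
    "fundamental_class d (subtopology M U) ori = hclass (subtopology M U) d n"
    "\<And>V. euclidean_open d (subtopology M U) V \<Longrightarrow>
      steenrod_restriction (subtopology M U) V d (hclass (subtopology M U) d n) = ori V"
    using N.fundamental_class by blast
  have "steenrod_restriction (subtopology M U) V d (hclass (subtopology M U) d (chain_restriction M U d c)) = ori V"
    if V: "euclidean_open d (subtopology M U) V" for V
  proof -
    have "V \<subseteq> U" using openin_subset[OF N.euclidean_openin[OF V]] by simp
    moreover have "openin M V" using N.euclidean_openin[OF V] U openin_open_subtopology by blast
    moreover have "subtopology (subtopology M U) V = subtopology M V"
      using \<open>V \<subseteq> U\<close> by (simp add: subtopology_subtopology inf.absorb2)
    ultimately have "euclidean_open d M V" using V by (simp add: euclidean_open_def)
    then show ?thesis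
      using steenrod_restriction_trans[OF extendable_open[OF U] N.extendable_open[OF N.euclidean_openin[OF V]]
          extendable_open[OF \<open>openin M V\<close>] \<open>V \<subseteq> U\<close> c(1)] c(2)
      by (simp add: steenrod_restriction_hclass[OF extendable_open[OF U] c(1)])
  qed
  then show ?thesis
    using N.fundamental_cycle_unique[OF n(1) chain_restriction_cycles[OF extendable_open[OF U] c(1)] n(3)] n(2) by simp
qed

end

section \<open>Properness of maps and omega limit sets\<close>

lemma proper_continuous_compact:
  assumes "compact_space X" "Hausdorff_space Y" "continuous_map X Y f"
  shows "proper_continuous X Y f"
  unfolding proper_continuous_def
proof (intro conjI allI impI)
  fix K assume "compactin Y K"
  then have "closedin Y K" using assms(2) compactin_imp_closedin by blast
  then show "compactin X {x \<in> topspace X. f x \<in> K}"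
    by (intro closedin_compact_space[OF assms(1)] closedin_continuous_map_preimage[OF assms(3)])
qed fact

lemma closedin_omega_limit_set: "closedin Z (omega_limit_set M Z f)"
proof -
  have "compactin M {}" by simp
  then have "(\<lambda>K. Z closure_of (f ` (topspace M - K))) ` {K. compactin M K} \<noteq> {}" by blast
  then show ?thesis unfolding omega_limit_set_def by (intro closedin_Inter) auto
qed

lemma omega_limit_set_subset: "omega_limit_set M Z f \<subseteq> Z closure_of (f ` topspace M)"
  unfolding omega_limit_set_def using compactin_empty[of M] by fastforce

text \<open>A point \<open>y\<close> outside the omega limit set has a neighbourhood that
  \<open>f\<close> reaches only from some compact \<open>L y\<close>. Finitely many of these
  neighbourhoods cover a given compact \<open>K\<close>, so its preimage lies in a finite union of
  compact sets.\<close>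

lemma proper_off_omega_limit_set:
  assumes Z: "Hausdorff_space Z" and M: "Hausdorff_space M" and f: "continuous_map M Z f"
  defines "\<Omega> \<equiv> omega_limit_set M Z f" and "C \<equiv> Z closure_of (f ` topspace M)"
  shows "proper_continuous (subtopology M {x \<in> topspace M. f x \<notin> \<Omega>}) (subtopology (subtopology Z C) (topspace (subtopology Z C) - \<Omega>)) f"
  unfolding proper_continuous_def
proof (intro conjI allI impI)
  let ?Mo = "{x \<in> topspace M. f x \<notin> \<Omega>}"
  have fM: "f ` topspace M \<subseteq> topspace Z" using f by (auto simp: continuous_map_def)
  then have "f ` topspace M \<subseteq> C" unfolding C_def by (rule closure_of_subset)
  then have "f ` ?Mo \<subseteq> topspace (subtopology Z C) - \<Omega>" using fM by auto
  then show "continuous_map (subtopology M ?Mo) (subtopology (subtopology Z C) (topspace (subtopology Z C) - \<Omega>)) f"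
    using continuous_map_from_subtopology[OF f] by (auto simp: continuous_map_in_subtopology)
  fix K assume "compactin (subtopology (subtopology Z C) (topspace (subtopology Z C) - \<Omega>)) K"
  then have K: "compactin Z K" "K \<inter> \<Omega> = {}" by (auto simp: compactin_subtopology)
  have "\<exists>L. compactin M L \<and> y \<notin> Z closure_of (f ` (topspace M - L))" if "y \<in> K" for y
    using that K(2) unfolding \<Omega>_def omega_limit_set_def by blast
  then obtain L where L: "\<And>y. y \<in> K \<Longrightarrow> compactin M (L y)"
    "\<And>y. y \<in> K \<Longrightarrow> y \<notin> Z closure_of (f ` (topspace M - L y))" by metis
  define V where "V = (\<lambda>y. topspace Z - Z closure_of (f ` (topspace M - L y)))"
  have "K \<subseteq> \<Union>(V ` K)" using L(2) compactin_subset_topspace[OF K(1)] by (auto simp: V_def)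
  moreover have "openin Z A" if "A \<in> V ` K" for A using that by (auto simp: V_def)
  ultimately obtain \<F> where F: "finite \<F>" "\<F> \<subseteq> V ` K" "K \<subseteq> \<Union>\<F>" using compactinD[OF K(1), of "V ` K"] by blast
  obtain T where "T \<subseteq> K" "finite T" "\<F> = V ` T" using finite_subset_image[OF F(1,2)] by blast
  then have T: "T \<subseteq> K" "finite T" "K \<subseteq> \<Union>(V ` T)" using F(3) by simp_all
  have "compactin M (\<Union>(L ` T))" using T(1,2) L(1) by (intro compactin_Union) auto
  moreover have "{x \<in> topspace M. f x \<in> K} \<subseteq> \<Union>(L ` T)"
  proof safe
    fix x assume x: "x \<in> topspace M" "f x \<in> K"
    then obtain y where y: "y \<in> T" "f x \<in> V y" using T(3) by blast
    have "f ` (topspace M - L y) \<subseteq> Z closure_of (f ` (topspace M - L y))"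
      using fM by (intro closure_of_subset) blast
    then have "x \<in> L y" using x(1) y(2) unfolding V_def by blast
    then show "x \<in> \<Union>(L ` T)" using y(1) by blast
  qed
  moreover have "closedin M {x \<in> topspace M. f x \<in> K}"
    using closedin_continuous_map_preimage[OF f compactin_imp_closedin[OF Z K(1)]] .
  ultimately have "compactin M {x \<in> topspace M. f x \<in> K}" by (rule closed_compactin)
  moreover have "{x \<in> topspace (subtopology M ?Mo). f x \<in> K} = {x \<in> topspace M. f x \<in> K}" using K(2) by auto
  ultimately show "compactin (subtopology M ?Mo) {x \<in> topspace (subtopology M ?Mo). f x \<in> K}"
    using K(2) by (auto simp: compactin_subtopology)
qed

theorem lemma3p6:
  fixes d :: nat
    and M Mbar :: "'a topology"
    and ori :: "'a set \<Rightarrow> 'a infinite_chain set"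
    and Z :: "'b topology"
    and f fbar :: "'a \<Rightarrow> 'b"
  assumes "topological_manifold d M" and "orientation d M ori"
    and "metrizable_space Z" and "locally_compact_space Z"
    and "continuous_map M Z f"
    and "thin_compactification d M Mbar"
    and "continuous_map Mbar Z fbar"
    and "\<And>x. x \<in> topspace M \<Longrightarrow> fbar x = f x"
    and "covering_dim_le (subtopology Z (fbar ` (topspace Mbar - topspace M))) (int d - 2)"
  shows "pseudo_cycle d M ori Z f \<and>
    steenrod_induced (image_closure M Z f) (subtopology Z (fbar ` topspace Mbar)) d id
        (pseudo_cycle_class d M ori Z f)
      = steenrod_induced Mbar (subtopology Z (fbar ` topspace Mbar)) d fbar
        (thin_fundamental_class d M ori Mbar)"
proof
  define S where "S = topspace Mbar - topspace M"
  define X where "X = subtopology Z (fbar ` topspace Mbar)"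
  define C where "C = Z closure_of (f ` topspace M)"
  define \<Omega> where "\<Omega> = omega_limit_set M Z f"
  let ?A = "fbar ` S"
  have Mbar: "compact_space Mbar" "Hausdorff_space Mbar" "topspace M \<subseteq> topspace Mbar"
    "subtopology Mbar (topspace M) = M" "closedin Mbar S"
    and thin: "\<And>k. int k > int d - 2 \<Longrightarrow> trivial_group (steenrod_homology (subtopology Mbar S) k)"
    using assms(6) by (auto simp: thin_compactification_def S_def)
  have M_eq: "topspace M = topspace Mbar - S" using Mbar(3) by (auto simp: S_def)
  then have M_open: "openin Mbar (topspace M)" using Mbar(5) by auto
  have Z: "Hausdorff_space Z" using assms(3) metrizable_imp_Hausdorff_space by blast
  have f_eq: "f ` topspace M = fbar ` topspace M" using assms(8) by auto
  have XT: "compactin Z (fbar ` topspace Mbar)"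
    using image_compactin[OF _ assms(7)] Mbar(1) by (auto simp: compact_space_def)
  then have XTc: "closedin Z (fbar ` topspace Mbar)" using compactin_imp_closedin[OF Z] by blast
  have CX: "C \<subseteq> fbar ` topspace Mbar"
    unfolding C_def f_eq using XTc Mbar(3) by (intro closure_of_minimal) auto
  have Cc: "closedin Z C" by (simp add: C_def)
  then have C: "compactin Z C" using closed_compactin[OF XT CX] by blast
  have "compactin Mbar S" using Mbar(1,5) closedin_compact_space by blast
  then have A: "compactin Z ?A" using image_compactin assms(7) by blast
  then have Ac: "closedin Z ?A" using compactin_imp_closedin[OF Z] by blast
  have \<Omega>c: "closedin Z \<Omega>" unfolding \<Omega>_def by (rule closedin_omega_limit_set)
  have \<Omega>C: "\<Omega> \<subseteq> C" unfolding \<Omega>_def C_def by (rule omega_limit_set_subset)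
  have \<Omega>A: "\<Omega> \<subseteq> ?A"
  proof
    fix y assume y: "y \<in> \<Omega>"
    show "y \<in> ?A"
    proof (rule ccontr)
      assume "y \<notin> ?A"
      have "y \<in> topspace Z" using y \<Omega>c closedin_subset by blast
      then have "compactin Z {y}" by simp
      moreover have "disjnt ?A {y}" using \<open>y \<notin> ?A\<close> by simp
      ultimately obtain V W where V: "openin Z V" "openin Z W" "?A \<subseteq> V" "{y} \<subseteq> W" "disjnt V W"
        using Hausdorff_space_compact_separation[OF Z A] by metis
      \<comment> \<open>The points not mapped into the neighbourhood \<open>V\<close> of
        \<open>?A\<close>: closed in \<open>Mbar\<close> and disjoint from \<open>S\<close>, hence a
        compact subset of \<open>M\<close>, outside of which \<open>f\<close> stays in
        \<open>V\<close> and so away from \<open>y\<close>.\<close>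
      define K where "K = topspace Mbar - {x \<in> topspace Mbar. fbar x \<in> V}"
      have "closedin Mbar K"
        unfolding K_def using openin_continuous_map_preimage[OF assms(7) V(1)] by blast
      then have "compactin Mbar K" using Mbar(1) closedin_compact_space by blast
      moreover have "K \<subseteq> topspace M" using V(3) by (auto simp: K_def M_eq)
      ultimately have "compactin M K" using Mbar(4) compactin_subtopology by metis
      then have "y \<in> Z closure_of (f ` (topspace M - K))"
        using y unfolding \<Omega>_def omega_limit_set_def by blast
      moreover have "f ` (topspace M - K) \<subseteq> V" using assms(8) Mbar(3) by (auto simp: K_def)
      ultimately have "y \<in> Z closure_of V" using closure_of_mono by blast
      then show False using V by (auto simp: in_closure_of disjnt_iff)
    qed
  qed
  have dimA: "covering_dim_le (subtopology Z ?A) (int d - 2)" using assms(9) by (simp add: S_def)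
  \<comment> \<open>The dimension bound is given on \<open>?A\<close> and passes to its closed
    subset \<Omega>.\<close>
  have "closedin (subtopology Z ?A) \<Omega>" using \<Omega>c \<Omega>A by (simp add: closedin_subset_topspace)
  then have dim\<Omega>: "covering_dim_le (subtopology Z \<Omega>) (int d - 2)"
    using covering_dim_closed[OF dimA] inf.absorb2[OF \<Omega>A] by (metis subtopology_subtopology)
  show "pseudo_cycle d M ori Z f"
    unfolding pseudo_cycle_def using assms(1-5) C dim\<Omega> by (simp add: C_def \<Omega>_def)

  have "locally_compact_space M"
    using locally_compact_space_open_subset[of Mbar "topspace M"] Mbar M_open compact_imp_locally_compact_space by metis
  then interpret oriented_manifold d M ori using assms(1,2) by unfold_locales
  obtain m where m: "m \<in> infinite_cycles M d" "fundamental_class d M ori = hclass M d m"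
    "\<And>U. euclidean_open d M U \<Longrightarrow> steenrod_restriction M U d (hclass M d m) = ori U"
    using fundamental_class by blast

  have acS: "infinite_cycles (subtopology Mbar S) k \<subseteq> infinite_boundaries (subtopology Mbar S) k" if "int k > int d - 2" for k
    using trivial_homologyD[OF thin[OF that]] .
  obtain a where a: "a \<in> infinite_cycles Mbar d"
    "\<And>\<phi>. \<phi> \<in> cochains_in Mbar (topspace M) d \<Longrightarrow> a \<phi> = m (restr Mbar (topspace M) \<phi>)"
    "(THE \<alpha>. \<alpha> \<in> carrier (steenrod_homology Mbar d) \<and>
       steenrod_restriction Mbar (topspace M) d \<alpha> = hclass (subtopology Mbar (topspace M)) d m) = hclass Mbar d a"
    using restriction_inverse[OF Mbar(1,2,5) acS acS M_eq, of d m] m(1) unfolding Mbar(4) by auto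
  have thin_class: "thin_fundamental_class d M ori Mbar = hclass Mbar d a"
    using a(3) unfolding thin_fundamental_class_def m(2) Mbar(4) .

  \<comment> \<open>The notions \<open>Xf\<close>, \<open>W\<close> and \<open>Mo\<close> follow the
    definition of \<open>pseudo_cycle_class\<close>; the cycle \<open>mo\<close> restricts the same
    \<open>m\<close> from which \<open>a\<close> was obtained, which links the two classes.\<close>
  define Xf where "Xf = subtopology Z C"
  define W where "W = topspace Xf - \<Omega>"
  define Mo where "Mo = {x \<in> topspace M. f x \<notin> \<Omega>}"
  have "openin M {x \<in> topspace M. f x \<in> topspace Z - \<Omega>}"
    using \<Omega>c by (intro openin_continuous_map_preimage[OF assms(5)]) blast
  moreover have "{x \<in> topspace M. f x \<in> topspace Z - \<Omega>} = Mo"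
    using assms(5) by (auto simp: Mo_def continuous_map_def)
  ultimately have Mo: "openin M Mo" by simp
  define mo where "mo = chain_restriction M Mo d m"
  have mo: "mo \<in> infinite_cycles (subtopology M Mo) d"
    unfolding mo_def by (rule chain_restriction_cycles[OF extendable_open[OF Mo] m(1)])
  have f_proper: "proper_continuous (subtopology M Mo) (subtopology Xf W) f"
    using proper_off_omega_limit_set[OF Z Hausdorff assms(5)] unfolding Mo_def Xf_def W_def \<Omega>_def C_def .
  define n where "n = chain_pushforward (subtopology M Mo) (subtopology Xf W) d f mo"
  have n: "n \<in> infinite_cycles (subtopology Xf W) d" unfolding n_def by (rule pushforward_cycle[OF f_proper mo])
  have Xf: "compact_space Xf" "Hausdorff_space Xf"
    using C Z Hausdorff_space_subtopology compact_space_subtopology by (auto simp: Xf_def)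
  have sub\<Omega>: "subtopology Xf \<Omega> = subtopology Z \<Omega>" using \<Omega>C by (simp add: Xf_def subtopology_subtopology inf.absorb2)
  have \<Omega>: "compact_space (subtopology Z \<Omega>)" "Hausdorff_space (subtopology Z \<Omega>)"
    using closed_compactin[OF C \<Omega>C \<Omega>c] Z Hausdorff_space_subtopology compact_space_subtopology by blast+
  have ac\<Omega>: "infinite_cycles (subtopology Xf \<Omega>) k \<subseteq> infinite_boundaries (subtopology Xf \<Omega>) k" if "int k > int d - 2" for k
    unfolding sub\<Omega> by (rule covering_dim_acyclic[OF \<Omega> dim\<Omega> that])
  have "closedin Xf \<Omega>" using \<Omega>c \<Omega>C by (simp add: Xf_def closedin_subset_topspace)
  then obtain c where c: "c \<in> infinite_cycles Xf d"
    "\<And>\<phi>. \<phi> \<in> cochains_in Xf W d \<Longrightarrow> c \<phi> = n (restr Xf W \<phi>)"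
    "(THE \<alpha>. \<alpha> \<in> carrier (steenrod_homology Xf d) \<and> steenrod_restriction Xf W d \<alpha> = hclass (subtopology Xf W) d n)
       = hclass Xf d c"
    using restriction_inverse[OF Xf _ ac\<Omega> ac\<Omega> W_def n] by auto
  have "fundamental_class d (subtopology M Mo) ori = hclass (subtopology M Mo) d mo"
    unfolding mo_def by (rule fundamental_class_open[OF Mo m(1)]) (rule m(3))
  then have "steenrod_induced (subtopology M Mo) (subtopology Xf W) d f (fundamental_class d (subtopology M Mo) ori)
      = hclass (subtopology Xf W) d n"
    unfolding n_def using steenrod_induced_hclass[OF f_proper mo] by (simp only:)
  then have pc_class: "pseudo_cycle_class d M ori Z f = hclass Xf d c"
    using c(3) unfolding pseudo_cycle_class_def Let_def image_closure_def Xf_def W_def Mo_def \<Omega>_def C_def by simp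

  have HX: "Hausdorff_space X" "compact_space X"
    using Z Hausdorff_space_subtopology XT compact_space_subtopology by (auto simp: X_def)
  have id_proper: "proper_continuous Xf X id"
    using CX by (intro proper_continuous_compact Xf(1) HX(1))
      (auto simp: X_def Xf_def continuous_map_in_subtopology continuous_map_from_subtopology)
  have fbar_proper: "proper_continuous Mbar X fbar"
    using assms(7) by (intro proper_continuous_compact Mbar(1) HX(1)) (auto simp: X_def continuous_map_in_subtopology)
  have A_sub: "?A \<subseteq> fbar ` topspace Mbar" by (auto simp: S_def)
  have AX: "closedin X ?A" unfolding X_def using Ac A_sub by (rule closedin_subset_topspace)
  have subA: "subtopology X ?A = subtopology Z ?A"
    unfolding X_def subtopology_subtopology inf.absorb2[OF A_sub] ..
  have acA: "infinite_cycles (subtopology X ?A) d \<subseteq> infinite_boundaries (subtopology X ?A) d"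
    unfolding subA using A Z Hausdorff_space_subtopology compact_space_subtopology dimA
    by (intro covering_dim_acyclic[where m = "int d - 2"]) auto

  \<comment> \<open>Restriction to the complement of \<open>?A\<close> is injective by
    \<open>acA\<close>, so only cochains supported off \<open>?A\<close> matter. On these both
    pushforwards agree exactly, and the zero chain serves as primitive.\<close>
  let ?e = "chain_pushforward Xf X d id c - chain_pushforward Mbar X d fbar a"
  have "?e \<in> infinite_boundaries X d"
  proof (rule restriction_injective[OF HX(2,1) AX acA])
    show "?e \<in> infinite_cycles X d"
      using pushforward_cycle[OF id_proper c(1)] pushforward_cycle[OF fbar_proper a(1)]
      by (rule subgrp_diff[OF subgrp_infinite_cycles])
    show "local_chain X (topspace X - ?A) (Suc d) (\<lambda>_. 0)" by (simp add: local_chain_def additive_on_def)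
    fix \<psi> assume \<psi>: "\<psi> \<in> cochains_in X (topspace X - ?A) d"
    then have \<psi>c: "\<psi> \<in> compact_cochains X d" and supp: "cochain_support X \<psi> \<inter> ?A = {}" by (auto simp: cochains_in_def)
    \<comment> \<open>Both evaluations end at the value of \<open>mo\<close> on this cochain. For
      \<open>c\<close> the way leads through \<open>W\<close>, as the support misses \<Omega>; for
      \<open>a\<close> it leads through \<open>M\<close>, as the support pulled back to
      \<open>Mbar\<close> misses \<open>S\<close>.\<close>
    let ?\<omega> = "cochain_pullback (subtopology M Mo) f \<psi>"
    have "cochain_pullback Xf id \<psi> \<in> cochains_in Xf W d"
      using pullback_compact[OF id_proper \<psi>c] pullback_support[of Xf X id \<psi>] id_proper supp \<Omega>A
      by (auto simp: cochains_in_def proper_continuous_def W_def)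
    from c(2)[OF this] have "c (cochain_pullback Xf id \<psi>) = n (restr Xf W (cochain_pullback Xf id \<psi>))" .
    also have "\<dots> = mo (cochain_pullback (subtopology M Mo) f (restr Xf W (cochain_pullback Xf id \<psi>)))"
    proof -
      have "restr Xf W (cochain_pullback Xf id \<psi>) \<in> compact_cochains (subtopology Xf W) d"
        using \<open>cochain_pullback Xf id \<psi> \<in> cochains_in Xf W d\<close> \<open>closedin Xf \<Omega>\<close> by (intro restr_compact) (auto simp: W_def)
      then show ?thesis by (simp add: n_def chain_pushforward_def)
    qed
    also have "cochain_pullback (subtopology M Mo) f (restr Xf W (cochain_pullback Xf id \<psi>)) = ?\<omega>"
    proof -
      have fW: "f ` topspace (subtopology M Mo) \<subseteq> topspace (subtopology Xf W)"
        using f_proper by (auto simp: proper_continuous_def continuous_map_def)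
      have "id ` topspace (subtopology Xf W) \<subseteq> topspace Xf" by auto
      then show ?thesis by (simp add: pullback_pullback[OF fW] pullback_pullback)
    qed
    finally have 1: "c (cochain_pullback Xf id \<psi>) = mo ?\<omega>" .
    have "x \<in> topspace M" if "x \<in> topspace Mbar" "fbar x \<in> cochain_support X \<psi>" for x
      using that supp by (auto simp: M_eq)
    then have \<psi>bar: "cochain_pullback Mbar fbar \<psi> \<in> cochains_in Mbar (topspace M) d"
      using pullback_compact[OF fbar_proper \<psi>c] pullback_support[of Mbar X fbar \<psi>] fbar_proper
      by (auto simp: cochains_in_def proper_continuous_def)
    have id_M: "id ` topspace (subtopology Mbar (topspace M)) \<subseteq> topspace Mbar" by auto
    have r: "restr Mbar (topspace M) (cochain_pullback Mbar fbar \<psi>) = cochain_pullback M f \<psi>"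
    proof -
      have "restr Mbar (topspace M) (cochain_pullback Mbar fbar \<psi>)
          = cochain_pullback (subtopology Mbar (topspace M)) (fbar \<circ> id) \<psi>"
        by (rule pullback_pullback[OF id_M])
      also have "\<dots> = cochain_pullback M f \<psi>"
        unfolding Mbar(4) using assms(8) by (intro pullback_cong) simp
      finally show ?thesis .
    qed
    \<comment> \<open>The preimage of the support lies in \<open>Mo\<close> since \<Omega> is
      contained in \<open>?A\<close>; therefore the value of \<open>m\<close> on the pullback can be
      read off from its restriction \<open>mo\<close>.\<close>
    have \<psi>M: "cochain_pullback M f \<psi> \<in> cochains_in M Mo d"
    proof -
      have "cochain_pullback M f \<psi> \<in> compact_cochains M d"
        using restr_compact[OF M_open \<psi>bar] r Mbar(4) by metis
      moreover have "continuous_map M X f"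
        using assms(5) image_mono[OF Mbar(3), of fbar]
        by (simp add: X_def continuous_map_in_subtopology f_eq image_subset_iff_funcset[symmetric])
      from pullback_support[OF this, of \<psi>] have "cochain_support M (cochain_pullback M f \<psi>) \<subseteq> Mo"
        using supp \<Omega>A by (auto simp: Mo_def)
      ultimately show ?thesis by (simp add: cochains_in_def)
    qed
    have "a (cochain_pullback Mbar fbar \<psi>) = m (cochain_pullback M f \<psi>)"
      using a(2)[OF \<psi>bar] by (simp only: r)
    also have "\<dots> = mo (restr M Mo (cochain_pullback M f \<psi>))"
      unfolding mo_def
      using chain_restriction_restr[OF extendable_open[OF Mo] chain_local_chain[OF infinite_cyclesD[OF m(1)]] \<psi>M] by simp
    also have "restr M Mo (cochain_pullback M f \<psi>) = ?\<omega>"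
      by (subst pullback_pullback) auto
    finally show "?e \<psi> = 0" using 1 \<psi>c by (simp add: chain_pushforward_def)
  qed
  then have "hclass X d (chain_pushforward Xf X d id c) = hclass X d (chain_pushforward Mbar X d fbar a)"
    by (simp add: hclass_eq_iff)
  then show "steenrod_induced (image_closure M Z f) (subtopology Z (fbar ` topspace Mbar)) d id
        (pseudo_cycle_class d M ori Z f)
      = steenrod_induced Mbar (subtopology Z (fbar ` topspace Mbar)) d fbar
        (thin_fundamental_class d M ori Mbar)"
    unfolding pc_class thin_class
    using steenrod_induced_hclass[OF id_proper c(1)] steenrod_induced_hclass[OF fbar_proper a(1)]
    by (simp add: X_def Xf_def C_def image_closure_def)
qed

end
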